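(* Let $c_0>0$ be a sufficiently large constant, let $1/2<\beta<1$, and suppose $c_0/n\leq p\leq n^{-\beta}$. Then there is $s=s(n)=\frac{2}{2\beta-1}+o(1)$ (as $n\to\infty$) and there are numbers $u,u',u''$ depending on $n$ and $p$ such that with probability $1-o(1)$ as $n\to\infty$, $$u\leq\bar\vartheta_{1/2}(G(n,p))\leq u+s,\quad u'\leq\bar\vartheta(G(n,p))\leq u'+s,\quad u''\leq\bar\vartheta_2(G(n,p))\leq u''+s.$$
   Context: $G(n,p)$ is the random graph on $V=\{1,\dots,n\}$ with each possible edge present independently with probability $p$. For a graph $G=(V,E)$ and a real $k>1$, an $n$-tuple $(v_1,\dots,v_n)$ of unit vectors in $\mathbb R^n$ is a vector $k$-coloring if $\langle v_i,v_j\rangle\leq-1/(k-1)$ for all $\{i,j\}\in E$; strict if $\langle v_i,v_j\rangle=-1/(k-1)$ for all $\{i,j\}\in E$; rigid if moreover (in addition to equality on edges) $\langle v_i,v_j\rangle\geq-1/(k-1)$ for all non-adjacent $i\neq j$. $\bar\vartheta_{1/2}(G)$ (the vector chromatic number), $\bar\vartheta(G)$, $\bar\vartheta_2(G)$ denote the infimum of $k>1$ such that $G$ admits a vector, strict vector, resp. rigid vector $k$-coloring. *)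

theory Defs
  imports "HOL-Analysis.Analysis"
begin

text \<open>Graphs on V = {1..n} are given by edge sets E, a set of 2-element subsets of {1..n}.
  Vectors in R^n are functions nat => real, of which only components 1..n are used.\<close>

definition all_edges :: "nat \<Rightarrow> nat set set" where
  "all_edges n = {{i, j} | i j. i \<in> {1..n} \<and> j \<in> {1..n} \<and> i \<noteq> j}"

definition gnp_prob :: "nat \<Rightarrow> real \<Rightarrow> (nat set set \<Rightarrow> bool) \<Rightarrow> real" where
  "gnp_prob n p P =
     (\<Sum>E\<in>Pow (all_edges n). if P E
        then p ^ card E * (1 - p) ^ (card (all_edges n) - card E) else 0)"

definition ip :: "nat \<Rightarrow> (nat \<Rightarrow> real) \<Rightarrow> (nat \<Rightarrow> real) \<Rightarrow> real" where
  "ip n x y = (\<Sum>l = 1..n. x l * y l)"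

definition unit_family :: "nat \<Rightarrow> (nat \<Rightarrow> nat \<Rightarrow> real) \<Rightarrow> bool" where
  "unit_family n v \<longleftrightarrow> (\<forall>i\<in>{1..n}. ip n (v i) (v i) = 1)"

definition vector_coloring :: "nat \<Rightarrow> nat set set \<Rightarrow> real \<Rightarrow> (nat \<Rightarrow> nat \<Rightarrow> real) \<Rightarrow> bool" where
  "vector_coloring n E k v \<longleftrightarrow> unit_family n v \<and>
     (\<forall>i\<in>{1..n}. \<forall>j\<in>{1..n}. {i, j} \<in> E \<longrightarrow> ip n (v i) (v j) \<le> - 1 / (k - 1))"

definition strict_vector_coloring :: "nat \<Rightarrow> nat set set \<Rightarrow> real \<Rightarrow> (nat \<Rightarrow> nat \<Rightarrow> real) \<Rightarrow> bool" where
  "strict_vector_coloring n E k v \<longleftrightarrow> unit_family n v \<and>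
     (\<forall>i\<in>{1..n}. \<forall>j\<in>{1..n}. {i, j} \<in> E \<longrightarrow> ip n (v i) (v j) = - 1 / (k - 1))"

definition rigid_vector_coloring :: "nat \<Rightarrow> nat set set \<Rightarrow> real \<Rightarrow> (nat \<Rightarrow> nat \<Rightarrow> real) \<Rightarrow> bool" where
  "rigid_vector_coloring n E k v \<longleftrightarrow> strict_vector_coloring n E k v \<and>
     (\<forall>i\<in>{1..n}. \<forall>j\<in>{1..n}. i \<noteq> j \<longrightarrow> {i, j} \<notin> E \<longrightarrow> ip n (v i) (v j) \<ge> - 1 / (k - 1))"

definition vtheta_half :: "nat \<Rightarrow> nat set set \<Rightarrow> real" where
  "vtheta_half n E = Inf {k. k > 1 \<and> (\<exists>v. vector_coloring n E k v)}"

definition vtheta :: "nat \<Rightarrow> nat set set \<Rightarrow> real" where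
  "vtheta n E = Inf {k. k > 1 \<and> (\<exists>v. strict_vector_coloring n E k v)}"

definition vtheta2 :: "nat \<Rightarrow> nat set set \<Rightarrow> real" where
  "vtheta2 n E = Inf {k. k > 1 \<and> (\<exists>v. rigid_vector_coloring n E k v)}"

end

theory Submission
  imports Defs
begin

text \<open>Let \<open>u\<close> be a low quantile of the parameter. Exposing the graph vertex by vertex, a second-moment
  version of Talagrand's convex distance inequality yields, with high probability, a probability
  distribution on vertex sets \<open>U\<close> whose deletion brings the parameter down to about \<open>u\<close>, such that
  the inclusion probabilities of the vertices have bounded square sum. Gram matrices can be averaged,
  and \<open>u\<close> is at most of order \<open>sqrt (n p)\<close> up to \<open>n\<close> to the power \<open>o(1)\<close>, so it suffices to delete the
  vertices whose inclusion probability exceeds \<open>o(1) / u\<close>; there are about \<open>n powr (1 - \<beta>)\<close> of them.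
  (Deleting a single set \<open>U\<close> would cost about \<open>sqrt n\<close> vertices, and sets of that size are too dense.)
  With \<open>x = 1 / (2 \<beta> - 1)\<close>, sets of the smaller size have average degree below \<open>1 + x + o(1)\<close>.
  If \<open>x \<ge> 2\<close>, they are colorable with at most \<open>2 x\<close> new colors. If \<open>x < 2\<close>, the set can be enlarged
  until its neighbourhood is independent; one new color for the neighbourhood then separates the set,
  which is 3-colorable, from the rest of the graph, and \<open>u + 2\<close> colors suffice.\<close>

section \<open>Bernoulli expectations\<close>

text \<open>Balance of exponents: if every kept vertex is deleted with probability at most
  \<open>\<eta>\<close>, averaging divides the parameter by \<open>1 - \<eta>\<close>, an increase
  of about \<open>\<eta> * u\<close>; this forces \<open>\<eta> = o(1) / u\<close>. Square sum at
  most \<open>4 / e\<close> leaves at most \<open>4 / (e * \<eta>\<^sup>2)\<close> vertices above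
  \<open>\<eta>\<close>, that is, \<open>u\<^sup>2\<close> up to n to the o(1). The bound on
  \<open>u\<close> comes from degrees and from codegrees, which are bounded because
  \<open>\<beta> > 1 / 2\<close>. Losing small powers of n is harmless, so \<open>e\<close> may be
  \<open>n powr (- \<kappa>)\<close>, and Chebyshev replaces Gaussian tails. A union bound shows
  that sets of size \<open>n powr \<sigma>\<close> span fewer than \<open>\<rho>\<close> edges per
  vertex once \<open>\<rho> > (1 - \<sigma>) / (\<beta> - \<sigma>)\<close>. At
  \<open>\<sigma> = 1 - \<beta>\<close> the threshold is
  \<open>\<beta> / (2 * \<beta> - 1) = (1 + x) / 2\<close>. At \<open>\<sigma> = 1 / 2\<close> it
  would be \<open>x\<close>, and greedy coloring at that density needs more than
  \<open>2 * x\<close> colors. For \<open>x\<close> near 1 even the smaller sets may need 3 >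
  \<open>2 * x\<close> new colors, so there old colors must be reused on the deleted set.\<close>

definition bexp :: "'a set \<Rightarrow> real \<Rightarrow> ('a set \<Rightarrow> real) \<Rightarrow> real" where
  "bexp A p f = (\<Sum>E\<in>Pow A. p ^ card E * (1 - p) ^ (card A - card E) * f E)"

definition bprob :: "'a set \<Rightarrow> real \<Rightarrow> ('a set \<Rightarrow> bool) \<Rightarrow> real" where
  "bprob A p P = bexp A p (\<lambda>E. of_bool (P E))"

lemma bexp_cong:
  assumes "A = B" "\<And>E. E \<subseteq> B \<Longrightarrow> f E = g E"
  shows "bexp A p f = bexp B p g"
  unfolding bexp_def using assms by (intro sum.cong) auto

lemma bexp_add: "bexp A p (\<lambda>E. f E + g E) = bexp A p f + bexp A p g"
  unfolding bexp_def by (simp add: ring_distribs sum.distrib)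

lemma bexp_cmult: "bexp A p (\<lambda>E. c * f E) = c * bexp A p f"
  unfolding bexp_def by (simp add: sum_distrib_left mult_ac)

lemma bexp_sum: "bexp A p (\<lambda>E. \<Sum>i\<in>I. f i E) = (\<Sum>i\<in>I. bexp A p (f i))"
  unfolding bexp_def by (simp add: sum_distrib_left) (rule sum.swap)

lemma bexp_mono:
  assumes "0 \<le> p" "p \<le> 1" "\<And>E. E \<subseteq> A \<Longrightarrow> f E \<le> g E"
  shows "bexp A p f \<le> bexp A p g"
  unfolding bexp_def using assms by (intro sum_mono mult_left_mono) auto

lemma bexp_empty [simp]: "bexp {} p f = f {}"
  by (simp add: bexp_def)

lemma bexp_singleton: "bexp {a} p f = (1 - p) * f {} + p * f {a}"
  by (simp add: bexp_def Pow_insert)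

text \<open>Fubini for independent coordinates: subsets of a disjoint union split uniquely and the
  exponents of \<open>p\<close> and \<open>1 - p\<close> add.\<close>

lemma bexp_Un:
  assumes fin: "finite A" "finite B" and disj: "A \<inter> B = {}"
  shows "bexp (A \<union> B) p f = bexp A p (\<lambda>E. bexp B p (\<lambda>F. f (E \<union> F)))"
proof -
  let ?w = "\<lambda>A E. p ^ card E * (1 - p) ^ (card A - card E)"
  have bij: "bij_betw (\<lambda>(E, F). E \<union> F) (Pow A \<times> Pow B) (Pow (A \<union> B))"
  proof (rule bij_betwI)
    show "(\<lambda>(E, F). E \<union> F) \<in> Pow A \<times> Pow B \<rightarrow> Pow (A \<union> B)" by auto
    show "(\<lambda>E. (E \<inter> A, E \<inter> B)) \<in> Pow (A \<union> B) \<rightarrow> Pow A \<times> Pow B" by auto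
  qed (use disj in auto)
  have w: "?w (A \<union> B) (E \<union> F) = ?w A E * ?w B F" if "E \<subseteq> A" "F \<subseteq> B" for E F
  proof -
    have "finite E" "finite F" "E \<inter> F = {}" using that fin disj finite_subset by blast+
    then have 1: "card (E \<union> F) = card E + card F" by (rule card_Un_disjoint)
    have 2: "card (A \<union> B) = card A + card B" using fin disj by (rule card_Un_disjoint)
    have "card E \<le> card A" "card F \<le> card B" using that fin by (auto intro: card_mono)
    then have "card A + card B - (card E + card F) = (card A - card E) + (card B - card F)" by simp
    then show ?thesis by (simp only: 1 2 power_add mult_ac)
  qed
  have "bexp (A \<union> B) p f = (\<Sum>(E, F)\<in>Pow A \<times> Pow B. ?w (A \<union> B) (E \<union> F) * f (E \<union> F))"
    unfolding bexp_def using sum.reindex_bij_betw[OF bij, of "\<lambda>E. ?w (A \<union> B) E * f E", symmetric]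
    by (simp add: case_prod_unfold)
  also have "\<dots> = (\<Sum>(E, F)\<in>Pow A \<times> Pow B. ?w A E * (?w B F * f (E \<union> F)))"
    by (intro sum.cong) (auto simp: w)
  also have "\<dots> = bexp A p (\<lambda>E. bexp B p (\<lambda>F. f (E \<union> F)))"
    unfolding bexp_def by (simp add: sum.cartesian_product sum_distrib_left)
  finally show ?thesis .
qed

lemma bexp_const:
  assumes "finite A" shows "bexp A p (\<lambda>E. c) = c"
  using assms
proof induction
  case (insert a A)
  have "bexp (insert a A) p (\<lambda>E. c) = bexp ({a} \<union> A) p (\<lambda>E. c)" by simp
  also have "\<dots> = c" using insert by (subst bexp_Un) (auto simp: bexp_singleton algebra_simps)
  finally show ?case .
qed simp

lemma bexp_diff: "bexp A p (\<lambda>E. f E - g E) = bexp A p f - bexp A p g"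
  unfolding bexp_def by (simp add: ring_distribs sum_subtractf)

text \<open>Variance plus squared bias; the cross term is a multiple of the centred mean and
  vanishes. Hence the mean is the best constant approximation, the fact behind Efron--Stein.\<close>

lemma bexp_square_diff:
  assumes "finite A"
  shows "bexp A p (\<lambda>E. (f E - c)\<^sup>2) = bexp A p (\<lambda>E. (f E - bexp A p f)\<^sup>2) + (bexp A p f - c)\<^sup>2"
proof -
  let ?m = "bexp A p f"
  have "bexp A p (\<lambda>E. (f E - c)\<^sup>2)
      = bexp A p (\<lambda>E. (f E - ?m)\<^sup>2 + (2 * (?m - c) * (f E - ?m) + (?m - c)\<^sup>2))"
    by (intro bexp_cong refl) (simp add: power2_eq_square algebra_simps)
  then show ?thesis
    by (simp add: bexp_add bexp_cmult bexp_diff bexp_const[OF assms])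
qed

lemma bexp_square_ge:
  assumes "finite A" "0 \<le> p" "p \<le> 1"
  shows "(bexp A p f - c)\<^sup>2 \<le> bexp A p (\<lambda>E. (f E - c)\<^sup>2)"
proof -
  have "bexp A p (\<lambda>E. 0) \<le> bexp A p (\<lambda>E. (f E - bexp A p f)\<^sup>2)"
    by (rule bexp_mono) (use assms in auto)
  then show ?thesis
    using bexp_square_diff[OF assms(1), of p f c] bexp_const[OF assms(1), of p 0] by simp
qed

text \<open>The last hypothesis says that \<open>g i\<close> ignores block \<open>i\<close>.
  Induction on the blocks: averaging over block \<open>j\<close> splits the variance into the
  variance inside that block, which is at most the mean square of \<open>f - g j\<close> because
  \<open>g j\<close> is constant there, and the variance of the averaged function. The latter is
  handled by the induction hypothesis with averaged \<open>g i\<close>, and averaging only decreases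
  squares (Jensen).\<close>

lemma efron_stein:
  assumes "finite I" "\<And>i. i \<in> I \<Longrightarrow> finite (B i)" "disjoint_family_on B I"
    and "0 \<le> p" "p \<le> 1"
    and "\<And>i E. i \<in> I \<Longrightarrow> g i (E - B i) = g i E"
  shows "bexp (\<Union>i\<in>I. B i) p (\<lambda>E. (f E - bexp (\<Union>i\<in>I. B i) p f)\<^sup>2)
    \<le> (\<Sum>i\<in>I. bexp (\<Union>i\<in>I. B i) p (\<lambda>E. (f E - g i E)\<^sup>2))"
  using assms(1,2,3,6)
proof (induction arbitrary: f g)
  case (insert j I)
  note p = assms(4,5)
  define A where "A = (\<Union>i\<in>I. B i)"
  define \<phi> where "\<phi> E = bexp (B j) p (\<lambda>F. f (E \<union> F))" for E
  define h where "h i E = bexp (B j) p (\<lambda>F. g i (E \<union> F))" for i E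
  have fin: "finite A" "finite (B j)" using insert unfolding A_def by auto
  have "B i \<inter> B j = {}" if "i \<in> I" for i
    using disjoint_family_onD[OF insert.prems(2), of i j] insert.hyps that by auto
  then have disj: "A \<inter> B j = {}" unfolding A_def by auto
  have eq: "bexp (\<Union>i\<in>insert j I. B i) p F = bexp A p (\<lambda>E. bexp (B j) p (\<lambda>F'. F (E \<union> F')))" for F
    using bexp_Un[OF fin disj, of p F] by (simp add: A_def Un_commute)
  define m where "m = bexp A p \<phi>"
  have m: "bexp (\<Union>i\<in>insert j I. B i) p f = m" by (simp only: eq m_def \<phi>_def[abs_def])
  have IH: "bexp A p (\<lambda>E. (\<phi> E - m)\<^sup>2) \<le> (\<Sum>i\<in>I. bexp A p (\<lambda>E. (\<phi> E - h i E)\<^sup>2))"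
    unfolding m_def A_def
  proof (rule insert.IH)
    show "disjoint_family_on B I" using insert.prems(2) by (rule disjoint_family_on_mono[rotated]) auto
  next
    fix i E assume i: "i \<in> I"
    have "g i ((E - B i) \<union> F) = g i (E \<union> F)" for F
      using insert.prems(3)[of i "(E - B i) \<union> F"] insert.prems(3)[of i "E \<union> F"] i
      by (metis Un_Diff Diff_idemp insertCI)
    then show "h i (E - B i) = h i E" by (simp add: h_def)
  qed (use insert in auto)
  have split: "bexp (B j) p (\<lambda>F. (f (E \<union> F) - m)\<^sup>2)
      = bexp (B j) p (\<lambda>F. (f (E \<union> F) - \<phi> E)\<^sup>2) + (\<phi> E - m)\<^sup>2" for E
    unfolding \<phi>_def using fin(2) by (rule bexp_square_diff)
  have jpart: "bexp (B j) p (\<lambda>F. (f (E \<union> F) - \<phi> E)\<^sup>2) \<le> bexp (B j) p (\<lambda>F. (f (E \<union> F) - g j (E \<union> F))\<^sup>2)"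
    if "E \<subseteq> A" for E
  proof -
    have "g j (E \<union> F) = g j E" if "F \<subseteq> B j" for F
      using insert.prems(3)[of j "E \<union> F"] insert.prems(3)[of j E] that
      by (metis Un_Diff Diff_eq_empty_iff insertI1 sup_bot.right_neutral)
    then have "bexp (B j) p (\<lambda>F. (f (E \<union> F) - g j (E \<union> F))\<^sup>2) = bexp (B j) p (\<lambda>F. (f (E \<union> F) - g j E)\<^sup>2)"
      by (intro bexp_cong) auto
    also have "\<dots> = bexp (B j) p (\<lambda>F. (f (E \<union> F) - \<phi> E)\<^sup>2) + (\<phi> E - g j E)\<^sup>2"
      unfolding \<phi>_def using fin(2) by (rule bexp_square_diff)
    finally show ?thesis by simp
  qed
  have ipart: "(\<phi> E - h i E)\<^sup>2 \<le> bexp (B j) p (\<lambda>F. (f (E \<union> F) - g i (E \<union> F))\<^sup>2)" for i E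
    unfolding \<phi>_def h_def bexp_diff[symmetric]
    using bexp_square_ge[OF fin(2) p, of "\<lambda>F. f (E \<union> F) - g i (E \<union> F)" 0] by simp
  have "bexp (\<Union>i\<in>insert j I. B i) p (\<lambda>E. (f E - m)\<^sup>2)
      = bexp A p (\<lambda>E. bexp (B j) p (\<lambda>F. (f (E \<union> F) - \<phi> E)\<^sup>2)) + bexp A p (\<lambda>E. (\<phi> E - m)\<^sup>2)"
    by (simp only: eq split bexp_add)
  also have "\<dots> \<le> bexp A p (\<lambda>E. bexp (B j) p (\<lambda>F. (f (E \<union> F) - g j (E \<union> F))\<^sup>2))
      + (\<Sum>i\<in>I. bexp A p (\<lambda>E. bexp (B j) p (\<lambda>F. (f (E \<union> F) - g i (E \<union> F))\<^sup>2)))"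
    by (intro add_mono order.trans[OF IH] sum_mono bexp_mono p jpart ipart)
  also have "\<dots> = (\<Sum>i\<in>insert j I. bexp (\<Union>i\<in>insert j I. B i) p (\<lambda>E. (f E - g i E)\<^sup>2))"
    unfolding eq using insert.hyps by simp
  finally show ?case by (simp only: m)
qed simp

section \<open>Probabilities of events: union bounds, Markov, Chebyshev\<close>

lemma bprob_mono:
  assumes "0 \<le> p" "p \<le> 1" "\<And>E. E \<subseteq> A \<Longrightarrow> P E \<Longrightarrow> Q E"
  shows "bprob A p P \<le> bprob A p Q"
  unfolding bprob_def using assms by (intro bexp_mono) auto

lemma bprob_nonneg:
  assumes "0 \<le> p" "p \<le> 1" shows "0 \<le> bprob A p P"
  unfolding bprob_def bexp_def using assms by (intro sum_nonneg) auto

lemma bprob_not: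
  assumes "finite A" shows "bprob A p (\<lambda>E. \<not> P E) = 1 - bprob A p P"
proof -
  have "bexp A p (\<lambda>E. of_bool (\<not> P E)) = bexp A p (\<lambda>E. 1 - of_bool (P E))"
    by (intro bexp_cong) auto
  then show ?thesis using assms by (simp add: bprob_def bexp_diff bexp_const)
qed

lemma bprob_le_1:
  assumes "finite A" "0 \<le> p" "p \<le> 1" shows "bprob A p P \<le> 1"
  using bprob_not[OF assms(1), of p P] bprob_nonneg[OF assms(2,3), of A "\<lambda>E. \<not> P E"] by simp

lemma bprob_disj:
  assumes "0 \<le> p" "p \<le> 1"
  shows "bprob A p (\<lambda>E. P E \<or> Q E) \<le> bprob A p P + bprob A p Q"
  unfolding bprob_def bexp_add[symmetric] using assms by (intro bexp_mono) auto

lemma bprob_subset: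
  assumes "finite A" "F \<subseteq> A" shows "bprob A p (\<lambda>E. F \<subseteq> E) = p ^ card F"
proof -
  have finF: "finite F" using assms finite_subset by blast
  have A: "A = F \<union> (A - F)" using assms(2) by auto
  have "bprob A p (\<lambda>E. F \<subseteq> E)
      = bexp F p (\<lambda>E. bexp (A - F) p (\<lambda>E'. of_bool (F \<subseteq> E \<union> E')))"
    unfolding bprob_def by (subst A, subst bexp_Un) (use assms finF in auto)
  also have "\<dots> = bexp F p (\<lambda>E. of_bool (E = F))"
  proof (intro bexp_cong refl)
    fix E assume "E \<subseteq> F"
    then have "bexp (A - F) p (\<lambda>E'. of_bool (F \<subseteq> E \<union> E')) = bexp (A - F) p (\<lambda>E'. of_bool (E = F))"
      by (intro bexp_cong) auto
    then show "bexp (A - F) p (\<lambda>E'. of_bool (F \<subseteq> E \<union> E')) = of_bool (E = F)"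
      using assms(1) by (simp add: bexp_const)
  qed
  also have "\<dots> = (\<Sum>E\<in>{F}. p ^ card E * (1 - p) ^ (card F - card E) * of_bool (E = F))"
    unfolding bexp_def using finF by (intro sum.mono_neutral_right) auto
  finally show ?thesis by simp
qed

lemma bprob_ex_le_sum:
  assumes "finite I" "0 \<le> p" "p \<le> 1"
  shows "bprob A p (\<lambda>E. \<exists>i\<in>I. P i E) \<le> (\<Sum>i\<in>I. bprob A p (P i))"
proof -
  have "bprob A p (\<lambda>E. \<exists>i\<in>I. P i E) \<le> bexp A p (\<lambda>E. \<Sum>i\<in>I. of_bool (P i E))"
    unfolding bprob_def
  proof (intro bexp_mono assms)
    fix E
    show "of_bool (\<exists>i\<in>I. P i E) \<le> (\<Sum>i\<in>I. of_bool (P i E) :: real)"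
    proof (cases "\<exists>i\<in>I. P i E")
      case True
      then obtain i where i: "i \<in> I" "P i E" by auto
      then have "of_bool (P i E) \<le> (\<Sum>i\<in>I. of_bool (P i E) :: real)"
        by (intro member_le_sum) (use assms in auto)
      then show ?thesis using i by auto
    qed (simp add: sum_nonneg)
  qed
  then show ?thesis by (simp add: bexp_sum bprob_def)
qed

lemma bprob_ex_subset:
  assumes "finite A" "\<And>F. F \<in> \<F> \<Longrightarrow> F \<subseteq> A" and p: "0 \<le> p" "p \<le> 1"
  shows "bprob A p (\<lambda>E. \<exists>F\<in>\<F>. F \<subseteq> E) \<le> (\<Sum>F\<in>\<F>. p ^ card F)"
proof -
  have fin: "finite \<F>" using assms(1,2) by (meson PowI finite_Pow_iff finite_subset subsetI)
  have "bprob A p (\<lambda>E. \<exists>F\<in>\<F>. F \<subseteq> E) \<le> (\<Sum>F\<in>\<F>. bprob A p (\<lambda>E. F \<subseteq> E))"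
    by (rule bprob_ex_le_sum[OF fin p])
  also have "\<dots> = (\<Sum>F\<in>\<F>. p ^ card F)"
    by (intro sum.cong refl bprob_subset assms(1,2))
  finally show ?thesis .
qed

lemma bexp_markov:
  assumes "0 \<le> p" "p \<le> 1" "0 < t" "\<And>E. E \<subseteq> A \<Longrightarrow> 0 \<le> h E"
  shows "t * bprob A p (\<lambda>E. t \<le> h E) \<le> bexp A p h"
  unfolding bprob_def bexp_cmult[symmetric] using assms by (intro bexp_mono) auto

text \<open>If the nonnegative variable f vanishes with probability at least eps, then Chebyshev's
  inequality first bounds its mean and then its upper tail.\<close>

lemma bprob_upper_tail:
  assumes A: "finite A" and p: "0 \<le> p" "p \<le> 1" and e: "0 < e"
    and nonneg: "\<And>E. E \<subseteq> A \<Longrightarrow> 0 \<le> f E"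
    and var: "bexp A p (\<lambda>E. (f E - bexp A p f)\<^sup>2) \<le> 1"
    and zero: "e \<le> bprob A p (\<lambda>E. f E = 0)"
  shows "bprob A p (\<lambda>E. 2 / sqrt e < f E) \<le> e"
proof -
  define m where "m = bexp A p f"
  have m0: "0 \<le> m" unfolding m_def using bexp_mono[OF p, of A "\<lambda>_. 0" f] nonneg bexp_const[OF A] by simp
  have "e * m\<^sup>2 \<le> m\<^sup>2 * bprob A p (\<lambda>E. f E = 0)"
    using mult_right_mono[OF zero, of "m\<^sup>2"] by (simp add: mult.commute)
  also have "\<dots> \<le> bexp A p (\<lambda>E. (f E - m)\<^sup>2)"
    unfolding bprob_def bexp_cmult[symmetric] by (intro bexp_mono p) auto
  also have "\<dots> \<le> 1" using var by (simp add: m_def)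
  finally have "m\<^sup>2 \<le> 1 / e" using e by (simp add: field_simps)
  then have m: "m \<le> 1 / sqrt e" using m0 by (metis real_le_rsqrt real_sqrt_divide real_sqrt_one)
  \<comment> \<open>The mean is at most \<open>1 / sqrt e\<close>, so exceeding twice that is a
    deviation by at least \<open>1 / sqrt e\<close>.\<close>
  have "(1 / e) * bprob A p (\<lambda>E. 2 / sqrt e < f E) \<le> (1 / e) * bprob A p (\<lambda>E. 1 / e \<le> (f E - m)\<^sup>2)"
  proof (intro mult_left_mono bprob_mono p)
    fix E assume "2 / sqrt e < f E"
    moreover have "0 \<le> 1 / sqrt e" using e by simp
    ultimately have "1 / sqrt e \<le> f E - m" using m by linarith
    then have "(1 / sqrt e)\<^sup>2 \<le> (f E - m)\<^sup>2" using \<open>0 \<le> 1 / sqrt e\<close> by (rule power_mono)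
    then show "1 / e \<le> (f E - m)\<^sup>2" using e by (simp add: power_divide)
  qed (use e in auto)
  also have "\<dots> \<le> bexp A p (\<lambda>E. (f E - m)\<^sup>2)"
    by (rule bexp_markov) (use e p in auto)
  also have "\<dots> \<le> 1" using var by (simp add: m_def)
  finally show ?thesis using e by (simp add: field_simps)
qed

section \<open>Distance to the hull of admissible deletion sets\<close>

text \<open>Pinning the weights to 0 outside \<open>F\<close> makes the set a product of compact
  sets over the whole index type, cut by a closed hyperplane, so Tychonoff applies.\<close>

lemma compact_simplex:
  fixes F :: "'b set"
  assumes "finite F"
  shows "compact {w :: 'b \<Rightarrow> real. (\<forall>u\<in>F. 0 \<le> w u \<and> w u \<le> 1) \<and> (\<forall>u. u \<notin> F \<longrightarrow> w u = 0) \<and> sum w F = 1}"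
proof -
  let ?S = "\<lambda>u. if u \<in> F then {0..1::real} else {0}"
  have "compactin (product_topology (\<lambda>_. euclidean) UNIV) (PiE UNIV ?S)"
    unfolding compactin_PiE by (auto simp: compact_Icc)
  then have "compact (PiE UNIV ?S)"
    by (simp add: euclidean_product_topology)
  moreover have "closed {w :: 'b \<Rightarrow> real. sum w F = 1}"
    by (intro closed_Collect_eq continuous_intros continuous_on_product_coordinates)
  ultimately have "compact (PiE UNIV ?S \<inter> {w. sum w F = 1})"
    by (rule compact_Int_closed)
  also have "PiE UNIV ?S \<inter> {w. sum w F = 1}
      = {w. (\<forall>u\<in>F. 0 \<le> w u \<and> w u \<le> 1) \<and> (\<forall>u. u \<notin> F \<longrightarrow> w u = 0) \<and> sum w F = 1}"
    by (auto simp: PiE_def Pi_def split: if_splits)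
  finally show ?thesis .
qed

text \<open>First-order optimality of the projection of the origin onto the convex hull of the
  \<open>a u\<close>: the hull lies beyond the hyperplane through the nearest point. The
  minimisation runs over weights, not over points of the hull, because the weights serve later to
  average Gram matrices.\<close>

lemma min_norm_point_hull:
  fixes a :: "'b \<Rightarrow> 'i \<Rightarrow> real"
  assumes F: "finite F" "F \<noteq> {}"
  obtains w where "\<And>u. u \<in> F \<Longrightarrow> 0 \<le> w u" "sum w F = 1"
    "\<And>u. u \<in> F \<Longrightarrow> (\<Sum>i\<in>V. (\<Sum>t\<in>F. w t * a t i)\<^sup>2) \<le> (\<Sum>i\<in>V. (\<Sum>t\<in>F. w t * a t i) * a u i)"
proof -
  define S where "S = {w :: 'b \<Rightarrow> real. (\<forall>u\<in>F. 0 \<le> w u \<and> w u \<le> 1) \<and> (\<forall>u. u \<notin> F \<longrightarrow> w u = 0) \<and> sum w F = 1}"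
  define \<delta> where "\<delta> w i = (\<Sum>t\<in>F. w t * a t i)" for w :: "'b \<Rightarrow> real" and i
  have "compact S" unfolding S_def using F(1) by (rule compact_simplex)
  moreover have "S \<noteq> {}"
  proof -
    obtain u where "u \<in> F" using F by auto
    then have "(\<lambda>t. of_bool (t = u)) \<in> S" using F(1) by (auto simp: S_def sum.delta of_bool_def)
    then show ?thesis by auto
  qed
  moreover have "continuous_on S (\<lambda>w. \<Sum>i\<in>V. (\<delta> w i)\<^sup>2)"
    unfolding \<delta>_def
    by (intro continuous_intros continuous_on_subset[OF continuous_on_product_coordinates]) auto
  ultimately obtain w where w: "w \<in> S" and min: "\<And>w'. w' \<in> S \<Longrightarrow> (\<Sum>i\<in>V. (\<delta> w i)\<^sup>2) \<le> (\<Sum>i\<in>V. (\<delta> w' i)\<^sup>2)"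
    using continuous_attains_inf[of S "\<lambda>w. \<Sum>i\<in>V. (\<delta> w i)\<^sup>2"] by blast
  have "(\<Sum>i\<in>V. (\<delta> w i)\<^sup>2) \<le> (\<Sum>i\<in>V. \<delta> w i * a u i)" if u: "u \<in> F" for u
  proof -
    define c where "c = (\<Sum>i\<in>V. \<delta> w i * (a u i - \<delta> w i))"
    define d where "d = (\<Sum>i\<in>V. (a u i - \<delta> w i)\<^sup>2)"
    \<comment> \<open>Moving the weights by a fraction \<open>s\<close> towards \<open>u\<close>
      changes the squared norm by \<open>s * (2 * c + s * d)\<close>.\<close>
    have ineq: "0 \<le> 2 * c + s * d" if s: "0 < s" "s \<le> 1" for s
    proof -
      define w' where "w' t = (1 - s) * w t + s * of_bool (t = u)" for t
      have sum: "(\<Sum>t\<in>F. of_bool (t = u) * f t) = f u" for f :: "'b \<Rightarrow> real"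
        using u F(1) by (simp add: of_bool_def if_distrib[of "\<lambda>x. x * _"] sum.delta cong: if_cong)
      have "sum w' F = 1"
        using w sum[of "\<lambda>_. 1"] by (simp add: w'_def sum.distrib sum_distrib_left[symmetric] S_def)
      moreover have "0 \<le> w' t \<and> w' t \<le> 1" if "t \<in> F" for t
      proof -
        have "0 \<le> w t" "w t \<le> 1" using w that by (auto simp: S_def)
        then have "(1 - s) * w t \<le> (1 - s) * 1" "0 \<le> (1 - s) * w t"
          using s by (intro mult_left_mono mult_nonneg_nonneg; simp)+
        then show ?thesis using s by (auto simp: w'_def)
      qed
      ultimately have "w' \<in> S" using w u by (auto simp: S_def w'_def)
      have \<delta>': "\<delta> w' i = \<delta> w i + s * (a u i - \<delta> w i)" for i
      proof -
        have "\<delta> w' i = (\<Sum>t\<in>F. (1 - s) * (w t * a t i) + s * (of_bool (t = u) * a t i))"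
          unfolding \<delta>_def w'_def by (intro sum.cong) (auto simp: algebra_simps)
        also have "\<dots> = (1 - s) * \<delta> w i + s * a u i"
          by (simp only: sum.distrib sum_distrib_left[symmetric] sum \<delta>_def)
        finally show ?thesis by (simp add: algebra_simps)
      qed
      have "(\<Sum>i\<in>V. (\<delta> w' i)\<^sup>2) = (\<Sum>i\<in>V. (\<delta> w i)\<^sup>2 + 2 * s * (\<delta> w i * (a u i - \<delta> w i)) + s\<^sup>2 * (a u i - \<delta> w i)\<^sup>2)"
        by (intro sum.cong) (auto simp: \<delta>' power2_eq_square algebra_simps)
      also have "\<dots> = (\<Sum>i\<in>V. (\<delta> w i)\<^sup>2) + s * (2 * c + s * d)"
        unfolding c_def d_def
        by (simp only: sum.distrib sum_distrib_left[symmetric]) (simp add: algebra_simps power2_eq_square)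
      finally have "0 \<le> s * (2 * c + s * d)" using min[OF \<open>w' \<in> S\<close>] by simp
      then show ?thesis using s by (simp add: zero_le_mult_iff)
    qed
    have "0 \<le> c"
    proof (rule ccontr)
      assume "\<not> 0 \<le> c"
      \<comment> \<open>Small enough that \<open>s * d \<le> - c\<close>; then
        \<open>2 * c + s * d \<le> c < 0\<close> contradicts minimality.\<close>
      define s where "s = min 1 (- c / (d + 1))"
      have d: "0 \<le> d" unfolding d_def by (simp add: sum_nonneg)
      have s: "0 < s" "s \<le> 1" using \<open>\<not> 0 \<le> c\<close> d by (auto simp: s_def divide_neg_pos)
      have "s * d \<le> (- c / (d + 1)) * d" using d by (intro mult_right_mono) (auto simp: s_def)
      also have "\<dots> \<le> - c" using \<open>\<not> 0 \<le> c\<close> d by (simp add: field_simps)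
      finally show False using ineq[OF s] \<open>\<not> 0 \<le> c\<close> by linarith
    qed
    then show ?thesis by (simp add: c_def right_diff_distrib sum_subtractf power2_eq_square)
  qed
  then show ?thesis using that[of w] w by (auto simp: S_def \<delta>_def)
qed

lemma sum_le_sqrt_sum_squares:
  fixes x y :: "'i \<Rightarrow> real"
  assumes "(\<Sum>i\<in>V. (x i)\<^sup>2) \<le> 1"
  shows "(\<Sum>i\<in>V. x i * y i) \<le> sqrt (\<Sum>i\<in>V. (y i)\<^sup>2)"
proof -
  have "(\<Sum>i\<in>V. x i * y i)\<^sup>2 \<le> (\<Sum>i\<in>V. (x i)\<^sup>2) * (\<Sum>i\<in>V. (y i)\<^sup>2)"
    by (rule Cauchy_Schwarz_ineq_sum)
  also have "\<dots> \<le> 1 * (\<Sum>i\<in>V. (y i)\<^sup>2)"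
    using assms by (intro mult_right_mono) (auto intro: sum_nonneg)
  finally show ?thesis by (simp add: real_le_rsqrt)
qed

text \<open>A second-moment version of Talagrand's convex distance inequality. The distance f of the hull
  of the admissible sets from 0 changes by at most \<open>\<alpha> i\<close> when block i is resampled, where
  \<open>\<alpha>\<close> is the unit vector pointing to the closest point; hence Efron--Stein gives variance at most 1.\<close>

lemma convex_distance_tail:
  fixes B :: "'i \<Rightarrow> 'a set" and \<U> :: "'a set \<Rightarrow> 'i set set"
  assumes I: "finite I" and B: "\<And>i. i \<in> I \<Longrightarrow> finite (B i)" "disjoint_family_on B I"
    and A: "A = (\<Union>i\<in>I. B i)" and p: "0 \<le> p" "p \<le> 1" and e: "0 < e"
    and \<U>: "\<And>E. E \<subseteq> A \<Longrightarrow> \<U> E \<subseteq> Pow I" "\<And>E. E \<subseteq> A \<Longrightarrow> \<U> E \<noteq> {}"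
    and ins: "\<And>E E' i U. E \<subseteq> A \<Longrightarrow> E' \<subseteq> A \<Longrightarrow> i \<in> I \<Longrightarrow> E - B i = E' - B i \<Longrightarrow> U \<in> \<U> E' \<Longrightarrow> insert i U \<in> \<U> E"
    and zero: "e \<le> bprob A p (\<lambda>E. {} \<in> \<U> E)"
  shows "bprob A p (\<lambda>E. \<not> (\<exists>w. (\<forall>U\<in>\<U> E. 0 \<le> w U) \<and> sum w (\<U> E) = 1 \<and>
      (\<Sum>i\<in>I. (\<Sum>U\<in>\<U> E. w U * of_bool (i \<in> U))\<^sup>2) \<le> 4 / e)) \<le> e"
proof -
  have finA: "finite A" using I B A by auto
  have fin\<U>: "finite (\<U> E)" if "E \<subseteq> A" for E
    using \<U>(1)[OF that] I by (meson finite_Pow_iff finite_subset)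
  define good where "good E w \<longleftrightarrow> (\<forall>U\<in>\<U> E. 0 \<le> w U) \<and> sum w (\<U> E) = 1 \<and>
    (\<forall>U\<in>\<U> E. (\<Sum>i\<in>I. (\<Sum>t\<in>\<U> E. w t * of_bool (i \<in> t))\<^sup>2)
       \<le> (\<Sum>i\<in>I. (\<Sum>t\<in>\<U> E. w t * of_bool (i \<in> t)) * of_bool (i \<in> U)))" for E and w :: "'i set \<Rightarrow> real"
  define W where "W E = (SOME w. good E w)" for E
  have W: "good E (W E)" if E: "E \<subseteq> A" for E
  proof -
    have "\<exists>w. good E w"
      by (rule min_norm_point_hull[OF fin\<U>[OF E] \<U>(2)[OF E], where a = "\<lambda>t i. of_bool (i \<in> t)" and V = I])
        (unfold good_def, blast)
    then show ?thesis unfolding W_def by (rule someI_ex)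
  qed
  define \<delta> where "\<delta> E i = (\<Sum>t\<in>\<U> E. W E t * of_bool (i \<in> t))" for E i
  define f where "f E = sqrt (\<Sum>i\<in>I. (\<delta> E i)\<^sup>2)" for E
  have f0: "0 \<le> f E" for E by (simp add: f_def sum_nonneg)
  have fsq: "(f E)\<^sup>2 = (\<Sum>i\<in>I. (\<delta> E i)\<^sup>2)" for E by (simp add: f_def sum_nonneg)
  \<comment> \<open>If \<open>f E = 0\<close>, the quotient is the zero vector, and the bounds
    \<open>\<alpha>1\<close> and \<open>\<alpha>f\<close> remain true.\<close>
  define \<alpha> where "\<alpha> E i = \<delta> E i / f E" for E i
  have \<delta>0: "0 \<le> \<delta> E i" if "E \<subseteq> A" for E i
    unfolding \<delta>_def using W[OF that] by (intro sum_nonneg mult_nonneg_nonneg) (auto simp: good_def)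
  have \<alpha>0: "0 \<le> \<alpha> E i" if "E \<subseteq> A" for E i using \<delta>0[OF that] f0 by (simp add: \<alpha>_def)
  have \<alpha>1: "(\<Sum>i\<in>I. (\<alpha> E i)\<^sup>2) \<le> 1" for E
    using fsq[of E] by (simp add: \<alpha>_def power_divide sum_divide_distrib[symmetric])
  have \<alpha>f: "f E \<le> (\<Sum>i\<in>I. \<alpha> E i * of_bool (i \<in> U))" if E: "E \<subseteq> A" and U: "U \<in> \<U> E" for E U
  proof (cases "f E = 0")
    case True then show ?thesis by (simp add: \<alpha>_def)
  next
    case False
    then have pos: "0 < f E" using f0[of E] by simp
    have "f E * f E \<le> (\<Sum>i\<in>I. \<delta> E i * of_bool (i \<in> U))"
      using W[OF E] U fsq[of E] by (simp add: good_def \<delta>_def power2_eq_square)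
    then have "f E \<le> (\<Sum>i\<in>I. \<delta> E i * of_bool (i \<in> U)) / f E"
      using pos by (simp add: pos_le_divide_eq)
    then show ?thesis by (simp add: \<alpha>_def sum_divide_distrib)
  qed
  \<comment> \<open>A set admissible for \<open>E'\<close> becomes admissible for \<open>E\<close>
    once \<open>i\<close> is added, which costs at most \<open>\<alpha> E i\<close>. Averaging over
    the optimal weights of \<open>E'\<close> and applying Cauchy--Schwarz turns the remaining term
    into \<open>f E'\<close>.\<close>
  have lip: "f E \<le> f E' + \<alpha> E i"
    if E: "E \<subseteq> A" and E': "E' \<subseteq> A" and i: "i \<in> I" and eq: "E - B i = E' - B i" for E E' i
  proof -
    note W' = W[OF E']
    have "f E = (\<Sum>t\<in>\<U> E'. W E' t * f E)"
      using W' by (simp add: good_def sum_distrib_right[symmetric])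
    also have "\<dots> \<le> (\<Sum>t\<in>\<U> E'. W E' t * ((\<Sum>j\<in>I. \<alpha> E j * of_bool (j \<in> t)) + \<alpha> E i))"
    proof (intro sum_mono mult_left_mono)
      fix t assume t: "t \<in> \<U> E'"
      show "0 \<le> W E' t" using W' t by (simp add: good_def)
      have "f E \<le> (\<Sum>j\<in>I. \<alpha> E j * of_bool (j \<in> insert i t))"
        using \<alpha>f[OF E ins[OF E E' i eq t]] .
      also have "\<dots> \<le> (\<Sum>j\<in>I. \<alpha> E j * of_bool (j \<in> t) + (if j = i then \<alpha> E i else 0))"
        using \<alpha>0[OF E] by (intro sum_mono) auto
      also have "\<dots> = (\<Sum>j\<in>I. \<alpha> E j * of_bool (j \<in> t)) + \<alpha> E i"
        using I i by (simp add: sum.distrib sum.delta)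
      finally show "f E \<le> (\<Sum>j\<in>I. \<alpha> E j * of_bool (j \<in> t)) + \<alpha> E i" .
    qed
    also have "\<dots> = (\<Sum>t\<in>\<U> E'. \<Sum>j\<in>I. W E' t * (\<alpha> E j * of_bool (j \<in> t))) + \<alpha> E i"
      using W' by (simp add: good_def ring_distribs sum.distrib sum_distrib_left sum_distrib_right[symmetric])
    also have "(\<Sum>t\<in>\<U> E'. \<Sum>j\<in>I. W E' t * (\<alpha> E j * of_bool (j \<in> t))) = (\<Sum>j\<in>I. \<alpha> E j * \<delta> E' j)"
      unfolding \<delta>_def by (subst sum.swap) (simp add: sum_distrib_left mult_ac)
    also have "\<dots> \<le> f E'" unfolding f_def by (rule sum_le_sqrt_sum_squares[OF \<alpha>1])
    finally show ?thesis by simp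
  qed
  \<comment> \<open>Minimising over all contents of block \<open>i\<close> makes
    \<open>f - g i\<close> nonnegative, so the one-sided estimate \<open>lip\<close>, with
    \<open>\<alpha>\<close> taken at \<open>E\<close> itself, controls its square.\<close>
  define g where "g i E = Min ((\<lambda>F. f (((E - B i) \<inter> A) \<union> F)) ` Pow (B i))" for i E
  have g: "0 \<le> f E - g i E \<and> f E - g i E \<le> \<alpha> E i" if E: "E \<subseteq> A" and i: "i \<in> I" for E i
  proof -
    let ?X = "(\<lambda>F. f (((E - B i) \<inter> A) \<union> F)) ` Pow (B i)"
    have fin: "finite ?X" "?X \<noteq> {}" using B(1)[OF i] by auto
    have "f E \<in> ?X" using E by (intro image_eqI[of _ _ "E \<inter> B i"]) (auto intro!: arg_cong[of _ _ f])
    then have 1: "g i E \<le> f E" unfolding g_def using fin by (intro Min_le)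
    have "g i E \<in> ?X" unfolding g_def using fin by (rule Min_in)
    then obtain F where F: "F \<subseteq> B i" "g i E = f (((E - B i) \<inter> A) \<union> F)" by auto
    have "f E \<le> f (((E - B i) \<inter> A) \<union> F) + \<alpha> E i"
      by (rule lip) (use E i F A in auto)
    then show ?thesis using 1 F by simp
  qed
  have "bexp A p (\<lambda>E. (f E - bexp A p f)\<^sup>2) \<le> (\<Sum>i\<in>I. bexp A p (\<lambda>E. (f E - g i E)\<^sup>2))"
    unfolding A by (rule efron_stein[OF I B(1) B(2) p]) (auto simp: g_def)
  also have "\<dots> \<le> (\<Sum>i\<in>I. bexp A p (\<lambda>E. (\<alpha> E i)\<^sup>2))"
    using g by (intro sum_mono bexp_mono p power_mono) auto
  also have "\<dots> = bexp A p (\<lambda>E. \<Sum>i\<in>I. (\<alpha> E i)\<^sup>2)" by (simp add: bexp_sum)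
  also have "\<dots> \<le> bexp A p (\<lambda>E. 1)" by (intro bexp_mono p \<alpha>1)
  finally have var: "bexp A p (\<lambda>E. (f E - bexp A p f)\<^sup>2) \<le> 1"
    by (simp add: bexp_const[OF finA])
  have "e \<le> bprob A p (\<lambda>E. f E = 0)"
  proof (rule order.trans[OF zero bprob_mono[OF p]])
    fix E assume E: "E \<subseteq> A" and "{} \<in> \<U> E"
    then show "f E = 0" using \<alpha>f[OF E, of "{}"] f0[of E] by simp
  qed
  from bprob_upper_tail[OF finA p e f0 var this]
  have tail: "bprob A p (\<lambda>E. 2 / sqrt e < f E) \<le> e" .
  show ?thesis
  proof (rule order.trans[OF bprob_mono[OF p] tail])
    fix E assume E: "E \<subseteq> A"
    assume no: "\<not> (\<exists>w. (\<forall>U\<in>\<U> E. 0 \<le> w U) \<and> sum w (\<U> E) = 1 \<and>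
      (\<Sum>i\<in>I. (\<Sum>U\<in>\<U> E. w U * of_bool (i \<in> U))\<^sup>2) \<le> 4 / e)"
    show "2 / sqrt e < f E"
    proof (rule ccontr)
      assume "\<not> 2 / sqrt e < f E"
      then have "(f E)\<^sup>2 \<le> (2 / sqrt e)\<^sup>2" using f0 by (intro power_mono) auto
      also have "\<dots> = 4 / e" using e by (simp add: power_divide)
      finally have "(\<Sum>i\<in>I. (\<delta> E i)\<^sup>2) \<le> 4 / e" by (simp add: fsq)
      then show False using no W[OF E] by (auto simp: good_def \<delta>_def)
    qed
  qed
qed

section \<open>Vector colorings as positive semidefinite matrices\<close>

definition qform :: "'a set \<Rightarrow> ('a \<Rightarrow> 'a \<Rightarrow> real) \<Rightarrow> ('a \<Rightarrow> real) \<Rightarrow> real" where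
  "qform S M x = (\<Sum>i\<in>S. \<Sum>j\<in>S. x i * x j * M i j)"

definition psd :: "'a set \<Rightarrow> ('a \<Rightarrow> 'a \<Rightarrow> real) \<Rightarrow> bool" where
  "psd S M \<longleftrightarrow> (\<forall>i\<in>S. \<forall>j\<in>S. M i j = M j i) \<and> (\<forall>x. 0 \<le> qform S M x)"

lemma qform_cong:
  assumes "S = T" "\<And>i j. i \<in> T \<Longrightarrow> j \<in> T \<Longrightarrow> M i j = N i j" "\<And>i. i \<in> T \<Longrightarrow> x i = y i"
  shows "qform S M x = qform T N y"
  unfolding qform_def using assms by (intro sum.cong) auto

lemma psd_sym: "psd S M \<Longrightarrow> i \<in> S \<Longrightarrow> j \<in> S \<Longrightarrow> M i j = M j i"
  by (simp add: psd_def)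

lemma qform_add: "qform S (\<lambda>i j. M i j + N i j) x = qform S M x + qform S N x"
  by (simp add: qform_def ring_distribs sum.distrib)

lemma qform_diff: "qform S (\<lambda>i j. M i j - N i j) x = qform S M x - qform S N x"
  by (simp add: qform_def ring_distribs sum_subtractf)

lemma qform_scale: "qform S (\<lambda>i j. c * M i j) x = c * qform S M x"
  by (simp add: qform_def sum_distrib_left mult_ac)

lemma qform_sum: "qform S (\<lambda>i j. \<Sum>u\<in>F. M u i j) x = (\<Sum>u\<in>F. qform S (M u) x)"
proof -
  have "qform S (\<lambda>i j. \<Sum>u\<in>F. M u i j) x = (\<Sum>i\<in>S. \<Sum>u\<in>F. \<Sum>j\<in>S. x i * x j * M u i j)"
    unfolding qform_def by (simp add: sum_distrib_left sum.swap[of _ S F])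
  then show ?thesis by (simp add: qform_def sum.swap[of _ S F])
qed

lemma qform_rank_one: "qform S (\<lambda>i j. y i * y j) x = (\<Sum>i\<in>S. x i * y i)\<^sup>2"
  by (simp add: qform_def power2_eq_square sum_product mult_ac)

lemma qform_ones: "qform S (\<lambda>i j. 1) x = (sum x S)\<^sup>2"
  using qform_rank_one[of S "\<lambda>_. 1" x] by simp

lemma qform_diag:
  assumes "finite S"
  shows "qform S (\<lambda>i j. if i = j then d i else 0) x = (\<Sum>i\<in>S. (x i)\<^sup>2 * d i)"
  using assms by (simp add: qform_def power2_eq_square if_distrib[of "\<lambda>z. _ * z"] sum.delta cong: if_cong)

lemma qform_insert:
  assumes "finite S" "a \<notin> S" "\<And>i. i \<in> S \<Longrightarrow> M a i = M i a"
  shows "qform (insert a S) M x = qform S M x + 2 * x a * (\<Sum>i\<in>S. x i * M i a) + (x a)\<^sup>2 * M a a"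
  using assms by (simp add: qform_def sum.distrib sum_distrib_left power2_eq_square mult_ac cong: sum.cong)

lemma qform_mono_neutral:
  assumes "finite T" "S \<subseteq> T" "\<And>i. i \<in> T - S \<Longrightarrow> x i = 0"
  shows "qform T M x = qform S M x"
proof -
  have "qform T M x = (\<Sum>i\<in>S. \<Sum>j\<in>T. x i * x j * M i j)"
    unfolding qform_def using assms by (intro sum.mono_neutral_right) auto
  also have "\<dots> = qform S M x"
    unfolding qform_def using assms by (intro sum.cong sum.mono_neutral_right) auto
  finally show ?thesis .
qed

lemma psd_subset:
  assumes "psd T M" "S \<subseteq> T" "finite T"
  shows "psd S M"
  unfolding psd_def
proof (intro conjI ballI allI)
  fix x
  have "0 \<le> qform T M (\<lambda>i. if i \<in> S then x i else 0)" using assms(1) by (simp add: psd_def)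
  also have "\<dots> = qform S M (\<lambda>i. if i \<in> S then x i else 0)"
    using assms by (intro qform_mono_neutral) auto
  also have "\<dots> = qform S M x" by (intro qform_cong) auto
  finally show "0 \<le> qform S M x" .
qed (use assms in \<open>auto simp: psd_def\<close>)

lemma psd_two:
  assumes "psd S M" "i \<in> S" "a \<in> S" "i \<noteq> a" "finite S"
  shows "0 \<le> s\<^sup>2 * M i i + 2 * s * t * M i a + t\<^sup>2 * M a a"
proof -
  have p: "psd {i, a} M" using assms by (intro psd_subset[OF assms(1)]) auto
  then have "0 \<le> qform {i, a} M (\<lambda>j. if j = i then s else t)" by (simp add: psd_def)
  then show ?thesis using assms psd_sym[OF assms(1)]
    by (simp add: qform_def power2_eq_square algebra_simps)
qed

text \<open>Cholesky factorisation, which also delivers the right dimension. The last index is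
  eliminated; the Schur complement \<open>N\<close> has a Gram representation in one dimension less,
  and the new coordinate restores the rank-one part.\<close>

lemma psd_gram:
  assumes "psd {1..n} M"
  shows "\<exists>v. \<forall>i\<in>{1..n}. \<forall>j\<in>{1..n}. ip n (v i) (v j) = M i j"
  using assms
proof (induction n arbitrary: M)
  case (Suc n)
  let ?a = "Suc n"
  define r where "r = M ?a ?a"
  define N where "N i j = M i j - M i ?a * M j ?a / r" for i j
  have S: "{1..Suc n} = insert ?a {1..n}" by auto
  have sym: "M i j = M j i" if "i \<in> {1..Suc n}" "j \<in> {1..Suc n}" for i j
    using psd_sym[OF Suc.prems that] .
  have r0: "0 \<le> r"
    using Suc.prems psd_subset[OF Suc.prems, of "{?a}"]
    by (auto simp: psd_def qform_def r_def dest: spec[of _ "\<lambda>_. 1"])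
  \<comment> \<open>A vanishing pivot forces a vanishing column: otherwise the chosen coefficient
    gives the form the value -1.\<close>
  have zero: "M i ?a = 0" if "r = 0" "i \<in> {1..n}" for i
  proof (rule ccontr)
    assume nz: "M i ?a \<noteq> 0"
    have "0 \<le> 1\<^sup>2 * M i i + 2 * 1 * (- (M i i + 1) / (2 * M i ?a)) * M i ?a + (- (M i i + 1) / (2 * M i ?a))\<^sup>2 * r"
      unfolding r_def using that by (intro psd_two[OF Suc.prems]) auto
    then show False using nz that by (simp add: field_simps)
  qed
  have "psd {1..n} N"
    unfolding psd_def
  proof (intro conjI ballI allI)
    fix x :: "nat \<Rightarrow> real"
    define b where "b = (\<Sum>i\<in>{1..n}. x i * M i ?a)"
    \<comment> \<open>This last coordinate minimises the form. For \<open>r = 0\<close> all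
      quotients by \<open>r\<close> are 0, so the same formula covers that case.\<close>
    define y where "y = x(?a := - b / r)"
    have "0 \<le> qform {1..Suc n} M y" using Suc.prems by (simp add: psd_def)
    also have "\<dots> = qform {1..n} M y + 2 * y ?a * (\<Sum>i\<in>{1..n}. y i * M i ?a) + (y ?a)\<^sup>2 * M ?a ?a"
      unfolding S using sym by (intro qform_insert) auto
    also have "qform {1..n} M y = qform {1..n} M x" by (intro qform_cong) (auto simp: y_def)
    also have "(\<Sum>i\<in>{1..n}. y i * M i ?a) = b" unfolding b_def by (intro sum.cong) (auto simp: y_def)
    also have "qform {1..n} M x + 2 * y ?a * b + (y ?a)\<^sup>2 * M ?a ?a = qform {1..n} M x - b\<^sup>2 / r"
      by (cases "r = 0") (auto simp: y_def r_def[symmetric] power2_eq_square field_simps)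
    also have "\<dots> = qform {1..n} (\<lambda>i j. M i j - (1 / r) * (M i ?a * M j ?a)) x"
      by (simp only: qform_diff qform_scale qform_rank_one b_def) simp
    also have "\<dots> = qform {1..n} N x" by (intro qform_cong) (auto simp: N_def)
    finally show "0 \<le> qform {1..n} N x" .
  next
    fix i j assume "i \<in> {1..n}" "j \<in> {1..n}"
    then show "N i j = N j i" using sym[of i j] by (simp add: N_def mult.commute)
  qed
  from Suc.IH[OF this] obtain v where v: "\<And>i j. i \<in> {1..n} \<Longrightarrow> j \<in> {1..n} \<Longrightarrow> ip n (v i) (v j) = N i j"
    by blast
  define u where "u i l = (if i = ?a then if l = ?a then sqrt r else 0
      else if l = ?a then M i ?a / sqrt r else v i l)" for i l
  have ip_Suc: "ip (Suc n) f g = ip n f g + f ?a * g ?a" for f g by (simp add: ip_def)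
  have ip_cong: "ip n f g = ip n f' g'" if "\<And>l. l \<in> {1..n} \<Longrightarrow> f l = f' l \<and> g l = g' l" for f g f' g'
    unfolding ip_def using that by (intro sum.cong) auto
  have "ip (Suc n) (u i) (u j) = M i j" if ij: "i \<in> {1..Suc n}" "j \<in> {1..Suc n}" for i j
  proof -
    consider "i = ?a" "j = ?a" | "i = ?a" "j \<in> {1..n}" | "i \<in> {1..n}" "j = ?a" | "i \<in> {1..n}" "j \<in> {1..n}"
      using ij by force
    then show ?thesis
    proof cases
      case 1
      have "ip n (u i) (u j) = ip n (\<lambda>_. 0) (\<lambda>_. 0)" by (rule ip_cong) (use 1 in \<open>auto simp: u_def\<close>)
      then show ?thesis using 1 r0 by (simp add: ip_Suc u_def ip_def r_def)
    next
      case 2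
      have "ip n (u i) (u j) = ip n (\<lambda>_. 0) (v j)" by (rule ip_cong) (use 2 in \<open>auto simp: u_def\<close>)
      then show ?thesis using 2 r0 zero[of j] sym[of j ?a]
        by (cases "r = 0") (auto simp: ip_Suc u_def ip_def r_def)
    next
      case 3
      have "ip n (u i) (u j) = ip n (v i) (\<lambda>_. 0)" by (rule ip_cong) (use 3 in \<open>auto simp: u_def\<close>)
      then show ?thesis using 3 r0 zero[of i]
        by (cases "r = 0") (auto simp: ip_Suc u_def ip_def r_def)
    next
      case 4
      have "ip n (u i) (u j) = ip n (v i) (v j)" by (rule ip_cong) (use 4 in \<open>auto simp: u_def\<close>)
      then show ?thesis using 4 r0 by (auto simp: ip_Suc u_def v N_def)
    qed
  qed
  then show ?case by blast
qed simp

text \<open>A vector \<open>k\<close>-coloring \<open>v\<close> is encoded by the matrix with entries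
  \<open>Z i j = 1 + (k - 1) * \<langle>v i, v j\<rangle>\<close>, so that the threshold \<open>- 1 / (k - 1)\<close> becomes 0. The predicates
  \<open>P\<close> and \<open>Q\<close> constrain the entries at edges and non-edges and distinguish the three variants.\<close>

locale coloring_cone =
  fixes P Q :: "real \<Rightarrow> bool"
  assumes P_nonpos: "P x \<Longrightarrow> x \<le> 0" and P_zero: "P 0"
    and P_add: "P x \<Longrightarrow> P y \<Longrightarrow> P (x + y)" and P_scale: "0 \<le> c \<Longrightarrow> P x \<Longrightarrow> P (c * x)"
    and Q_nonneg: "0 \<le> x \<Longrightarrow> Q x"
    and Q_add: "Q x \<Longrightarrow> Q y \<Longrightarrow> Q (x + y)" and Q_scale: "0 \<le> c \<Longrightarrow> Q x \<Longrightarrow> Q (c * x)"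
begin

text \<open>Subtracting 1 from every entry recovers a multiple of a Gram matrix. The diagonal is
  only bounded by \<open>k\<close>: slack can be added there without harming semidefiniteness, and
  monotonicity in \<open>k\<close> becomes immediate.\<close>

definition feas :: "nat set \<Rightarrow> nat set set \<Rightarrow> real \<Rightarrow> bool" where
  "feas S E k \<longleftrightarrow> (\<exists>Z. psd S (\<lambda>i j. Z i j - 1) \<and> (\<forall>i\<in>S. Z i i \<le> k) \<and>
     (\<forall>i\<in>S. \<forall>j\<in>S. i \<noteq> j \<longrightarrow> (if {i, j} \<in> E then P (Z i j) else Q (Z i j))))"

definition theta :: "nat set \<Rightarrow> nat set set \<Rightarrow> real" where
  "theta S E = Inf {k. 1 < k \<and> feas S E k}"

lemma feas_mono: "feas S E k \<Longrightarrow> k \<le> k' \<Longrightarrow> feas S E k'"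
  unfolding feas_def by (meson order.trans)

lemma feas_empty: "feas {} E k"
  by (simp add: feas_def psd_def qform_def)

lemma feas_subset:
  assumes "feas T E k" "S \<subseteq> T" "finite T" shows "feas S E k"
  using assms psd_subset[OF _ assms(2,3)] unfolding feas_def by (meson subsetD)

lemma feas_cong_edges:
  assumes "\<And>i j. i \<in> S \<Longrightarrow> j \<in> S \<Longrightarrow> i \<noteq> j \<Longrightarrow> {i, j} \<in> E \<longleftrightarrow> {i, j} \<in> E'" "feas S E k"
  shows "feas S E' k"
proof -
  obtain Z where Z: "psd S (\<lambda>i j. Z i j - 1)" "\<forall>i\<in>S. Z i i \<le> k"
    "\<forall>i\<in>S. \<forall>j\<in>S. i \<noteq> j \<longrightarrow> (if {i, j} \<in> E then P (Z i j) else Q (Z i j))"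
    using assms(2) unfolding feas_def by blast
  then have "\<forall>i\<in>S. \<forall>j\<in>S. i \<noteq> j \<longrightarrow> (if {i, j} \<in> E' then P (Z i j) else Q (Z i j))"
    using assms(1) by metis
  then show ?thesis using Z unfolding feas_def by blast
qed

lemma P_sum:
  assumes "finite F" "\<And>u. u \<in> F \<Longrightarrow> P (f u)" shows "P (sum f F)"
  using assms by (induction F rule: finite_induct) (auto intro: P_zero P_add)

lemma Q_sum:
  assumes "finite F" "\<And>u. u \<in> F \<Longrightarrow> Q (f u)" shows "Q (sum f F)"
  using assms by (induction F rule: finite_induct) (auto intro: Q_nonneg Q_add)

lemma feas_edge_ge_2:
  assumes "feas S E k" "finite S" "i \<in> S" "j \<in> S" "i \<noteq> j" "{i, j} \<in> E"
  shows "2 \<le> k"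
proof -
  obtain Z where Z: "psd S (\<lambda>i j. Z i j - 1)" "\<forall>i\<in>S. Z i i \<le> k"
    "\<forall>i\<in>S. \<forall>j\<in>S. i \<noteq> j \<longrightarrow> (if {i, j} \<in> E then P (Z i j) else Q (Z i j))"
    using assms(1) unfolding feas_def by blast
  have "0 \<le> 1\<^sup>2 * (Z i i - 1) + 2 * 1 * 1 * (Z i j - 1) + 1\<^sup>2 * (Z j j - 1)"
    using psd_two[OF Z(1) assms(3,4,5,2), of 1 1] .
  moreover have "Z i j \<le> 0" using Z(3) assms by (metis P_nonpos)
  moreover have "Z i i \<le> k" "Z j j \<le> k" using Z(2) assms by auto
  ultimately show ?thesis by simp
qed

text \<open>Parts without edges between them can use the same colors: the mixed entries are 1,
  meaning orthogonal vectors, so after subtracting 1 the matrix is block diagonal.\<close>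

lemma feas_disjoint_Un:
  assumes "feas S E k" "feas T E k" "S \<inter> T = {}" "finite S" "finite T"
    and noedge: "\<And>i j. i \<in> S \<Longrightarrow> j \<in> T \<Longrightarrow> {i, j} \<notin> E"
  shows "feas (S \<union> T) E k"
proof -
  obtain Z where Z: "psd S (\<lambda>i j. Z i j - 1)" "\<forall>i\<in>S. Z i i \<le> k"
    "\<forall>i\<in>S. \<forall>j\<in>S. i \<noteq> j \<longrightarrow> (if {i, j} \<in> E then P (Z i j) else Q (Z i j))"
    using assms(1) unfolding feas_def by blast
  obtain Y where Y: "psd T (\<lambda>i j. Y i j - 1)" "\<forall>i\<in>T. Y i i \<le> k"
    "\<forall>i\<in>T. \<forall>j\<in>T. i \<noteq> j \<longrightarrow> (if {i, j} \<in> E then P (Y i j) else Q (Y i j))"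
    using assms(2) unfolding feas_def by blast
  define X where "X i j = (if i \<in> S \<and> j \<in> S then Z i j else if i \<in> T \<and> j \<in> T then Y i j else 1)" for i j
  have nT: "i \<notin> T" if "i \<in> S" for i using that assms(3) by blast
  have nS: "i \<notin> S" if "i \<in> T" for i using that assms(3) by blast
  have "psd (S \<union> T) (\<lambda>i j. X i j - 1)"
    unfolding psd_def
  proof (intro conjI ballI allI)
    fix i j assume "i \<in> S \<union> T" "j \<in> S \<union> T"
    then show "X i j - 1 = X j i - 1"
      using psd_sym[OF Z(1), of i j] psd_sym[OF Y(1), of i j] by (auto simp: X_def)
  next
    fix x
    have "qform (S \<union> T) (\<lambda>i j. X i j - 1) x
        = (\<Sum>i\<in>S. (\<Sum>j\<in>S. x i * x j * (X i j - 1)) + (\<Sum>j\<in>T. x i * x j * (X i j - 1)))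
        + (\<Sum>i\<in>T. (\<Sum>j\<in>S. x i * x j * (X i j - 1)) + (\<Sum>j\<in>T. x i * x j * (X i j - 1)))"
      unfolding qform_def using assms(3,4,5) by (simp add: sum.union_disjoint)
    also have "\<dots> = qform S (\<lambda>i j. Z i j - 1) x + qform T (\<lambda>i j. Y i j - 1) x"
      unfolding qform_def
      by (intro arg_cong2[of _ _ _ _ "(+)"] sum.cong) (auto simp: X_def nT nS intro!: sum.neutral)
    also have "\<dots> \<ge> 0" using Z(1) Y(1) by (simp add: psd_def)
    finally show "0 \<le> qform (S \<union> T) (\<lambda>i j. X i j - 1) x" .
  qed
  moreover have "\<forall>i\<in>S \<union> T. X i i \<le> k" using Z(2) Y(2) nS by (auto simp: X_def)
  moreover have "if {i, j} \<in> E then P (X i j) else Q (X i j)"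
    if ij: "i \<in> S \<union> T" "j \<in> S \<union> T" "i \<noteq> j" for i j
  proof -
    have "{i, j} \<notin> E" if "(i \<in> S \<and> j \<in> T) \<or> (i \<in> T \<and> j \<in> S)"
      using that noedge by (metis insert_commute)
    then show ?thesis using ij Z(3) Y(3) nS nT Q_nonneg[of 1] by (auto simp: X_def)
  qed
  ultimately show ?thesis unfolding feas_def by blast
qed

text \<open>Parts with arbitrary edges between them cost the sum of the two values. Mixed entries
  sit exactly at the threshold 0, which satisfies both \<open>P\<close> and \<open>Q\<close>.
  Rescaling the blocks by \<open>K / k\<close> and \<open>K / l\<close> brings both diagonals to at
  most \<open>K\<close>, and semidefiniteness is the weighted Cauchy--Schwarz inequality for the two
  block sums.\<close>

lemma feas_join:
  assumes "feas S E k" "feas T E l" "S \<inter> T = {}" "finite S" "finite T" "0 < k" "0 < l"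
  shows "feas (S \<union> T) E (k + l)"
proof -
  obtain Z where Z: "psd S (\<lambda>i j. Z i j - 1)" "\<forall>i\<in>S. Z i i \<le> k"
    "\<forall>i\<in>S. \<forall>j\<in>S. i \<noteq> j \<longrightarrow> (if {i, j} \<in> E then P (Z i j) else Q (Z i j))"
    using assms(1) unfolding feas_def by blast
  obtain Y where Y: "psd T (\<lambda>i j. Y i j - 1)" "\<forall>i\<in>T. Y i i \<le> l"
    "\<forall>i\<in>T. \<forall>j\<in>T. i \<noteq> j \<longrightarrow> (if {i, j} \<in> E then P (Y i j) else Q (Y i j))"
    using assms(2) unfolding feas_def by blast
  define K where "K = k + l"
  define X where "X i j = (if i \<in> S \<and> j \<in> S then (K / k) * Z i j
    else if i \<in> T \<and> j \<in> T then (K / l) * Y i j else 0)" for i j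
  have K: "0 < K" "0 < K / k" "0 < K / l" using assms by (auto simp: K_def)
  have nT: "i \<notin> T" if "i \<in> S" for i using that assms(3) by blast
  have nS: "i \<notin> S" if "i \<in> T" for i using that assms(3) by blast
  have "psd (S \<union> T) (\<lambda>i j. X i j - 1)"
    unfolding psd_def
  proof (intro conjI ballI allI)
    fix i j assume "i \<in> S \<union> T" "j \<in> S \<union> T"
    then show "X i j - 1 = X j i - 1"
      using psd_sym[OF Z(1), of i j] psd_sym[OF Y(1), of i j] by (auto simp: X_def)
  next
    fix x :: "nat \<Rightarrow> real"
    define a b where "a = sum x S" and "b = sum x T"
    have "qform (S \<union> T) X x
        = (\<Sum>i\<in>S. (\<Sum>j\<in>S. x i * x j * X i j) + (\<Sum>j\<in>T. x i * x j * X i j))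
        + (\<Sum>i\<in>T. (\<Sum>j\<in>S. x i * x j * X i j) + (\<Sum>j\<in>T. x i * x j * X i j))"
      unfolding qform_def using assms(3,4,5) by (simp add: sum.union_disjoint)
    also have "\<dots> = qform S (\<lambda>i j. (K / k) * Z i j) x + qform T (\<lambda>i j. (K / l) * Y i j) x"
      unfolding qform_def
      by (intro arg_cong2[of _ _ _ _ "(+)"] sum.cong) (auto simp: X_def nT nS intro!: sum.neutral)
    also have "\<dots> = (K / k) * qform S Z x + (K / l) * qform T Y x" by (simp only: qform_scale)
    finally have X: "qform (S \<union> T) X x = (K / k) * qform S Z x + (K / l) * qform T Y x" .
    have "a\<^sup>2 \<le> qform S Z x"
      using Z(1) by (auto simp: psd_def qform_diff qform_ones a_def)
    moreover have "b\<^sup>2 \<le> qform T Y x"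
      using Y(1) by (auto simp: psd_def qform_diff qform_ones b_def)
    ultimately have "(K / k) * a\<^sup>2 + (K / l) * b\<^sup>2 \<le> qform (S \<union> T) X x"
      unfolding X using K by (intro add_mono mult_left_mono) auto
    moreover have "(K / k) * a\<^sup>2 + (K / l) * b\<^sup>2 - (a + b)\<^sup>2 = (l * a - k * b)\<^sup>2 / (k * l)"
      using assms by (simp add: K_def field_simps power2_eq_square)
    moreover have "0 \<le> (l * a - k * b)\<^sup>2 / (k * l)" using assms by simp
    moreover have "sum x (S \<union> T) = a + b"
      unfolding a_def b_def using assms by (simp add: sum.union_disjoint)
    ultimately show "0 \<le> qform (S \<union> T) (\<lambda>i j. X i j - 1) x"
      by (simp add: qform_diff qform_ones)
  qed
  moreover have "X i i \<le> K" if "i \<in> S \<union> T" for i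
  proof (cases "i \<in> S")
    case True
    have "(K / k) * Z i i \<le> (K / k) * k" using Z(2) True K by (intro mult_left_mono) auto
    then show ?thesis using True assms by (simp add: X_def)
  next
    case False
    have "(K / l) * Y i i \<le> (K / l) * l" using Y(2) False K that by (intro mult_left_mono) auto
    then show ?thesis using False that assms by (simp add: X_def)
  qed
  moreover have "if {i, j} \<in> E then P (X i j) else Q (X i j)"
    if ij: "i \<in> S \<union> T" "j \<in> S \<union> T" "i \<noteq> j" for i j
  proof -
    consider "i \<in> S" "j \<in> S" | "i \<in> T" "j \<in> T" | "X i j = 0"
      using ij nS nT by (auto simp: X_def)
    then show ?thesis
    proof cases
      case 1
      then have "X i j = (K / k) * Z i j" by (simp add: X_def)
      then show ?thesis using Z(3) 1 ij P_scale[of "K / k" "Z i j"] Q_scale[of "K / k" "Z i j"] K by auto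
    next
      case 2
      then have "X i j = (K / l) * Y i j" using nS by (simp add: X_def)
      then show ?thesis using Y(3) 2 ij P_scale[of "K / l" "Y i j"] Q_scale[of "K / l" "Y i j"] K by auto
    next
      case 3 then show ?thesis using P_zero Q_nonneg[of 0] by simp
    qed
  qed
  ultimately show ?thesis unfolding feas_def K_def by blast
qed

text \<open>Colors become vertices of a regular simplex: \<open>Z\<close> is \<open>q\<close> times
  the indicator of equal colors. Semidefiniteness is Cauchy--Schwarz over the color classes.\<close>

lemma feas_colorable:
  assumes fin: "finite S" and col: "\<And>i. i \<in> S \<Longrightarrow> c i < q"
    and proper: "\<And>i j. i \<in> S \<Longrightarrow> j \<in> S \<Longrightarrow> {i, j} \<in> E \<Longrightarrow> i \<noteq> j \<Longrightarrow> c i \<noteq> c j"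
  shows "feas S E (real q)"
proof -
  define Z where "Z i j = real q * of_bool (c i = c j)" for i j
  have "psd S (\<lambda>i j. Z i j - 1)"
    unfolding psd_def
  proof (intro conjI ballI allI)
    fix x :: "nat \<Rightarrow> real"
    define s where "s a = (\<Sum>i\<in>S. x i * of_bool (c i = a))" for a
    have Z': "Z i j = real q * (\<Sum>a<q. of_bool (c i = a) * of_bool (c j = a))" if "i \<in> S" "j \<in> S" for i j
    proof -
      have "(\<Sum>a<q. of_bool (c i = a) * of_bool (c j = a) :: real) = (\<Sum>a<q. if a = c i then of_bool (c i = c j) else 0)"
        by (intro sum.cong) auto
      then show ?thesis using col[OF that(1)] by (simp add: Z_def)
    qed
    have "qform S Z x = qform S (\<lambda>i j. real q * (\<Sum>a<q. of_bool (c i = a) * of_bool (c j = a))) x"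
      by (intro qform_cong) (auto simp: Z')
    also have "\<dots> = real q * (\<Sum>a<q. (s a)\<^sup>2)"
      by (simp only: qform_scale qform_sum qform_rank_one s_def)
    finally have 1: "qform S Z x = real q * (\<Sum>a<q. (s a)\<^sup>2)" .
    have "sum x S = (\<Sum>i\<in>S. \<Sum>a<q. x i * of_bool (c i = a))"
    proof (intro sum.cong refl)
      fix i assume "i \<in> S"
      have "(\<Sum>a<q. x i * of_bool (c i = a)) = (\<Sum>a<q. if a = c i then x i else 0)"
        by (intro sum.cong) auto
      then show "x i = (\<Sum>a<q. x i * of_bool (c i = a))" using col[OF \<open>i \<in> S\<close>] by simp
    qed
    also have "\<dots> = (\<Sum>a<q. s a)" unfolding s_def by (rule sum.swap)
    finally have "(sum x S)\<^sup>2 = (\<Sum>a<q. 1 * s a)\<^sup>2" by simp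
    also have "\<dots> \<le> (\<Sum>a<q. 1\<^sup>2) * (\<Sum>a<q. (s a)\<^sup>2)" by (rule Cauchy_Schwarz_ineq_sum)
    finally show "0 \<le> qform S (\<lambda>i j. Z i j - 1) x" by (simp add: qform_diff qform_ones 1)
  qed (auto simp: Z_def)
  moreover have "if {i, j} \<in> E then P (Z i j) else Q (Z i j)"
    if "i \<in> S" "j \<in> S" "i \<noteq> j" for i j
    using proper[OF that(1,2)] that(3) P_zero Q_nonneg[of "Z i j"] by (auto simp: Z_def)
  moreover have "\<forall>i\<in>S. Z i i \<le> real q" by (simp add: Z_def)
  ultimately show ?thesis unfolding feas_def by blast
qed

end

section \<open>Averaged and spectral constructions of vector colorings\<close>

lemma weighted_square_le:
  fixes w a :: "'b \<Rightarrow> real"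
  assumes "\<And>u. u \<in> F \<Longrightarrow> 0 \<le> w u" "sum w F = 1"
  shows "(\<Sum>u\<in>F. w u * a u)\<^sup>2 \<le> (\<Sum>u\<in>F. w u * (a u)\<^sup>2)"
proof -
  have "(\<Sum>u\<in>F. w u * a u) = (\<Sum>u\<in>F. sqrt (w u) * (sqrt (w u) * a u))"
    using assms(1) by (intro sum.cong) (auto simp: mult.assoc[symmetric])
  also have "\<dots>\<^sup>2 \<le> (\<Sum>u\<in>F. (sqrt (w u))\<^sup>2) * (\<Sum>u\<in>F. (sqrt (w u) * a u)\<^sup>2)"
    by (rule Cauchy_Schwarz_ineq_sum)
  also have "\<dots> = (\<Sum>u\<in>F. w u * (a u)\<^sup>2)"
    using assms by (simp add: power_mult_distrib)
  finally show ?thesis .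
qed

lemma qform_masked:
  assumes "finite S"
  shows "qform S (\<lambda>i j. if i \<notin> U \<and> j \<notin> U then Z i j else 0) z = qform (S - U) Z z"
proof -
  let ?z = "\<lambda>i. if i \<in> U then 0 else z i"
  have "qform S (\<lambda>i j. if i \<notin> U \<and> j \<notin> U then Z i j else 0) z = qform S Z ?z"
    unfolding qform_def by (intro sum.cong) auto
  also have "\<dots> = qform (S - U) Z ?z"
    using assms by (intro qform_mono_neutral) auto
  also have "\<dots> = qform (S - U) Z z" by (intro qform_cong) auto
  finally show ?thesis .
qed

text \<open>Twice this form is the sum of \<open>C i j * (x i - x j)\<^sup>2\<close>.\<close>

lemma qform_laplacian_nonneg:
  assumes "finite S" and C: "\<And>i j. i \<in> S \<Longrightarrow> j \<in> S \<Longrightarrow> 0 \<le> C i j \<and> C i j = C j i"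
  shows "0 \<le> qform S (\<lambda>i j. (if i = j then \<Sum>l\<in>S. C i l else 0) - C i j) x"
proof -
  have 1: "(\<Sum>i\<in>S. \<Sum>j\<in>S. C i j * (x j)\<^sup>2) = (\<Sum>i\<in>S. \<Sum>j\<in>S. C i j * (x i)\<^sup>2)"
    by (subst sum.swap) (use C in \<open>auto intro!: sum.cong\<close>)
  have "0 \<le> (\<Sum>i\<in>S. \<Sum>j\<in>S. C i j * (x i - x j)\<^sup>2)"
    using C by (intro sum_nonneg) auto
  also have "\<dots> = (\<Sum>i\<in>S. \<Sum>j\<in>S. C i j * (x i)\<^sup>2 + C i j * (x j)\<^sup>2 - 2 * (x i * x j * C i j))"
    by (intro sum.cong) (auto simp: power2_eq_square algebra_simps)
  also have "\<dots> = 2 * (\<Sum>i\<in>S. \<Sum>j\<in>S. C i j * (x i)\<^sup>2) - 2 * qform S C x"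
    by (simp add: sum_subtractf sum.distrib 1 qform_def sum_distrib_left)
  also have "(\<Sum>i\<in>S. \<Sum>j\<in>S. C i j * (x i)\<^sup>2) = (\<Sum>i\<in>S. (x i)\<^sup>2 * (\<Sum>l\<in>S. C i l))"
    by (simp add: sum_distrib_right mult.commute)
  finally show ?thesis by (simp add: qform_diff qform_diag[OF assms(1)])
qed

context coloring_cone
begin

text \<open>Each matrix is extended by 0 to the deleted vertices; 0 satisfies \<open>P\<close> and
  \<open>Q\<close>, so the cone conditions survive averaging. By Jensen the average dominates the
  rank-one matrix of the survival probabilities \<open>y\<close>, and dividing entry
  \<open>(i, j)\<close> by \<open>y i * y j\<close> turns that matrix into all ones. Diagonal
  entries are at most \<open>k * y i\<close> before the division, hence at most
  \<open>k / y i\<close> after it.\<close>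

lemma feas_average:
  assumes fin: "finite V" "finite \<U>" and k: "0 \<le> k"
    and \<U>: "\<And>U. U \<in> \<U> \<Longrightarrow> feas (V - U) E k"
    and w: "\<And>U. U \<in> \<U> \<Longrightarrow> 0 \<le> w U" "sum w \<U> = 1"
    and S: "S \<subseteq> V" "\<And>i. i \<in> S \<Longrightarrow> (\<Sum>U\<in>\<U>. w U * of_bool (i \<in> U)) \<le> \<eta>"
    and \<eta>: "\<eta> < 1"
  shows "feas S E (k / (1 - \<eta>))"
proof -
  have "\<forall>U\<in>\<U>. \<exists>Z. psd (V - U) (\<lambda>i j. Z i j - 1) \<and> (\<forall>i\<in>V - U. Z i i \<le> k) \<and>
     (\<forall>i\<in>V - U. \<forall>j\<in>V - U. i \<noteq> j \<longrightarrow> (if {i, j} \<in> E then P (Z i j) else Q (Z i j)))"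
    using \<U> unfolding feas_def by blast
  from bchoice[OF this] obtain Z where
    Z0: "\<forall>U\<in>\<U>. psd (V - U) (\<lambda>i j. Z U i j - 1) \<and> (\<forall>i\<in>V - U. Z U i i \<le> k) \<and>
     (\<forall>i\<in>V - U. \<forall>j\<in>V - U. i \<noteq> j \<longrightarrow> (if {i, j} \<in> E then P (Z U i j) else Q (Z U i j)))" ..
  have Z: "psd (V - U) (\<lambda>i j. Z U i j - 1)" "i \<in> V - U \<Longrightarrow> Z U i i \<le> k"
    "i \<in> V - U \<Longrightarrow> j \<in> V - U \<Longrightarrow> i \<noteq> j \<Longrightarrow> (if {i, j} \<in> E then P (Z U i j) else Q (Z U i j))"
    if "U \<in> \<U>" for U i j
    using bspec[OF Z0 that] by blast+
  define y where "y i = (\<Sum>U\<in>\<U>. w U * of_bool (i \<notin> U))" for i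
  have y: "y i = 1 - (\<Sum>U\<in>\<U>. w U * of_bool (i \<in> U))" for i
  proof -
    have "y i = (\<Sum>U\<in>\<U>. w U - w U * of_bool (i \<in> U))"
      unfolding y_def by (rule sum.cong) auto
    then show ?thesis using w(2) by (simp add: sum_subtractf)
  qed
  have y_ge: "1 - \<eta> \<le> y i" "0 < y i" if "i \<in> S" for i using S(2)[OF that] \<eta> by (auto simp: y)
  define M where "M U i j = (if i \<notin> U \<and> j \<notin> U then Z U i j else 0)" for U i j
  define Zb where "Zb i j = (\<Sum>U\<in>\<U>. w U * M U i j)" for i j
  define Z' where "Z' i j = Zb i j / (y i * y j)" for i j
  have finS: "finite S" using S(1) fin(1) finite_subset by blast
  have qZb: "qform S Zb z \<ge> (\<Sum>i\<in>S. z i * y i)\<^sup>2" for z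
  proof -
    have "(\<Sum>i\<in>S. z i * y i) = (\<Sum>U\<in>\<U>. w U * (\<Sum>i\<in>S. z i * of_bool (i \<notin> U)))"
      unfolding y_def by (simp add: sum_distrib_left mult_ac) (rule sum.swap)
    also have "\<dots>\<^sup>2 \<le> (\<Sum>U\<in>\<U>. w U * (\<Sum>i\<in>S. z i * of_bool (i \<notin> U))\<^sup>2)"
      by (rule weighted_square_le[OF w])
    also have "\<dots> \<le> (\<Sum>U\<in>\<U>. w U * qform S (M U) z)"
    proof (intro sum_mono mult_left_mono w)
      fix U assume U: "U \<in> \<U>"
      have "psd (S - U) (\<lambda>i j. Z U i j - 1)"
        using psd_subset[OF Z(1)[OF U]] S(1) fin(1) by (simp add: Diff_mono)
      then have "(sum z (S - U))\<^sup>2 \<le> qform (S - U) (Z U) z"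
        by (auto simp: psd_def qform_diff qform_ones)
      moreover have "sum z (S - U) = (\<Sum>i\<in>S. z i * of_bool (i \<notin> U))"
        using finS by (intro sum.mono_neutral_cong_left) auto
      ultimately show "(\<Sum>i\<in>S. z i * of_bool (i \<notin> U))\<^sup>2 \<le> qform S (M U) z"
        unfolding M_def qform_masked[OF finS] by simp
    qed
    also have "\<dots> = qform S Zb z"
      unfolding Zb_def qform_sum qform_scale ..
    finally show ?thesis .
  qed
  have "psd S (\<lambda>i j. Z' i j - 1)"
    unfolding psd_def
  proof (intro conjI ballI allI)
    fix i j assume ij: "i \<in> S" "j \<in> S"
    have "M U i j = M U j i" if "U \<in> \<U>" for U
      using psd_sym[OF Z(1)[OF that], of i j] ij S(1) by (auto simp: M_def)
    then show "Z' i j - 1 = Z' j i - 1" by (simp add: Z'_def Zb_def mult.commute)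
  next
    fix x :: "nat \<Rightarrow> real"
    have "qform S Z' x = qform S Zb (\<lambda>i. x i / y i)"
      unfolding qform_def Z'_def by (intro sum.cong) auto
    also have "\<dots> \<ge> (\<Sum>i\<in>S. x i / y i * y i)\<^sup>2" by (rule qZb)
    also have "(\<Sum>i\<in>S. x i / y i * y i) = sum x S"
      using y_ge(2) by (intro sum.cong) (auto simp: less_imp_neq[symmetric])
    finally show "0 \<le> qform S (\<lambda>i j. Z' i j - 1) x" by (simp add: qform_diff qform_ones)
  qed
  moreover have "\<forall>i\<in>S. Z' i i \<le> k / (1 - \<eta>)"
  proof
    fix i assume i: "i \<in> S"
    have "Zb i i \<le> (\<Sum>U\<in>\<U>. w U * (k * of_bool (i \<notin> U)))"
      unfolding Zb_def using Z(2) i S(1) w(1) by (intro sum_mono mult_left_mono) (auto simp: M_def)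
    also have "\<dots> = k * y i" by (simp add: y_def sum_distrib_left mult_ac)
    finally have "Z' i i \<le> (k * y i) / (y i * y i)"
      unfolding Z'_def by (intro divide_right_mono) auto
    also have "\<dots> = k / y i" using y_ge(2)[OF i] by simp
    also have "\<dots> \<le> k / (1 - \<eta>)" using y_ge[OF i] k \<eta> by (intro divide_left_mono) auto
    finally show "Z' i i \<le> k / (1 - \<eta>)" .
  qed
  moreover have "if {i, j} \<in> E then P (Z' i j) else Q (Z' i j)" if ij: "i \<in> S" "j \<in> S" "i \<noteq> j" for i j
  proof -
    have Z': "Z' i j = (1 / (y i * y j)) * Zb i j" by (simp add: Z'_def)
    have pos: "0 \<le> 1 / (y i * y j)" using y_ge(2)[of i] y_ge(2)[of j] ij by simp
    show ?thesis
    proof (cases "{i, j} \<in> E")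
      case True
      have "P (Zb i j)" unfolding Zb_def
        using Z(3)[of _ i j] ij S(1) True w(1) by (intro P_sum fin P_scale) (auto simp: M_def P_zero)
      then show ?thesis using True P_scale[OF pos, of "Zb i j"] by (simp only: Z' if_True)
    next
      case False
      have "Q (Zb i j)" unfolding Zb_def
        using Z(3)[of _ i j] ij S(1) False w(1) by (intro Q_sum fin Q_scale) (auto simp: M_def Q_nonneg)
      then show ?thesis using False Q_scale[OF pos, of "Zb i j"] by (simp only: Z' if_False)
    qed
  qed
  ultimately show ?thesis unfolding feas_def by blast
qed

text \<open>The matrix behind the bound is \<open>(\<theta> I - A)\<^sup>2\<close>, corrected at the edges, where its entries are
  spoilt by triangles, by the Laplacian of the codegrees.\<close>

lemma feas_degree_bound:
  assumes fin: "finite V" and \<Delta>: "0 < \<Delta>" and \<theta>: "\<theta> = sqrt (\<Delta> * (1 + q))"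
    and deg: "\<And>i. i \<in> V \<Longrightarrow> real (card {j \<in> V. j \<noteq> i \<and> {i, j} \<in> E}) \<le> \<Delta>"
    and codeg: "\<And>i j. i \<in> V \<Longrightarrow> j \<in> V \<Longrightarrow> i \<noteq> j \<Longrightarrow>
      real (card {l \<in> V. l \<noteq> i \<and> l \<noteq> j \<and> {i, l} \<in> E \<and> {j, l} \<in> E}) \<le> q"
    and q: "0 \<le> q"
  shows "feas V E (1 + \<theta>)"
proof -
  have \<theta>0: "0 < \<theta>" and \<theta>2: "\<theta>\<^sup>2 = \<Delta> + \<Delta> * q" using \<Delta> q by (auto simp: \<theta> algebra_simps add_pos_nonneg)
  define a :: "nat \<Rightarrow> nat \<Rightarrow> real" where "a i j = of_bool (i \<noteq> j \<and> {i, j} \<in> E)" for i j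
  define b where "b i l = (if l = i then \<theta> else 0) - a i l" for i l
  define G where "G i j = (\<Sum>l\<in>V. a i l * a j l)" for i j
  define C where "C i j = a i j * G i j" for i j
  \<comment> \<open>Off the diagonal the square has entries
    \<open>- 2 * \<theta> * a i j + G i j\<close>. Subtracting \<open>C\<close> leaves exactly -1 at
    edges after scaling, so \<open>1 + N\<close> is 0 there, and it is at least 1 at non-edges. The
    diagonal of \<open>N\<close> is at most \<open>(\<theta>\<^sup>2 + \<Delta> + \<Delta> * q) / (2
    * \<theta>)\<close>, and \<open>\<theta>\<close> is chosen to make this
    \<open>\<theta>\<close>.\<close>
  define N where "N i j = (1 / (2 * \<theta>)) * ((\<Sum>l\<in>V. b i l * b j l)
    + ((if i = j then \<Sum>l\<in>V. C i l else 0) - C i j))" for i j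
  have a_sym: "a i j = a j i" for i j by (auto simp: a_def insert_commute)
  have aa: "a i i = 0" for i by (simp add: a_def)
  have G_sym: "G i j = G j i" for i j by (simp add: G_def mult.commute)
  have G0: "0 \<le> G i j" for i j by (auto simp: G_def a_def intro!: sum_nonneg)
  have G_le: "G i j \<le> q" if "i \<in> V" "j \<in> V" "i \<noteq> j" for i j
  proof -
    have "G i j = (\<Sum>l\<in>V. of_bool (l \<noteq> i \<and> l \<noteq> j \<and> {i, l} \<in> E \<and> {j, l} \<in> E))"
      unfolding G_def a_def by (intro sum.cong) auto
    also have "\<dots> = real (card {l \<in> V. l \<noteq> i \<and> l \<noteq> j \<and> {i, l} \<in> E \<and> {j, l} \<in> E})"
      using fin by (simp add: sum_of_bool_eq Int_def)
    finally show ?thesis using codeg[OF that] by simp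
  qed
  have deg_a: "(\<Sum>l\<in>V. a i l) \<le> \<Delta>" if "i \<in> V" for i
  proof -
    have "(\<Sum>l\<in>V. a i l) = (\<Sum>l\<in>V. of_bool (l \<noteq> i \<and> {i, l} \<in> E))"
      unfolding a_def by (intro sum.cong) auto
    also have "\<dots> = real (card {j \<in> V. j \<noteq> i \<and> {i, j} \<in> E})"
      using fin by (simp add: sum_of_bool_eq Int_def)
    finally show ?thesis using deg[OF that] by simp
  qed
  have bb: "(\<Sum>l\<in>V. b i l * b j l) = (if i = j then \<theta>\<^sup>2 else 0) - 2 * \<theta> * a i j + G i j"
    if "i \<in> V" "j \<in> V" for i j
  proof -
    have "(\<Sum>l\<in>V. b i l * b j l) = (\<Sum>l\<in>V. (if l = i then (if i = j then \<theta>\<^sup>2 else 0) - \<theta> * a j i else 0)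
        + (if l = j then - \<theta> * a i j else 0) + a i l * a j l)"
      unfolding b_def by (intro sum.cong) (auto simp: algebra_simps power2_eq_square)
    then show ?thesis using that fin a_sym[of j i]
      by (simp add: sum.distrib sum.delta G_def)
  qed
  have "psd V N"
    unfolding psd_def
  proof (intro conjI ballI allI)
    fix i j assume "i \<in> V" "j \<in> V"
    then show "N i j = N j i" using a_sym[of i j] G_sym[of i j] by (auto simp: N_def C_def bb)
  next
    fix x :: "nat \<Rightarrow> real"
    have "0 \<le> qform V (\<lambda>i j. (if i = j then \<Sum>l\<in>V. C i l else 0) - C i j) x"
      by (rule qform_laplacian_nonneg[OF fin])
        (auto simp: C_def a_sym G_sym a_def insert_commute intro!: mult_nonneg_nonneg G0)
    moreover have "0 \<le> qform V (\<lambda>i j. \<Sum>l\<in>V. b i l * b j l) x"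
      unfolding qform_sum by (intro sum_nonneg) (simp add: qform_rank_one)
    ultimately show "0 \<le> qform V N x"
      unfolding N_def qform_scale qform_add using \<theta>0 by (intro mult_nonneg_nonneg add_nonneg_nonneg) auto
  qed
  moreover have "N i i \<le> \<theta>" if i: "i \<in> V" for i
  proof -
    have "(\<Sum>l\<in>V. C i l) \<le> (\<Sum>l\<in>V. a i l * q)"
    proof (intro sum_mono)
      fix l assume "l \<in> V"
      then show "C i l \<le> a i l * q" using G_le[OF i, of l] by (auto simp: C_def a_def)
    qed
    also have "\<dots> \<le> \<Delta> * q" using deg_a[OF i] q by (simp add: sum_distrib_right[symmetric] mult_right_mono)
    finally have 1: "(\<Sum>l\<in>V. C i l) \<le> \<Delta> * q" .
    have "G i i = (\<Sum>l\<in>V. a i l)" unfolding G_def by (intro sum.cong) (auto simp: a_def)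
    then have 2: "G i i \<le> \<Delta>" using deg_a[OF i] by simp
    have "N i i = (1 / (2 * \<theta>)) * (\<theta>\<^sup>2 + G i i + (\<Sum>l\<in>V. C i l))"
      using i by (simp add: N_def bb aa C_def)
    also have "\<dots> \<le> (1 / (2 * \<theta>)) * (\<theta>\<^sup>2 + \<theta>\<^sup>2)"
      using 1 2 \<theta>2 \<theta>0 by (intro mult_left_mono) auto
    also have "\<dots> = \<theta>" using \<theta>0 by (simp add: power2_eq_square field_simps)
    finally show ?thesis .
  qed
  moreover have "if {i, j} \<in> E then P (1 + N i j) else Q (1 + N i j)"
    if ij: "i \<in> V" "j \<in> V" "i \<noteq> j" for i j
  proof (cases "{i, j} \<in> E")
    case True
    then have "N i j = -1" using ij \<theta>0 by (simp add: N_def bb C_def a_def)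
    then show ?thesis using True P_zero by simp
  next
    case False
    then have "N i j = (1 / (2 * \<theta>)) * G i j" using ij by (simp add: N_def bb C_def a_def)
    then show ?thesis using False Q_nonneg[of "1 + N i j"] G0[of i j] \<theta>0 by simp
  qed
  ultimately show ?thesis unfolding feas_def
    by (intro exI[of _ "\<lambda>i j. 1 + N i j"]) auto
qed

lemma feas_iff_vectors:
  assumes k: "1 < k"
  shows "feas {1..n} E k \<longleftrightarrow> (\<exists>v. unit_family n v \<and> (\<forall>i\<in>{1..n}. \<forall>j\<in>{1..n}. i \<noteq> j \<longrightarrow>
    (if {i, j} \<in> E then P (1 + (k - 1) * ip n (v i) (v j)) else Q (1 + (k - 1) * ip n (v i) (v j)))))"
proof
  assume "feas {1..n} E k"
  then obtain Z where Z: "psd {1..n} (\<lambda>i j. Z i j - 1)" "\<forall>i\<in>{1..n}. Z i i \<le> k"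
    "\<forall>i\<in>{1..n}. \<forall>j\<in>{1..n}. i \<noteq> j \<longrightarrow> (if {i, j} \<in> E then P (Z i j) else Q (Z i j))"
    unfolding feas_def by blast
  \<comment> \<open>Raising the diagonal to exactly \<open>k\<close> adds a nonnegative diagonal
    matrix and makes the vectors unit vectors.\<close>
  define M where "M i j = (1 / (k - 1)) * ((Z i j - 1) + (if i = j then k - Z i i else 0))" for i j
  have "psd {1..n} M"
    unfolding psd_def
  proof (intro conjI ballI allI)
    fix i j assume "i \<in> {1..n}" "j \<in> {1..n}"
    then show "M i j = M j i" using psd_sym[OF Z(1), of i j] by (simp add: M_def)
  next
    fix x
    have "qform {1..n} M x = (1 / (k - 1)) * (qform {1..n} (\<lambda>i j. Z i j - 1) x + (\<Sum>i\<in>{1..n}. (x i)\<^sup>2 * (k - Z i i)))"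
      unfolding M_def qform_scale qform_add by (simp add: qform_diag)
    also have "\<dots> \<ge> 0"
      using Z(1,2) k by (intro mult_nonneg_nonneg add_nonneg_nonneg sum_nonneg) (auto simp: psd_def)
    finally show "0 \<le> qform {1..n} M x" .
  qed
  then obtain v where v: "\<And>i j. i \<in> {1..n} \<Longrightarrow> j \<in> {1..n} \<Longrightarrow> ip n (v i) (v j) = M i j"
    using psd_gram by blast
  have "1 + (k - 1) * ip n (v i) (v j) = Z i j" if "i \<in> {1..n}" "j \<in> {1..n}" "i \<noteq> j" for i j
    using v[of i j] that k by (simp add: M_def)
  moreover have "unit_family n v" using v k by (simp add: unit_family_def M_def)
  ultimately show "\<exists>v. unit_family n v \<and> (\<forall>i\<in>{1..n}. \<forall>j\<in>{1..n}. i \<noteq> j \<longrightarrow>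
    (if {i, j} \<in> E then P (1 + (k - 1) * ip n (v i) (v j)) else Q (1 + (k - 1) * ip n (v i) (v j))))"
    using Z(3) by (intro exI[of _ v]) simp
next
  assume "\<exists>v. unit_family n v \<and> (\<forall>i\<in>{1..n}. \<forall>j\<in>{1..n}. i \<noteq> j \<longrightarrow>
    (if {i, j} \<in> E then P (1 + (k - 1) * ip n (v i) (v j)) else Q (1 + (k - 1) * ip n (v i) (v j))))"
  then obtain v where v: "unit_family n v" "\<forall>i\<in>{1..n}. \<forall>j\<in>{1..n}. i \<noteq> j \<longrightarrow>
    (if {i, j} \<in> E then P (1 + (k - 1) * ip n (v i) (v j)) else Q (1 + (k - 1) * ip n (v i) (v j)))" by blast
  have "psd {1..n} (\<lambda>i j. (1 + (k - 1) * ip n (v i) (v j)) - 1)"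
    unfolding psd_def
  proof (intro conjI ballI allI)
    fix x
    have "qform {1..n} (\<lambda>i j. (1 + (k - 1) * ip n (v i) (v j)) - 1) x
        = (k - 1) * (\<Sum>l\<in>{1..n}. (\<Sum>i\<in>{1..n}. x i * v i l)\<^sup>2)"
      unfolding ip_def by (simp only: add_diff_cancel_left' qform_scale qform_sum qform_rank_one)
    then show "0 \<le> qform {1..n} (\<lambda>i j. (1 + (k - 1) * ip n (v i) (v j)) - 1) x"
      using k by (simp add: sum_nonneg)
  qed (simp add: ip_def mult.commute)
  moreover have "\<forall>i\<in>{1..n}. 1 + (k - 1) * ip n (v i) (v i) \<le> k"
    using v(1) by (simp add: unit_family_def)
  ultimately show "feas {1..n} E k"
    unfolding feas_def using v(2)
    by (intro exI[of _ "\<lambda>i j. 1 + (k - 1) * ip n (v i) (v j)"] conjI)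
qed

lemma theta_le: "feas S E k \<Longrightarrow> 1 < k \<Longrightarrow> theta S E \<le> k"
  unfolding theta_def by (intro cInf_lower) (auto intro: bdd_belowI[of _ 1])

lemma feas_card:
  assumes "finite S" shows "feas S E (real (card S))"
proof -
  obtain c where c: "bij_betw c S {0..<card S}" using assms ex_bij_betw_finite_nat by blast
  show ?thesis
  proof (rule feas_colorable[OF assms])
    show "c i < card S" if "i \<in> S" for i using bij_betwE[OF c] that by auto
    show "c i \<noteq> c j" if "i \<in> S" "j \<in> S" "i \<noteq> j" for i j
      using bij_betw_imp_inj_on[OF c] that by (auto dest: inj_onD)
  qed
qed

text \<open>Works with strict inequality instead of attainment of the infimum; this is why
  feasibility is later asked for slightly above a quantile.\<close>

lemma feas_theta_less:
  assumes "finite S" "theta S E < k" shows "feas S E k"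
proof -
  have "1 < real (card S) + 2" by simp
  moreover have "feas S E (real (card S) + 2)" by (rule feas_mono[OF feas_card[OF assms(1)]]) simp
  ultimately have "{k. 1 < k \<and> feas S E k} \<noteq> {}" by blast
  then obtain k' where "feas S E k'" "k' < k"
    using assms(2) cInf_lessD[of "{k. 1 < k \<and> feas S E k}" k] unfolding theta_def by blast
  then show ?thesis using feas_mono[of S E k' k] by simp
qed

end

section \<open>The three parameters as instances\<close>

interpretation half: coloring_cone "\<lambda>x. x \<le> 0" "\<lambda>_. True"
  by unfold_locales (auto simp: mult_nonneg_nonpos)

interpretation strict: coloring_cone "\<lambda>x. x = 0" "\<lambda>_. True"
  by unfold_locales auto

interpretation rigid: coloring_cone "\<lambda>x. x = 0" "\<lambda>x. 0 \<le> x"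
  by unfold_locales auto

lemma all_edges_neq: "E \<subseteq> all_edges n \<Longrightarrow> {i, j} \<in> E \<Longrightarrow> i \<noteq> j"
  by (auto simp: all_edges_def doubleton_eq_iff)

lemma threshold_iff:
  fixes k z :: real assumes "1 < k"
  shows "z \<le> - 1 / (k - 1) \<longleftrightarrow> 1 + (k - 1) * z \<le> 0" "z = - 1 / (k - 1) \<longleftrightarrow> 1 + (k - 1) * z = 0"
    "- 1 / (k - 1) \<le> z \<longleftrightarrow> 0 \<le> 1 + (k - 1) * z"
  using assms by (auto simp: field_simps)

lemma vtheta_half_eq:
  assumes "E \<subseteq> all_edges n" shows "vtheta_half n E = half.theta {1..n} E"
proof -
  have "half.feas {1..n} E k \<longleftrightarrow> (\<exists>v. vector_coloring n E k v)" if "1 < k" for k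
    unfolding half.feas_iff_vectors[OF that] vector_coloring_def threshold_iff[OF that]
    using all_edges_neq[OF assms] by (intro ex_cong1) auto
  then show ?thesis unfolding vtheta_half_def half.theta_def by (intro arg_cong[of _ _ Inf]) auto
qed

lemma vtheta_eq:
  assumes "E \<subseteq> all_edges n" shows "vtheta n E = strict.theta {1..n} E"
proof -
  have "strict.feas {1..n} E k \<longleftrightarrow> (\<exists>v. strict_vector_coloring n E k v)" if "1 < k" for k
    unfolding strict.feas_iff_vectors[OF that] strict_vector_coloring_def threshold_iff[OF that]
    using all_edges_neq[OF assms] by (intro ex_cong1) auto
  then show ?thesis unfolding vtheta_def strict.theta_def by (intro arg_cong[of _ _ Inf]) auto
qed

lemma vtheta2_eq:
  assumes "E \<subseteq> all_edges n" shows "vtheta2 n E = rigid.theta {1..n} E"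
proof -
  have "rigid.feas {1..n} E k \<longleftrightarrow> (\<exists>v. rigid_vector_coloring n E k v)" if "1 < k" for k
    unfolding rigid.feas_iff_vectors[OF that] rigid_vector_coloring_def strict_vector_coloring_def
      threshold_iff[OF that]
    using all_edges_neq[OF assms] by (intro ex_cong1) (auto split: if_splits)
  then show ?thesis unfolding vtheta2_def rigid.theta_def by (intro arg_cong[of _ _ Inf]) auto
qed

section \<open>Sparse edge sets\<close>

definition edges_in :: "nat set set \<Rightarrow> nat set \<Rightarrow> nat set set" where
  "edges_in E S = {e \<in> E. e \<subseteq> S}"

lemma all_edges_card: "e \<in> all_edges n \<Longrightarrow> finite e \<and> card e = 2"
  by (auto simp: all_edges_def)

lemma all_edges_memI: "i \<in> {1..n} \<Longrightarrow> j \<in> {1..n} \<Longrightarrow> i \<noteq> j \<Longrightarrow> {i, j} \<in> all_edges n"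
  unfolding all_edges_def by blast

lemma all_edges_subset: "e \<in> all_edges n \<Longrightarrow> e \<subseteq> {1..n}"
  by (auto simp: all_edges_def)

lemma finite_all_edges: "finite (all_edges n)"
  by (rule finite_subset[of _ "Pow {1..n}"]) (use all_edges_subset in blast, simp)

lemma low_degree_vertex:
  assumes E: "E \<subseteq> all_edges n" and S: "finite S" "S \<noteq> {}"
    and sparse: "2 * card (edges_in E S) < (D + 1) * card S"
  shows "\<exists>i\<in>S. card {j \<in> S. {i, j} \<in> E} \<le> D"
proof (rule ccontr)
  assume "\<not> ?thesis"
  then have big: "D + 1 \<le> card {j \<in> S. {i, j} \<in> E}" if "i \<in> S" for i using that by force
  have fin: "finite (edges_in E S)"
    unfolding edges_in_def using finite_subset[OF E finite_all_edges] by simp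
  have "(D + 1) * card S = (\<Sum>i\<in>S. D + 1)" by simp
  also have "\<dots> \<le> (\<Sum>i\<in>S. \<Sum>e\<in>edges_in E S. of_bool (i \<in> e))"
  proof (intro sum_mono)
    fix i assume i: "i \<in> S"
    have "inj_on (\<lambda>j. {i, j}) {j \<in> S. {i, j} \<in> E}" by (auto simp: inj_on_def doubleton_eq_iff)
    moreover have "(\<lambda>j. {i, j}) ` {j \<in> S. {i, j} \<in> E} \<subseteq> {e \<in> edges_in E S. i \<in> e}"
      using i by (auto simp: edges_in_def)
    ultimately have "card {j \<in> S. {i, j} \<in> E} \<le> card {e \<in> edges_in E S. i \<in> e}"
      using fin by (intro card_inj_on_le) auto
    also have "\<dots> = (\<Sum>e\<in>edges_in E S. of_bool (i \<in> e))"
      using fin by (simp add: sum_of_bool_eq Int_def)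
    finally show "D + 1 \<le> (\<Sum>e\<in>edges_in E S. of_bool (i \<in> e))" using big[OF i] by simp
  qed
  also have "\<dots> = (\<Sum>e\<in>edges_in E S. \<Sum>i\<in>S. of_bool (i \<in> e))" by (rule sum.swap)
  also have "\<dots> = (\<Sum>e\<in>edges_in E S. 2)"
  proof (intro sum.cong refl)
    fix e assume e: "e \<in> edges_in E S"
    then have "S \<inter> {i. i \<in> e} = e" by (auto simp: edges_in_def)
    moreover have "card e = 2" using e E all_edges_card by (auto simp: edges_in_def)
    ultimately show "(\<Sum>i\<in>S. of_bool (i \<in> e)) = (2::nat)" using S(1) by (simp add: sum_of_bool_eq)
  qed
  finally show False using sparse by simp
qed

text \<open>Degeneracy: every nonempty subset has average degree below \<open>D + 1\<close>, so some
  vertex has at most \<open>D\<close> neighbours in it; color the rest first, and one of the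
  \<open>D + 1\<close> colors is free.\<close>

lemma sparse_colorable:
  assumes E: "E \<subseteq> all_edges n" and "finite S"
    and "\<And>T. T \<subseteq> S \<Longrightarrow> T \<noteq> {} \<Longrightarrow> 2 * card (edges_in E T) < (D + 1) * card T"
  shows "\<exists>c. (\<forall>i\<in>S. c i < D + 1) \<and> (\<forall>i\<in>S. \<forall>j\<in>S. {i, j} \<in> E \<longrightarrow> c i \<noteq> (c j :: nat))"
  using assms(2,3)
proof (induction S rule: finite_psubset_induct)
  case (psubset S)
  show ?case
  proof (cases "S = {}")
    case False
    then obtain i where i: "i \<in> S" and deg: "card {j \<in> S. {i, j} \<in> E} \<le> D"
      using low_degree_vertex[OF E psubset.hyps False, of D] psubset.prems[of S] by auto
    have "\<exists>c. (\<forall>j\<in>S - {i}. c j < D + 1) \<and> (\<forall>j\<in>S - {i}. \<forall>l\<in>S - {i}. {j, l} \<in> E \<longrightarrow> c j \<noteq> (c l :: nat))"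
      by (rule psubset.IH) (use i psubset.prems in auto)
    then obtain c where c: "\<forall>j\<in>S - {i}. c j < D + 1"
      "\<forall>j\<in>S - {i}. \<forall>l\<in>S - {i}. {j, l} \<in> E \<longrightarrow> c j \<noteq> (c l :: nat)" by blast
    let ?N = "{j \<in> S. {i, j} \<in> E}"
    have "card (c ` ?N) \<le> D" using card_image_le[of ?N c] psubset.hyps deg by simp
    then have "\<not> {..<D + 1} \<subseteq> c ` ?N"
      using card_mono[of "c ` ?N" "{..<D + 1}"] psubset.hyps by auto
    then obtain a where a: "a < D + 1" "a \<notin> c ` ?N" by auto
    let ?c = "c(i := a)"
    have "?c j \<noteq> ?c l" if jl: "j \<in> S" "l \<in> S" "{j, l} \<in> E" for j l
    proof -
      have ne: "j \<noteq> l" using all_edges_neq[OF E jl(3)] .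
      show ?thesis
      proof (cases "j = i")
        case True then show ?thesis using a(2) jl ne by auto
      next
        case False
        then show ?thesis using a(2) jl ne c(2) by (cases "l = i") (auto simp: insert_commute)
      qed
    qed
    then show ?thesis using c(1) a(1) by (intro exI[of _ ?c]) auto
  qed auto
qed

text \<open>Luczak's closure: adding to \<open>U\<close> the two ends of an edge between neighbours of \<open>U\<close> creates
  three new edges, which the sparsity of small sets permits only boundedly often.\<close>

lemma independent_neighbourhood_closure:
  assumes E: "E \<subseteq> all_edges n" and U0: "U0 \<subseteq> {1..n}" "real (card U0) \<le> m"
    and sparse: "\<And>S. S \<subseteq> {1..n} \<Longrightarrow> S \<noteq> {} \<Longrightarrow> real (card S) \<le> M \<Longrightarrow>
      real (card (edges_in E S)) < \<rho> * real (card S)"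
    and \<rho>: "0 \<le> \<rho>" and mM: "m \<le> M" "3 * m + 6 < (3 - 2 * \<rho>) * M"
  obtains U where "U0 \<subseteq> U" "U \<subseteq> {1..n}" "real (card U) \<le> M"
    "\<And>x y a b. x \<in> {1..n} - U \<Longrightarrow> y \<in> {1..n} - U \<Longrightarrow> {x, y} \<in> E \<Longrightarrow> a \<in> U \<Longrightarrow> b \<in> U \<Longrightarrow>
      {x, a} \<in> E \<Longrightarrow> {y, b} \<in> E \<Longrightarrow> False"
proof -
  \<comment> \<open>Each enlargement adds two vertices and at least three edges, and the last
    inequality records exactly that ratio. A largest member of the family serves as the
    closure.\<close>
  let ?\<W> = "{U. U0 \<subseteq> U \<and> U \<subseteq> {1..n} \<and> real (card U) \<le> M \<and> 3 * card U \<le> 2 * card (edges_in E U) + 3 * card U0}"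
  have fin: "finite ?\<W>" by (rule finite_subset[of _ "Pow {1..n}"]) auto
  have "U0 \<in> ?\<W>" using U0 mM(1) by auto
  then have ne: "?\<W> \<noteq> {}" by blast
  have "Max (card ` ?\<W>) \<in> card ` ?\<W>" using fin ne by (intro Max_in) auto
  then obtain U where U: "U \<in> ?\<W>" and "card U = Max (card ` ?\<W>)" by auto
  then have max: "card U' \<le> card U" if "U' \<in> ?\<W>" for U'
    using that fin Max_ge[of "card ` ?\<W>" "card U'"] by auto
  show ?thesis
  proof (rule that)
    fix x y a b
    assume xy: "x \<in> {1..n} - U" "y \<in> {1..n} - U" "{x, y} \<in> E"
      and ab: "a \<in> U" "b \<in> U" "{x, a} \<in> E" "{y, b} \<in> E"
    have xny: "x \<noteq> y" using all_edges_neq[OF E xy(3)] .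
    let ?U = "insert x (insert y U)"
    have finU: "finite U" using U finite_subset[of U "{1..n}"] by auto
    have finE: "finite (edges_in E S)" for S
      unfolding edges_in_def using finite_subset[OF E finite_all_edges] by simp
    have card_U: "card ?U = card U + 2" using xy xny finU by simp
    have new: "{x, y} \<noteq> {x, a}" "{x, y} \<noteq> {y, b}" "{x, a} \<noteq> {y, b}"
      using xy ab xny by (auto simp: doubleton_eq_iff)
    have "edges_in E U \<union> {{x, y}, {x, a}, {y, b}} \<subseteq> edges_in E ?U"
      using xy ab by (auto simp: edges_in_def)
    moreover have "edges_in E U \<inter> {{x, y}, {x, a}, {y, b}} = {}"
      using xy by (auto simp: edges_in_def)
    ultimately have "card (edges_in E U) + card {{x, y}, {x, a}, {y, b}} \<le> card (edges_in E ?U)"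
      using card_mono[OF finE[of ?U]] finE[of U]
      by (metis card_Un_disjoint finite.emptyI finite_insert)
    then have e3: "card (edges_in E U) + 3 \<le> card (edges_in E ?U)" using new by simp
    \<comment> \<open>The enlarged set keeps the invariant, so by maximality it must be larger than
      \<open>M\<close>. Then \<open>U\<close> itself has more than \<open>M - 2\<close> vertices,
      and sparsity contradicts the invariant; the 6 in the hypothesis pays for the missing two
      vertices.\<close>
    have "?U \<notin> ?\<W>" using max[of ?U] card_U by auto
    then have "\<not> real (card ?U) \<le> M" using U e3 card_U xy by auto
    then have big: "M - 2 < real (card U)" using card_U by simp
    have "real (card (edges_in E U)) < \<rho> * real (card U)" using U ab by (intro sparse) auto
    moreover have "real (3 * card U) \<le> real (2 * card (edges_in E U) + 3 * card U0)"
      using U by (simp only: of_nat_le_iff mem_Collect_eq)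
    ultimately have 1: "(3 - 2 * \<rho>) * real (card U) < 3 * m" using U0(2) by (simp add: algebra_simps)
    have "0 \<le> m" using U0(2) by linarith
    have pos: "0 \<le> 3 - 2 * \<rho>"
    proof (rule ccontr)
      assume "\<not> 0 \<le> 3 - 2 * \<rho>"
      then have "(3 - 2 * \<rho>) * M \<le> 0"
        using mM(1) \<open>0 \<le> m\<close> by (intro mult_nonpos_nonneg) auto
      then show False using mM(2) \<open>0 \<le> m\<close> by linarith
    qed
    have "(3 - 2 * \<rho>) * (M - 2) \<le> (3 - 2 * \<rho>) * real (card U)"
      using big pos by (intro mult_left_mono) auto
    then show False using 1 mM(2) \<rho> by (simp add: algebra_simps)
  qed (use U in auto)
qed

context coloring_cone
begin

lemma feas_extend_sparse:
  assumes E: "E \<subseteq> all_edges n" and V: "finite V" and U: "U \<subseteq> V" and k: "feas (V - U) E k" "0 < k"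
    and sparse: "\<And>T. T \<subseteq> U \<Longrightarrow> T \<noteq> {} \<Longrightarrow> 2 * card (edges_in E T) < (D + 1) * card T"
  shows "feas V E (k + real (D + 1))"
proof -
  have finU: "finite U" using V U finite_subset by blast
  obtain c where c: "\<forall>i\<in>U. c i < D + 1" "\<forall>i\<in>U. \<forall>j\<in>U. {i, j} \<in> E \<longrightarrow> c i \<noteq> (c j :: nat)"
    using sparse_colorable[OF E finU sparse] by blast
  have "feas U E (real (D + 1))"
    by (rule feas_colorable[OF finU, of c]) (use c in auto)
  then have "feas (V - U \<union> U) E (k + real (D + 1))"
    using k V finU by (intro feas_join) auto
  moreover have "V - U \<union> U = V" using U by auto
  ultimately show ?thesis by simp
qed

text \<open>With \<open>U\<close> the closure, \<open>N\<close> its neighbourhood and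
  \<open>W\<close> the rest, no edge joins \<open>W\<close> to \<open>U\<close>, so both share
  \<open>k + 1\<close>, and the independent set \<open>N\<close> takes one more color.\<close>

lemma feas_extend_closure:
  assumes E: "E \<subseteq> all_edges n" and U0: "U0 \<subseteq> {1..n}" "real (card U0) \<le> m"
    and k: "feas ({1..n} - U0) E k" "2 \<le> k"
    and sparse: "\<And>S. S \<subseteq> {1..n} \<Longrightarrow> S \<noteq> {} \<Longrightarrow> real (card S) \<le> M \<Longrightarrow>
      real (card (edges_in E S)) < \<rho> * real (card S)"
    and \<rho>: "0 \<le> \<rho>" "\<rho> \<le> 3 / 2" and mM: "m \<le> M" "3 * m + 6 < (3 - 2 * \<rho>) * M"
  shows "feas {1..n} E (k + 2)"
proof -
  obtain U where U: "U0 \<subseteq> U" "U \<subseteq> {1..n}" "real (card U) \<le> M"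
    and closed: "\<And>x y a b. x \<in> {1..n} - U \<Longrightarrow> y \<in> {1..n} - U \<Longrightarrow> {x, y} \<in> E \<Longrightarrow> a \<in> U \<Longrightarrow> b \<in> U \<Longrightarrow>
      {x, a} \<in> E \<Longrightarrow> {y, b} \<in> E \<Longrightarrow> False"
    by (rule independent_neighbourhood_closure[OF E U0 sparse \<rho>(1) mM]; blast)
  have finU: "finite U" using U(2) finite_subset by blast
  define N where "N = {x \<in> {1..n} - U. \<exists>a\<in>U. {x, a} \<in> E}"
  define W where "W = {1..n} - U - N"
  have finW: "finite W" and finN: "finite N" by (auto simp: W_def N_def)
  have "feas U E (real (2 + 1))"
  proof -
    have "2 * card (edges_in E T) < (2 + 1) * card T" if "T \<subseteq> U" "T \<noteq> {}" for T
    proof -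
      have "real (card T) \<le> M" using U(3) card_mono[OF finU that(1)] by linarith
      then have "real (card (edges_in E T)) < \<rho> * real (card T)" using that U(2) by (intro sparse) auto
      also have "\<dots> \<le> 3 / 2 * real (card T)" using \<rho> by (intro mult_right_mono) auto
      finally have "real (2 * card (edges_in E T)) < real ((2 + 1) * card T)" by simp
      then show ?thesis by (simp only: of_nat_less_iff)
    qed
    then obtain c where "\<forall>i\<in>U. c i < 2 + 1" "\<forall>i\<in>U. \<forall>j\<in>U. {i, j} \<in> E \<longrightarrow> c i \<noteq> (c j :: nat)"
      using sparse_colorable[OF E finU] by blast
    then show ?thesis by (intro feas_colorable[OF finU, of c]) auto
  qed
  \<comment> \<open>Three colors fit into \<open>k + 1\<close> because
    \<open>k \<ge> 2\<close>.\<close>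
  then have fU: "feas U E (k + 1)" by (rule feas_mono) (use k in auto)
  have fW: "feas W E (k + 1)"
    by (rule feas_mono[OF feas_subset[OF k(1)]]) (use U in \<open>auto simp: W_def\<close>)
  have "feas (W \<union> U) E (k + 1)"
  proof (rule feas_disjoint_Un[OF fW fU _ finW finU])
    show "{i, j} \<notin> E" if "i \<in> W" "j \<in> U" for i j using that by (auto simp: W_def N_def)
  qed (auto simp: W_def)
  moreover have "feas N E (real 1)"
    by (rule feas_colorable[OF finN, of "\<lambda>_. 0"]) (use closed in \<open>auto simp: N_def\<close>)
  ultimately have "feas (W \<union> U \<union> N) E (k + 1 + real 1)"
    by (rule feas_join) (use finW finU finN k in \<open>auto simp: W_def N_def\<close>)
  moreover have "W \<union> U \<union> N = {1..n}" using U(2) by (auto simp: W_def N_def)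
  ultimately show ?thesis by (simp add: add.commute)
qed

end

section \<open>First moment bounds\<close>

lemma bprob_ex_card_subset:
  assumes A: "finite A" "X \<subseteq> A" and p: "0 \<le> p" "p \<le> 1"
  shows "bprob A p (\<lambda>E. e \<le> card (E \<inter> X)) \<le> real (card X choose e) * p ^ e"
proof -
  have finX: "finite X" using A finite_subset by blast
  have "bprob A p (\<lambda>E. e \<le> card (E \<inter> X)) \<le> bprob A p (\<lambda>E. \<exists>F\<in>{F. F \<subseteq> X \<and> card F = e}. F \<subseteq> E)"
  proof (rule bprob_mono[OF p])
    fix E assume "e \<le> card (E \<inter> X)"
    then obtain F where "F \<subseteq> E \<inter> X" "card F = e" by (meson obtain_subset_with_card_n)
    then show "\<exists>F\<in>{F. F \<subseteq> X \<and> card F = e}. F \<subseteq> E" by auto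
  qed
  also have "\<dots> \<le> (\<Sum>F\<in>{F. F \<subseteq> X \<and> card F = e}. p ^ card F)"
    using A by (intro bprob_ex_subset p) auto
  also have "\<dots> = real (card X choose e) * p ^ e"
    using n_subsets[OF finX, of e] by simp
  finally show ?thesis .
qed

text \<open>The left side divided by the factorial is one term of the series of
  \<open>exp (real e)\<close>, and 3 replaces Euler's number.\<close>

lemma power_self_le_fact: "real e ^ e \<le> 3 ^ e * fact e"
proof -
  have "real e ^ e / fact e \<le> exp (real e)"
  proof -
    have "(\<lambda>k. real e ^ k / fact k) sums exp (real e)"
      using exp_converges[of "real e"] by (simp add: field_simps scaleR_conv_of_real)
    then have s: "summable (\<lambda>k. real e ^ k / fact k)" "exp (real e) = (\<Sum>k. real e ^ k / fact k)"
      by (auto simp: sums_iff)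
    have "sum (\<lambda>k. real e ^ k / fact k) {e} \<le> (\<Sum>k. real e ^ k / fact k)"
      by (rule sum_le_suminf[OF s(1)]) auto
    then show ?thesis using s(2) by simp
  qed
  also have "exp (real e) = exp 1 ^ e" by (simp add: exp_of_nat_mult[symmetric])
  also have "\<dots> \<le> 3 ^ e" by (intro power_mono exp_le) auto
  finally show ?thesis by (simp add: field_simps)
qed

lemma binomial_upper_bound: "real (N choose e) * real e ^ e \<le> (3 * real N) ^ e"
proof -
  have "real (N choose e) * real e ^ e \<le> real (N choose e) * (3 ^ e * fact e)"
    by (intro mult_left_mono power_self_le_fact) auto
  also have "\<dots> = 3 ^ e * real ((N choose e) * fact e)" by simp
  also have "\<dots> \<le> 3 ^ e * real (N ^ e)"
  proof (intro mult_left_mono of_nat_mono)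
    show "(N choose e) * fact e \<le> N ^ e" by (rule binomial_fact_pow)
  qed auto
  finally show ?thesis by (simp add: power_mult_distrib)
qed

lemma card_edges_in_all_le:
  assumes "finite S" shows "card (edges_in (all_edges n) S) \<le> card S * card S"
proof -
  have "edges_in (all_edges n) S \<subseteq> (\<lambda>(i, j). {i, j}) ` (S \<times> S)"
    by (auto simp: edges_in_def all_edges_def)
  then have "card (edges_in (all_edges n) S) \<le> card ((\<lambda>(i, j). {i, j}) ` (S \<times> S))"
    using assms by (intro card_mono) auto
  also have "\<dots> \<le> card (S \<times> S)" using assms by (intro card_image_le) auto
  finally show ?thesis by (simp add: card_cartesian_product)
qed

text \<open>The first moment of \<open>t\<close>-sets spanning \<open>e\<close> edges. Since
  \<open>K \<le> t * t\<close> and \<open>t \<le> e\<close>, the two binomials give at most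
  \<open>9 ^ e\<close> times \<open>n ^ t * t ^ (e - t) * p ^ e\<close>. Bounding \<open>t\<close>
  in the base by \<open>n powr \<sigma>\<close> leaves the exponent
  \<open>(1 - \<sigma>) * t - (\<beta> - \<sigma>) * e\<close>, and finally
  \<open>t \<le> e / \<rho>\<close>.\<close>

lemma sparse_term_bound:
  fixes \<rho> \<sigma> \<beta> p :: real
  assumes n: "1 \<le> n" and t: "1 \<le> t" "real t \<le> real n powr \<sigma>" and e: "\<rho> * real t \<le> real e"
    and \<rho>: "1 \<le> \<rho>" and \<sigma>: "\<sigma> \<le> 1" and p: "0 \<le> p" "p \<le> real n powr (- \<beta>)"
    and K: "K \<le> t * t"
  shows "real (n choose t) * (real (K choose e) * p ^ e)
    \<le> (9 * real n powr (- ((\<beta> - \<sigma>) - (1 - \<sigma>) / \<rho>))) ^ e"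
proof -
  define N where "N = real n"
  have N: "1 \<le> N" using n by (simp add: N_def)
  have "1 * real t \<le> \<rho> * real t" using \<rho> by (intro mult_right_mono) auto
  then have te: "t \<le> e" using e by linarith
  have e0: "0 < real e" using te t by simp
  have 1: "real (n choose t) \<le> (3 * N) ^ t / real t ^ t"
    using binomial_upper_bound[of n t] t by (simp add: N_def field_simps)
  have "real K \<le> real (t * t)" using K by (simp only: of_nat_le_iff)
  also have "\<dots> \<le> real t * real e" using te by (simp add: mult_left_mono)
  finally have "real K \<le> real t * real e" .
  then have "(3 * real K) ^ e \<le> (3 * (real t * real e)) ^ e" by (intro power_mono) auto
  also have "\<dots> = (3 * real t) ^ e * real e ^ e" by (simp add: power_mult_distrib)
  finally have "real (K choose e) * real e ^ e \<le> (3 * real t) ^ e * real e ^ e"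
    using binomial_upper_bound[of K e] by linarith
  then have 2: "real (K choose e) \<le> (3 * real t) ^ e" using e0 by (simp add: mult_le_cancel_right)
  have "real (n choose t) * (real (K choose e) * p ^ e) \<le> ((3 * N) ^ t / real t ^ t) * ((3 * real t) ^ e * p ^ e)"
    using p 1 2 by (intro mult_mono mult_right_mono) auto
  also have "\<dots> = (3 ^ t * 3 ^ e) * (N ^ t * (real t ^ (e - t) * p ^ e))"
  proof -
    have "real t ^ e = real t ^ (e - t) * real t ^ t" using te by (simp flip: power_add)
    then show ?thesis using t by (simp add: power_mult_distrib field_simps)
  qed
  also have "\<dots> \<le> (3 ^ e * 3 ^ e) * (N ^ t * ((N powr \<sigma>) ^ (e - t) * (N powr (- \<beta>)) ^ e))"
    using te t p N by (intro mult_mono mult_left_mono power_increasing power_mono) (auto simp: N_def)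
  also have "\<dots> = 9 ^ e * N powr (real t + \<sigma> * (real e - real t) - \<beta> * real e)"
  proof -
    have "N ^ t = N powr real t" using N by (simp add: powr_realpow)
    moreover have "(N powr \<sigma>) ^ (e - t) = N powr (\<sigma> * (real e - real t))"
      using te N by (subst powr_realpow[symmetric]) (auto simp: powr_powr of_nat_diff)
    moreover have "(N powr (- \<beta>)) ^ e = N powr (- \<beta> * real e)"
      using N by (subst powr_realpow[symmetric]) (auto simp: powr_powr)
    ultimately show ?thesis
      by (simp add: powr_add[symmetric] power_mult_distrib[symmetric] algebra_simps)
  qed
  also have "\<dots> \<le> 9 ^ e * N powr (- ((\<beta> - \<sigma>) - (1 - \<sigma>) / \<rho>) * real e)"
  proof (intro mult_left_mono powr_mono)
    have "real t \<le> real e / \<rho>" using e \<rho> by (simp add: field_simps)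
    then have "(1 - \<sigma>) * real t \<le> (1 - \<sigma>) * (real e / \<rho>)" using \<sigma> by (intro mult_left_mono) auto
    then show "real t + \<sigma> * (real e - real t) - \<beta> * real e \<le> - ((\<beta> - \<sigma>) - (1 - \<sigma>) / \<rho>) * real e"
      by (simp add: algebra_simps)
  qed (use N in auto)
  also have "N powr (- ((\<beta> - \<sigma>) - (1 - \<sigma>) / \<rho>) * real e) = (N powr (- ((\<beta> - \<sigma>) - (1 - \<sigma>) / \<rho>))) ^ e"
    using N by (subst powr_realpow[symmetric]) (auto simp: powr_powr)
  finally show ?thesis by (simp add: N_def power_mult_distrib)
qed

text \<open>Since \<open>\<rho> \<ge> 1\<close>, a dense \<open>t\<close>-set spans at least
  \<open>t\<close> edges, so the union bound is dominated by a geometric series of ratio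
  \<open>z\<close> starting at \<open>t = 1\<close>.\<close>

lemma bprob_dense_subset:
  fixes \<rho> \<sigma> \<beta> p :: real
  assumes n: "1 \<le> n" and \<rho>: "1 \<le> \<rho>" and \<sigma>: "\<sigma> \<le> 1"
    and p: "0 \<le> p" "p \<le> 1" "p \<le> real n powr (- \<beta>)"
    and z: "z = 9 * real n powr (- ((\<beta> - \<sigma>) - (1 - \<sigma>) / \<rho>))" "z \<le> 1 / 2"
  shows "bprob (all_edges n) p (\<lambda>E. \<exists>S\<subseteq>{1..n}. S \<noteq> {} \<and> real (card S) \<le> real n powr \<sigma> \<and>
      \<rho> * real (card S) \<le> real (card (edges_in E S))) \<le> 2 * z"
proof -
  let ?A = "all_edges n"
  define I where "I = {t. 1 \<le> t \<and> t \<le> n \<and> real t \<le> real n powr \<sigma>}"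
  define J where "J t = {S. S \<subseteq> {1..n} \<and> card S = t}" for t
  define e where "e t = nat \<lceil>\<rho> * real t\<rceil>" for t
  have finI: "finite I" unfolding I_def by (rule finite_subset[of _ "{..n}"]) auto
  have finJ: "finite (J t)" for t unfolding J_def by (rule finite_subset[of _ "Pow {1..n}"]) auto
  have e: "\<rho> * real t \<le> real (e t)" "t \<le> e t" for t
  proof -
    show 1: "\<rho> * real t \<le> real (e t)" unfolding e_def by (rule real_nat_ceiling_ge)
    have "1 * real t \<le> \<rho> * real t" using \<rho> by (intro mult_right_mono) auto
    then show "t \<le> e t" using 1 by linarith
  qed
  have z0: "0 \<le> z" using z by simp
  have "bprob ?A p (\<lambda>E. \<exists>S\<subseteq>{1..n}. S \<noteq> {} \<and> real (card S) \<le> real n powr \<sigma> \<and>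
      \<rho> * real (card S) \<le> real (card (edges_in E S)))
    \<le> bprob ?A p (\<lambda>E. \<exists>t\<in>I. \<exists>S\<in>J t. e t \<le> card (E \<inter> edges_in ?A S))"
  proof (rule bprob_mono[OF p(1,2)])
    fix E assume E: "E \<subseteq> ?A" and "\<exists>S\<subseteq>{1..n}. S \<noteq> {} \<and> real (card S) \<le> real n powr \<sigma> \<and>
      \<rho> * real (card S) \<le> real (card (edges_in E S))"
    then obtain S where S: "S \<subseteq> {1..n}" "S \<noteq> {}" "real (card S) \<le> real n powr \<sigma>"
      "\<rho> * real (card S) \<le> real (card (edges_in E S))" by blast
    have finS: "finite S" using S(1) finite_subset by blast
    have "card S \<in> I" using S finS card_mono[OF _ S(1)] by (auto simp: I_def card_gt_0_iff Suc_le_eq)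
    moreover have "S \<in> J (card S)" using S by (simp add: J_def)
    moreover have "E \<inter> edges_in ?A S = edges_in E S" using E by (auto simp: edges_in_def)
    moreover have "e (card S) \<le> card (edges_in E S)" unfolding e_def using S(4) by linarith
    ultimately show "\<exists>t\<in>I. \<exists>S\<in>J t. e t \<le> card (E \<inter> edges_in ?A S)"
      by (intro bexI[of _ "card S"] bexI[of _ S]) simp_all
  qed
  also have "\<dots> \<le> (\<Sum>t\<in>I. \<Sum>S\<in>J t. bprob ?A p (\<lambda>E. e t \<le> card (E \<inter> edges_in ?A S)))"
    by (intro order.trans[OF bprob_ex_le_sum[OF finI p(1,2)]] sum_mono bprob_ex_le_sum finJ p)
  also have "\<dots> \<le> (\<Sum>t\<in>I. z ^ t)"
  proof (intro sum_mono)
    fix t assume t: "t \<in> I"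
    have "(\<Sum>S\<in>J t. bprob ?A p (\<lambda>E. e t \<le> card (E \<inter> edges_in ?A S)))
        \<le> (\<Sum>S\<in>J t. real ((t * t) choose e t) * p ^ e t)"
    proof (intro sum_mono)
      fix S assume S: "S \<in> J t"
      then have "finite S" "card S = t" using finite_subset[of S "{1..n}"] by (auto simp: J_def)
      then have "card (edges_in ?A S) \<le> t * t" using card_edges_in_all_le[of S n] by simp
      then have "real (card (edges_in ?A S) choose e t) \<le> real ((t * t) choose e t)"
        by (intro of_nat_mono binomial_right_mono)
      then show "bprob ?A p (\<lambda>E. e t \<le> card (E \<inter> edges_in ?A S)) \<le> real ((t * t) choose e t) * p ^ e t"
        using bprob_ex_card_subset[OF finite_all_edges, of "edges_in ?A S" n p "e t"] p
        by (smt (verit, ccfv_SIG) edges_in_def mem_Collect_eq mult_right_mono subsetI zero_le_power)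
    qed
    also have "\<dots> = real (n choose t) * (real ((t * t) choose e t) * p ^ e t)"
      using n_subsets[of "{1..n}" t] by (simp add: J_def)
    also have "\<dots> \<le> z ^ e t"
      unfolding z(1) by (rule sparse_term_bound) (use n t e \<rho> \<sigma> p in \<open>auto simp: I_def\<close>)
    also have "\<dots> \<le> z ^ t" using z0 z(2) e(2) by (intro power_decreasing) auto
    finally show "(\<Sum>S\<in>J t. bprob ?A p (\<lambda>E. e t \<le> card (E \<inter> edges_in ?A S))) \<le> z ^ t" .
  qed
  also have "\<dots> \<le> (\<Sum>t\<in>{1..n}. z ^ t)"
    using z0 by (intro sum_mono2) (auto simp: I_def)
  also have "\<dots> \<le> z * (\<Sum>t<n. z ^ t)"
    unfolding sum_distrib_left by (rule eq_refl, rule sum.reindex_bij_witness[of _ Suc "\<lambda>t. t - 1"])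
      (auto simp flip: power_Suc)
  also have "\<dots> \<le> z * 2"
  proof (rule mult_left_mono[OF _ z0])
    have "(\<Sum>t<n. z ^ t) = (1 - z ^ n) / (1 - z)" using z(2) by (subst sum_gp_strict) auto
    also have "\<dots> \<le> 1 / (1 - z)" using z0 z(2) by (intro divide_right_mono) auto
    also have "\<dots> \<le> 2" using z(2) by (simp add: field_simps)
    finally show "(\<Sum>t<n. z ^ t) \<le> 2" .
  qed
  finally show ?thesis by (simp add: mult.commute)
qed

lemma bprob_large_degree:
  assumes n: "1 \<le> n" and d: "1 \<le> d" and p: "0 \<le> p" "p \<le> 1"
  shows "bprob (all_edges n) p (\<lambda>E. \<exists>i\<in>{1..n}. d \<le> card {j \<in> {1..n}. j \<noteq> i \<and> {i, j} \<in> E})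
    \<le> real n * (3 * real n * p / real d) ^ d"
proof -
  let ?A = "all_edges n"
  define X where "X i = (\<lambda>j. {i, j}) ` ({1..n} - {i})" for i
  have X: "X i \<subseteq> ?A" if "i \<in> {1..n}" for i using that unfolding X_def by (auto intro!: all_edges_memI)
  have cX: "card (X i) \<le> n" if "i \<in> {1..n}" for i
  proof -
    have "card (X i) \<le> card ({1..n} - {i})" unfolding X_def by (intro card_image_le) auto
    also have "\<dots> \<le> card {1..n}" by (intro card_mono) auto
    finally show ?thesis by simp
  qed
  have "bprob ?A p (\<lambda>E. \<exists>i\<in>{1..n}. d \<le> card {j \<in> {1..n}. j \<noteq> i \<and> {i, j} \<in> E})
      \<le> bprob ?A p (\<lambda>E. \<exists>i\<in>{1..n}. d \<le> card (E \<inter> X i))"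
  proof (rule bprob_mono[OF p])
    fix E assume "\<exists>i\<in>{1..n}. d \<le> card {j \<in> {1..n}. j \<noteq> i \<and> {i, j} \<in> E}"
    then obtain i where i: "i \<in> {1..n}" "d \<le> card {j \<in> {1..n}. j \<noteq> i \<and> {i, j} \<in> E}" by blast
    have "card {j \<in> {1..n}. j \<noteq> i \<and> {i, j} \<in> E} \<le> card (E \<inter> X i)"
      by (rule card_inj_on_le[of "\<lambda>j. {i, j}"])
        (auto simp: inj_on_def doubleton_eq_iff X_def)
    then show "\<exists>i\<in>{1..n}. d \<le> card (E \<inter> X i)" using i by (meson order.trans)
  qed
  also have "\<dots> \<le> (\<Sum>i\<in>{1..n}. bprob ?A p (\<lambda>E. d \<le> card (E \<inter> X i)))"
    by (rule bprob_ex_le_sum[OF _ p]) auto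
  also have "\<dots> \<le> (\<Sum>i\<in>{1..n}. (3 * real n * p / real d) ^ d)"
  proof (intro sum_mono)
    fix i assume i: "i \<in> {1..n}"
    have "bprob ?A p (\<lambda>E. d \<le> card (E \<inter> X i)) \<le> real (card (X i) choose d) * p ^ d"
      by (rule bprob_ex_card_subset[OF finite_all_edges X[OF i] p])
    also have "\<dots> \<le> real (n choose d) * p ^ d"
      using p by (intro mult_right_mono of_nat_mono binomial_right_mono cX[OF i]) auto
    also have "\<dots> \<le> ((3 * real n) ^ d / real d ^ d) * p ^ d"
      using p binomial_upper_bound[of n d] d by (intro mult_right_mono) (auto simp: field_simps)
    also have "\<dots> = (3 * real n * p / real d) ^ d" by (simp add: power_mult_distrib power_divide)
    finally show "bprob ?A p (\<lambda>E. d \<le> card (E \<inter> X i)) \<le> (3 * real n * p / real d) ^ d" .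
  qed
  finally show ?thesis by simp
qed

text \<open>The edges from two vertices to \<open>q\<close> common neighbours are
  \<open>2 * q\<close> distinct pairs. As \<open>n * p\<^sup>2\<close> is at most
  \<open>n powr (1 - 2 * \<beta>)\<close>, a constant \<open>q\<close> will beat the number of pairs
  of vertices.\<close>

lemma bprob_large_codegree:
  assumes p: "0 \<le> p" "p \<le> 1"
  shows "bprob (all_edges n) p (\<lambda>E. \<exists>i\<in>{1..n}. \<exists>j\<in>{1..n}. i \<noteq> j \<and>
      q \<le> card {l \<in> {1..n}. l \<noteq> i \<and> l \<noteq> j \<and> {i, l} \<in> E \<and> {j, l} \<in> E})
    \<le> real n ^ 2 * (real n * p\<^sup>2) ^ q"
proof -
  let ?A = "all_edges n"
  define X where "X i j T = (\<lambda>l. {i, l}) ` T \<union> (\<lambda>l. {j, l}) ` T" for i j :: nat and T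
  define I where "I = {(i, j). i \<in> {1..n} \<and> j \<in> {1..n} \<and> i \<noteq> j}"
  define J where "J i j = {T. T \<subseteq> {1..n} - {i, j} \<and> card T = q}" for i j
  have finI: "finite I" by (rule finite_subset[of _ "{1..n} \<times> {1..n}"]) (auto simp: I_def)
  have cI: "card I \<le> n * n"
  proof -
    have "I \<subseteq> {1..n} \<times> {1..n}" by (auto simp: I_def)
    then have "card I \<le> card ({1..n} \<times> {1..n})" by (intro card_mono) auto
    then show ?thesis by (simp add: card_cartesian_product)
  qed
  have finJ: "finite (J i j)" for i j
    by (rule finite_subset[of _ "Pow {1..n}"]) (auto simp: J_def)
  have cJ: "card (J i j) \<le> n ^ q" for i j
  proof -
    have "card ({1..n} - {i, j}) \<le> n" using card_mono[of "{1..n}" "{1..n} - {i, j}"] by auto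
    then have "card (J i j) \<le> n choose q"
      unfolding J_def by (subst n_subsets) (auto intro: binomial_right_mono)
    also have "\<dots> \<le> n ^ q" by (cases "q \<le> n") (auto simp: binomial_le_pow binomial_eq_0)
    finally show ?thesis .
  qed
  have "bprob ?A p (\<lambda>E. \<exists>i\<in>{1..n}. \<exists>j\<in>{1..n}. i \<noteq> j \<and>
      q \<le> card {l \<in> {1..n}. l \<noteq> i \<and> l \<noteq> j \<and> {i, l} \<in> E \<and> {j, l} \<in> E})
    \<le> bprob ?A p (\<lambda>E. \<exists>(i, j)\<in>I. \<exists>T\<in>J i j. X i j T \<subseteq> E)"
  proof (rule bprob_mono[OF p])
    fix E assume "\<exists>i\<in>{1..n}. \<exists>j\<in>{1..n}. i \<noteq> j \<and>
      q \<le> card {l \<in> {1..n}. l \<noteq> i \<and> l \<noteq> j \<and> {i, l} \<in> E \<and> {j, l} \<in> E}"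
    then obtain i j where ij: "i \<in> {1..n}" "j \<in> {1..n}" "i \<noteq> j"
      "q \<le> card {l \<in> {1..n}. l \<noteq> i \<and> l \<noteq> j \<and> {i, l} \<in> E \<and> {j, l} \<in> E}" by blast
    obtain T where "T \<subseteq> {l \<in> {1..n}. l \<noteq> i \<and> l \<noteq> j \<and> {i, l} \<in> E \<and> {j, l} \<in> E}" "card T = q"
      using ij(4) by (meson obtain_subset_with_card_n)
    then have "T \<in> J i j" "X i j T \<subseteq> E" by (auto simp: J_def X_def)
    then show "\<exists>(i, j)\<in>I. \<exists>T\<in>J i j. X i j T \<subseteq> E" using ij by (auto simp: I_def)
  qed
  also have "\<dots> \<le> (\<Sum>x\<in>I. \<Sum>T\<in>J (fst x) (snd x). bprob ?A p (\<lambda>E. X (fst x) (snd x) T \<subseteq> E))"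
    unfolding case_prod_beta
    by (intro order.trans[OF bprob_ex_le_sum[OF finI p]] sum_mono bprob_ex_le_sum finJ p)
  also have "\<dots> \<le> (\<Sum>x\<in>I. \<Sum>T\<in>J (fst x) (snd x). p ^ (2 * q))"
  proof (intro sum_mono)
    fix x T assume "x \<in> I" "T \<in> J (fst x) (snd x)"
    then obtain i j where x: "x = (i, j)" "i \<in> {1..n}" "j \<in> {1..n}" "i \<noteq> j"
      and T: "T \<subseteq> {1..n} - {i, j}" "card T = q" by (auto simp: I_def J_def)
    have finT: "finite T" using T(1) finite_subset by blast
    have "(\<lambda>l. {i, l}) ` T \<inter> (\<lambda>l. {j, l}) ` T = {}" using T(1) x by (auto simp: doubleton_eq_iff)
    moreover have "card ((\<lambda>l. {a, l}) ` T) = q" for a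
      using T(2) by (subst card_image) (auto simp: inj_on_def doubleton_eq_iff)
    ultimately have "card (X i j T) = 2 * q"
      unfolding X_def using finT by (subst card_Un_disjoint) auto
    moreover have "X i j T \<subseteq> ?A" using T(1) x unfolding X_def by (auto intro!: all_edges_memI)
    ultimately show "bprob ?A p (\<lambda>E. X (fst x) (snd x) T \<subseteq> E) \<le> p ^ (2 * q)"
      using bprob_subset[OF finite_all_edges] x by simp
  qed
  also have "\<dots> \<le> (\<Sum>x\<in>I. real (n ^ q) * p ^ (2 * q))"
  proof (intro sum_mono)
    fix x
    have "real (card (J (fst x) (snd x))) * p ^ (2 * q) \<le> real (n ^ q) * p ^ (2 * q)"
      using p cJ by (intro mult_right_mono of_nat_mono) auto
    then show "(\<Sum>T\<in>J (fst x) (snd x). p ^ (2 * q)) \<le> real (n ^ q) * p ^ (2 * q)" by simp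
  qed
  also have "\<dots> \<le> real (n * n) * (real (n ^ q) * p ^ (2 * q))"
  proof -
    have "real (card I) * (real (n ^ q) * p ^ (2 * q)) \<le> real (n * n) * (real (n ^ q) * p ^ (2 * q))"
      using p cI by (intro mult_right_mono of_nat_mono) auto
    then show ?thesis by simp
  qed
  also have "\<dots> = real n ^ 2 * (real n * p\<^sup>2) ^ q"
    by (simp add: power_mult_distrib power_mult[symmetric] power2_eq_square[of "real n"])
  finally show ?thesis .
qed

lemma card_all_edges: "card (all_edges n) = n choose 2"
proof -
  have "all_edges n = {e. e \<subseteq> {1..n} \<and> card e = 2}"
  proof
    show "all_edges n \<subseteq> {e. e \<subseteq> {1..n} \<and> card e = 2}"
      using all_edges_card all_edges_subset by blast
    show "{e. e \<subseteq> {1..n} \<and> card e = 2} \<subseteq> all_edges n"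
      by (fastforce simp: card_2_iff all_edges_def)
  qed
  then show ?thesis using n_subsets[of "{1..n}" 2] by simp
qed

text \<open>An edge forces the parameter up to at least 2; the lower bound on \<open>p\<close>
  serves to guarantee one.\<close>

lemma bprob_no_edge:
  assumes n: "1 \<le> n" and p: "2 / real n \<le> p" "p \<le> 1"
  shows "bprob (all_edges n) p (\<lambda>E. E = {}) \<le> exp (1 - real n)"
proof -
  let ?A = "all_edges n"
  have "bprob ?A p (\<lambda>E. E = {}) = (\<Sum>E\<in>{{} :: nat set set}. p ^ card E * (1 - p) ^ (card ?A - card E) * of_bool (E = {}))"
    unfolding bprob_def bexp_def using finite_all_edges[of n] by (intro sum.mono_neutral_right) auto
  also have "\<dots> = (1 - p) ^ card ?A" by simp
  also have "\<dots> \<le> exp (- p) ^ card ?A"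
    using p(2) exp_ge_add_one_self[of "- p"] by (intro power_mono) auto
  also have "\<dots> = exp (- (p * real (card ?A)))" by (simp add: exp_of_nat_mult[symmetric] mult.commute)
  also have "\<dots> \<le> exp (1 - real n)"
  proof -
    have "even (n * (n - 1))" by auto
    then have "2 * real (card ?A) = real (n * (n - 1))"
      unfolding card_all_edges choose_two by (metis dvd_mult_div_cancel of_nat_mult of_nat_numeral)
    then have c: "real (card ?A) = real n * (real n - 1) / 2" using n by (simp add: of_nat_diff)
    have "real n - 1 = (2 / real n) * real (card ?A)" using n by (simp add: c)
    also have "\<dots> \<le> p * real (card ?A)" using p(1) by (intro mult_right_mono) auto
    finally show ?thesis by simp
  qed
  finally show ?thesis .
qed

section \<open>Concentration\<close>

text \<open>\<open>f\<close> takes finitely many values on subsets of \<open>A\<close>. Take the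
  least one whose lower tail reaches \<open>e\<close>; the next smaller value, if there is one, has
  a lower tail below \<open>e\<close>.\<close>

lemma bprob_quantile:
  fixes f :: "'a set \<Rightarrow> real"
  assumes A: "finite A" and p: "0 \<le> p" "p \<le> 1" and e: "0 < e" "e \<le> 1"
  obtains u where "e \<le> bprob A p (\<lambda>E. f E \<le> u)" "bprob A p (\<lambda>E. f E < u) \<le> e"
proof -
  let ?X = "f ` Pow A"
  define K where "K = {y \<in> ?X. e \<le> bprob A p (\<lambda>E. f E \<le> y)}"
  have finX: "finite ?X" using A by simp
  then have finK: "finite K" by (simp add: K_def)
  have "bprob A p (\<lambda>E. f E \<le> Max ?X) = bexp A p (\<lambda>E. 1)"
    unfolding bprob_def using finX by (intro bexp_cong) auto
  then have "e \<le> bprob A p (\<lambda>E. f E \<le> Max ?X)" using e by (simp add: bexp_const[OF A])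
  moreover have "Max ?X \<in> ?X" by (rule Max_in[OF finX]) auto
  ultimately have "Max ?X \<in> K" unfolding K_def by blast
  then have "K \<noteq> {}" by blast
  then have min: "Min K \<in> K" using finK by (rule Min_in[rotated])
  have "bprob A p (\<lambda>E. f E < Min K) \<le> e"
  proof (cases "\<exists>E\<subseteq>A. f E < Min K")
    case False
    then have "bprob A p (\<lambda>E. f E < Min K) = bexp A p (\<lambda>E. 0)"
      unfolding bprob_def by (intro bexp_cong) auto
    then show ?thesis using e by (simp add: bexp_const[OF A])
  next
    case True
    let ?Y = "{z \<in> ?X. z < Min K}"
    have Y: "finite ?Y" "?Y \<noteq> {}" using finX True by auto
    have y: "Max ?Y \<in> ?Y" using Y by (rule Max_in)
    have "Max ?Y \<notin> K"
    proof
      assume "Max ?Y \<in> K"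
      with finK have "Min K \<le> Max ?Y" by (rule Min_le)
      moreover have "Max ?Y < Min K" using y by blast
      ultimately show False by simp
    qed
    then have "bprob A p (\<lambda>E. f E \<le> Max ?Y) < e" using y by (auto simp: K_def)
    moreover have "bprob A p (\<lambda>E. f E < Min K) \<le> bprob A p (\<lambda>E. f E \<le> Max ?Y)"
      using Y(1) by (intro bprob_mono p Max_ge) auto
    ultimately show ?thesis by simp
  qed
  then show ?thesis using that[of "Min K"] min by (simp add: K_def)
qed

lemma bprob_conj:
  assumes "finite A" "0 \<le> p" "p \<le> 1"
  shows "bprob A p P + bprob A p Q - 1 \<le> bprob A p (\<lambda>E. P E \<and> Q E)"
  using bprob_disj[OF assms(2,3), of A "\<lambda>E. \<not> P E" "\<lambda>E. \<not> Q E"]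
    bprob_not[OF assms(1), of p P] bprob_not[OF assms(1), of p Q]
    bprob_not[OF assms(1), of p "\<lambda>E. P E \<and> Q E"] by simp

text \<open>Vertex exposure: block \<open>i\<close> holds the edges from \<open>i\<close> to smaller
  vertices. The blocks partition all pairs, and deleting vertex \<open>i\<close> makes its block
  invisible.\<close>

definition star_block :: "nat \<Rightarrow> nat \<Rightarrow> nat set set" where
  "star_block n i = {e \<in> all_edges n. Max e = i}"

lemma Union_star_block: "(\<Union>i\<in>{1..n}. star_block n i) = all_edges n"
proof
  show "all_edges n \<subseteq> (\<Union>i\<in>{1..n}. star_block n i)"
  proof
    fix e assume e: "e \<in> all_edges n"
    then have "finite e" "e \<noteq> {}" using all_edges_card by fastforce+
    then have "Max e \<in> e" by (rule Max_in)
    then show "e \<in> (\<Union>i\<in>{1..n}. star_block n i)"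
      using e all_edges_subset[OF e] by (auto simp: star_block_def)
  qed
qed (auto simp: star_block_def)

lemma pair_in_star_block: "{j, l} \<in> star_block n i \<Longrightarrow> i = j \<or> i = l"
  by (auto simp: star_block_def max_def)

context coloring_cone
begin

text \<open>Delete the vertices of inclusion probability above \<open>\<eta>\<close> and average
  over the rest. The value \<open>\<eta> = c / (B + 2 * c)\<close> is what makes
  \<open>(u + c) / (1 - \<eta>) \<le> u + 2 * c\<close> for all \<open>u \<le> B\<close>; the size
  bound is Markov's inequality for the squared probabilities.\<close>

lemma feas_outside_small_set:
  assumes c: "0 < c" and u: "0 \<le> u" "u \<le> B" and e: "0 < e"
    and \<U>: "\<U> = {U. U \<subseteq> {1..n} \<and> feas ({1..n} - U) E (u + c)}"
    and w: "\<forall>U\<in>\<U>. 0 \<le> w U" "sum w \<U> = 1"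
      "(\<Sum>i\<in>{1..n}. (\<Sum>U\<in>\<U>. w U * of_bool (i \<in> U))\<^sup>2) \<le> 4 / e"
  obtains U where "U \<subseteq> {1..n}" "real (card U) \<le> 4 * (B + 2 * c)\<^sup>2 / (e * c\<^sup>2)" "feas ({1..n} - U) E (u + 2 * c)"
proof -
  define \<eta> where "\<eta> = c / (B + 2 * c)"
  define \<delta> where "\<delta> i = (\<Sum>U\<in>\<U>. w U * of_bool (i \<in> U))" for i
  have \<eta>: "0 < \<eta>" "\<eta> < 1" using c u by (auto simp: \<eta>_def field_simps)
  define U where "U = {i \<in> {1..n}. \<eta> < \<delta> i}"
  have "real (card U) * \<eta>\<^sup>2 = (\<Sum>i\<in>U. \<eta>\<^sup>2)" by simp
  also have "\<dots> \<le> (\<Sum>i\<in>U. (\<delta> i)\<^sup>2)" using \<eta> by (intro sum_mono power_mono) (auto simp: U_def)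
  also have "\<dots> \<le> (\<Sum>i\<in>{1..n}. (\<delta> i)\<^sup>2)" by (intro sum_mono2) (auto simp: U_def)
  also have "\<dots> \<le> 4 / e" using w(3) by (simp add: \<delta>_def)
  finally have "real (card U) \<le> (4 / e) / \<eta>\<^sup>2" using \<eta> by (subst pos_le_divide_eq) auto
  also have "\<dots> = 4 * (B + 2 * c)\<^sup>2 / (e * c\<^sup>2)"
    using c u e by (simp add: \<eta>_def power_divide)
  finally have card: "real (card U) \<le> 4 * (B + 2 * c)\<^sup>2 / (e * c\<^sup>2)" .
  have "finite \<U>" unfolding \<U> by (rule finite_subset[of _ "Pow {1..n}"]) auto
  then have "feas ({1..n} - U) E ((u + c) / (1 - \<eta>))"
    by (intro feas_average[of "{1..n}" \<U> _ _ w])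
      (use c u w \<eta> in \<open>auto simp: \<U> U_def \<delta>_def\<close>)
  moreover have "(u + c) / (1 - \<eta>) \<le> u + 2 * c"
  proof -
    have "\<eta> * (u + 2 * c) \<le> \<eta> * (B + 2 * c)" using \<eta> u by (intro mult_left_mono) auto
    also have "\<dots> = c" using c u by (simp add: \<eta>_def)
    finally show ?thesis using \<eta> by (simp add: field_simps)
  qed
  ultimately have "feas ({1..n} - U) E (u + 2 * c)" by (rule feas_mono)
  moreover have "U \<subseteq> {1..n}" by (auto simp: U_def)
  ultimately show ?thesis using that card by blast
qed

text \<open>The set \<open>U\<close> and the value \<open>k\<close> to which this is applied depend
  on the random graph, so the property quantifies over all of them; its probability can then be
  bounded by a first moment.\<close>

definition extendable :: "nat \<Rightarrow> real \<Rightarrow> real \<Rightarrow> nat set set \<Rightarrow> bool" where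
  "extendable n m s E \<longleftrightarrow> (\<forall>U\<subseteq>{1..n}. real (card U) \<le> m \<longrightarrow>
     (\<forall>k\<ge>2. feas ({1..n} - U) E k \<longrightarrow> feas {1..n} E (k + s)))"

text \<open>\<open>u\<close> is the quantile at level \<open>e\<close>. The three bad events are:
  parameter below \<open>u\<close>, no suitable distribution on deletion sets, not extendable. Their
  probabilities are at most \<open>e\<close>, \<open>e\<close> and \<open>d\<close>.\<close>

lemma theta_interval:
  assumes p: "0 \<le> p" "p \<le> 1" and e: "0 < e" "e \<le> 1" and c: "0 < c" and s: "0 \<le> s"
    and upper: "e < bprob (all_edges n) p (\<lambda>E. theta {1..n} E \<le> B)"
    and noedge: "bprob (all_edges n) p (\<lambda>E. E = {}) < e"
    and m: "4 * (B + 2 * c)\<^sup>2 / (e * c\<^sup>2) \<le> m"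
    and ext: "bprob (all_edges n) p (\<lambda>E. \<not> extendable n m s E) \<le> d"
  shows "\<exists>u. 1 - (2 * e + d) \<le> bprob (all_edges n) p
    (\<lambda>E. u \<le> theta {1..n} E \<and> theta {1..n} E \<le> u + (s + 2 * c))"
proof -
  let ?A = "all_edges n" and ?V = "{1..n}"
  have A: "finite ?A" by (rule finite_all_edges)
  obtain u where u: "e \<le> bprob ?A p (\<lambda>E. theta ?V E \<le> u)" "bprob ?A p (\<lambda>E. theta ?V E < u) \<le> e"
    using bprob_quantile[OF A p e] by blast
  have uB: "u \<le> B"
  proof (rule ccontr)
    assume "\<not> u \<le> B"
    then have "bprob ?A p (\<lambda>E. theta ?V E \<le> B) \<le> bprob ?A p (\<lambda>E. theta ?V E < u)"
      by (intro bprob_mono p) auto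
    then show False using upper u(2) by linarith
  qed
  have u2: "2 \<le> u"
  proof (rule ccontr)
    assume u2: "\<not> 2 \<le> u"
    have "bprob ?A p (\<lambda>E. theta ?V E \<le> u) \<le> bprob ?A p (\<lambda>E. E = {})"
    proof (rule bprob_mono[OF p])
      fix E assume E: "E \<subseteq> ?A" and le: "theta ?V E \<le> u"
      \<comment> \<open>The midpoint of \<open>u\<close> and 2 exceeds \<open>u\<close>, so it is
        feasible, and it is below 2, which excludes edges.\<close>
      have f: "feas ?V E ((u + 2) / 2)" by (rule feas_theta_less) (use le u2 in auto)
      show "E = {}"
      proof (rule ccontr)
        assume "E \<noteq> {}"
        then obtain i j where "i \<in> ?V" "j \<in> ?V" "i \<noteq> j" "{i, j} \<in> E"
          using E by (auto simp: all_edges_def) blast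
        then show False using feas_edge_ge_2[OF f _ \<open>i \<in> ?V\<close> \<open>j \<in> ?V\<close>] u2 by auto
      qed
    qed
    then show False using u(1) noedge by linarith
  qed
  define \<U> where "\<U> E = {U. U \<subseteq> ?V \<and> feas (?V - U) E (u + c)}" for E
  define W where "W E \<longleftrightarrow> (\<exists>w. (\<forall>U\<in>\<U> E. 0 \<le> w U) \<and> sum w (\<U> E) = 1 \<and>
      (\<Sum>i\<in>?V. (\<Sum>U\<in>\<U> E. w U * of_bool (i \<in> U))\<^sup>2) \<le> 4 / e)" for E
  have tail: "bprob ?A p (\<lambda>E. \<not> W E) \<le> e"
    unfolding W_def
  proof (rule convex_distance_tail[where B = "star_block n"])
    show "finite (star_block n i)" for i using A by (simp add: star_block_def)
    show "disjoint_family_on (star_block n) ?V" by (auto simp: disjoint_family_on_def star_block_def)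
    show "?A = (\<Union>i\<in>?V. star_block n i)" by (rule Union_star_block[symmetric])
    show "\<U> E \<subseteq> Pow ?V" for E by (auto simp: \<U>_def)
    show "\<U> E \<noteq> {}" for E using feas_empty by (auto simp: \<U>_def intro!: exI[of _ ?V])
    show "e \<le> bprob ?A p (\<lambda>E. {} \<in> \<U> E)"
    proof (rule order.trans[OF u(1) bprob_mono[OF p]])
      fix E assume "theta ?V E \<le> u"
      then have "feas ?V E (u + c)" using c by (intro feas_theta_less) auto
      then show "{} \<in> \<U> E" by (simp add: \<U>_def)
    qed
    \<comment> \<open>Graphs that differ only in block \<open>i\<close> agree once vertex
      \<open>i\<close> is deleted too.\<close>
    fix E E' i U assume "E \<subseteq> ?A" "E' \<subseteq> ?A" and i: "i \<in> ?V"
      and eq: "E - star_block n i = E' - star_block n i" and U: "U \<in> \<U> E'"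
    have "feas (?V - insert i U) E' (u + c)"
      by (rule feas_subset[of "?V - U"]) (use U in \<open>auto simp: \<U>_def\<close>)
    then have "feas (?V - insert i U) E (u + c)"
    proof (rule feas_cong_edges[rotated])
      fix j l assume "j \<in> ?V - insert i U" "l \<in> ?V - insert i U"
      then have "{j, l} \<notin> star_block n i" using pair_in_star_block[of j l n i] by auto
      then show "{j, l} \<in> E' \<longleftrightarrow> {j, l} \<in> E" using eq by blast
    qed
    then show "insert i U \<in> \<U> E" using U i by (auto simp: \<U>_def)
  qed (use p e in auto)
  let ?G = "\<lambda>E. u \<le> theta ?V E \<and> theta ?V E \<le> u + (s + 2 * c)"
  have "bprob ?A p (\<lambda>E. \<not> ?G E)
      \<le> bprob ?A p (\<lambda>E. theta ?V E < u \<or> (\<not> W E \<or> \<not> extendable n m s E))"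
  proof (rule bprob_mono[OF p])
    fix E assume E: "E \<subseteq> ?A" and notG: "\<not> ?G E"
    show "theta ?V E < u \<or> (\<not> W E \<or> \<not> extendable n m s E)"
    proof (rule ccontr)
      assume "\<not> ?thesis"
      then have g: "u \<le> theta ?V E" "W E" "extendable n m s E" by auto
      then obtain w where w: "\<forall>U\<in>\<U> E. 0 \<le> w U" "sum w (\<U> E) = 1"
        "(\<Sum>i\<in>?V. (\<Sum>U\<in>\<U> E. w U * of_bool (i \<in> U))\<^sup>2) \<le> 4 / e" unfolding W_def by blast
      obtain U where U: "U \<subseteq> ?V" "real (card U) \<le> 4 * (B + 2 * c)\<^sup>2 / (e * c\<^sup>2)"
        "feas (?V - U) E (u + 2 * c)"
        by (rule feas_outside_small_set[OF c _ uB e(1) \<U>_def w]) (use u2 in auto)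
      then have "feas ?V E (u + 2 * c + s)"
        using g(3) m u2 c unfolding extendable_def by auto
      then have "theta ?V E \<le> u + 2 * c + s" by (rule theta_le) (use u2 c s in auto)
      then show False using notG g(1) by simp
    qed
  qed
  also have "\<dots> \<le> bprob ?A p (\<lambda>E. theta ?V E < u) + (bprob ?A p (\<lambda>E. \<not> W E) + bprob ?A p (\<lambda>E. \<not> extendable n m s E))"
    by (intro order.trans[OF bprob_disj[OF p]] add_left_mono bprob_disj p)
  also have "\<dots> \<le> e + (e + d)" by (intro add_mono u(2) tail ext)
  finally show ?thesis unfolding bprob_not[OF A] by (intro exI[of _ u]) simp
qed

text \<open>Density \<open>(D + 1) / 2\<close> leads to \<open>D + 1\<close> fresh colors on the
  deleted set; density below \<open>3 / 2\<close>, with \<open>M\<close> sufficiently larger than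
  \<open>m\<close>, leads to the closure argument.\<close>

lemma extendable_if_sparse:
  assumes E: "E \<subseteq> all_edges n" and m: "m \<le> M"
    and sparse: "\<And>S. S \<subseteq> {1..n} \<Longrightarrow> S \<noteq> {} \<Longrightarrow> real (card S) \<le> M \<Longrightarrow>
      real (card (edges_in E S)) < \<rho> * real (card S)"
    and cases: "(\<exists>D::nat. \<rho> = (real D + 1) / 2 \<and> real D + 1 \<le> s) \<or>
      (0 \<le> \<rho> \<and> \<rho> < 3 / 2 \<and> 2 \<le> s \<and> 3 * m + 6 < (3 - 2 * \<rho>) * M)"
  shows "extendable n m s E"
  unfolding extendable_def
proof (intro allI impI)
  fix U and k :: real assume U: "U \<subseteq> {1..n}" "real (card U) \<le> m" and k: "2 \<le> k" "feas ({1..n} - U) E k"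
  from cases show "feas {1..n} E (k + s)"
  proof
    assume "\<exists>D::nat. \<rho> = (real D + 1) / 2 \<and> real D + 1 \<le> s"
    then obtain D :: nat where D: "\<rho> = (real D + 1) / 2" "real D + 1 \<le> s" by blast
    have finU: "finite U" using U(1) finite_subset by blast
    have "feas {1..n} E (k + real (D + 1))"
    proof (rule feas_extend_sparse[OF E _ U(1) k(2)])
      fix T assume T: "T \<subseteq> U" "T \<noteq> {}"
      have "real (card T) \<le> M" using card_mono[OF finU T(1)] U(2) m by linarith
      then have "real (card (edges_in E T)) < \<rho> * real (card T)" using T U(1) by (intro sparse) auto
      then have "real (2 * card (edges_in E T)) < real ((D + 1) * card T)" by (simp add: D(1) algebra_simps)
      then show "2 * card (edges_in E T) < (D + 1) * card T" by (simp only: of_nat_less_iff)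
    qed (use k in auto)
    then show ?thesis by (rule feas_mono) (use D(2) in simp)
  next
    assume c: "0 \<le> \<rho> \<and> \<rho> < 3 / 2 \<and> 2 \<le> s \<and> 3 * m + 6 < (3 - 2 * \<rho>) * M"
    have "feas {1..n} E (k + 2)"
      by (rule feas_extend_closure[OF E U k(2,1), of M \<rho>]) (use sparse c m in auto)
    then show ?thesis by (rule feas_mono) (use c in simp)
  qed
qed

lemma theta_upper_tail:
  assumes p: "0 \<le> p" "p \<le> 1" and n: "1 \<le> n" and \<Delta>: "0 < \<Delta>"
    and B: "1 + sqrt (\<Delta> * (1 + real q)) \<le> B" and d: "d = nat \<lceil>\<Delta>\<rceil>"
  shows "1 - real n * (3 * real n * p / real d) ^ d - real n ^ 2 * (real n * p\<^sup>2) ^ q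
    \<le> bprob (all_edges n) p (\<lambda>E. theta {1..n} E \<le> B)"
proof -
  let ?A = "all_edges n" and ?V = "{1..n}"
  let ?D = "\<lambda>E. \<exists>i\<in>{1..n}. d \<le> card {j \<in> {1..n}. j \<noteq> i \<and> {i, j} \<in> E}"
  let ?C = "\<lambda>E. \<exists>i\<in>{1..n}. \<exists>j\<in>{1..n}. i \<noteq> j \<and>
      q \<le> card {l \<in> {1..n}. l \<noteq> i \<and> l \<noteq> j \<and> {i, l} \<in> E \<and> {j, l} \<in> E}"
  have d1: "1 \<le> d" using \<Delta> unfolding d by linarith
  have "bprob ?A p (\<lambda>E. \<not> theta ?V E \<le> B) \<le> bprob ?A p (\<lambda>E. ?D E \<or> ?C E)"
  proof (rule bprob_mono[OF p], rule ccontr)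
    fix E assume no: "\<not> theta ?V E \<le> B" and nDC: "\<not> (?D E \<or> ?C E)"
    have deg: "card {j \<in> {1..n}. j \<noteq> i \<and> {i, j} \<in> E} < d" if "i \<in> ?V" for i
      using that nDC by (meson not_le)
    have codeg: "card {l \<in> {1..n}. l \<noteq> i \<and> l \<noteq> j \<and> {i, l} \<in> E \<and> {j, l} \<in> E} < q"
      if "i \<in> ?V" "j \<in> ?V" "i \<noteq> j" for i j
      using that nDC by (meson not_le)
    have "feas ?V E (1 + sqrt (\<Delta> * (1 + real q)))"
    proof (rule feas_degree_bound[OF _ \<Delta> refl])
      show "real (card {j \<in> ?V. j \<noteq> i \<and> {i, j} \<in> E}) \<le> \<Delta>" if "i \<in> ?V" for i
        using deg[OF that] unfolding d by linarith
      show "real (card {l \<in> ?V. l \<noteq> i \<and> l \<noteq> j \<and> {i, l} \<in> E \<and> {j, l} \<in> E}) \<le> real q"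
        if "i \<in> ?V" "j \<in> ?V" "i \<noteq> j" for i j
        using codeg[OF that] by simp
    qed auto
    then have "feas ?V E B" by (rule feas_mono[OF _ B])
    moreover have "0 < sqrt (\<Delta> * (1 + real q))" using \<Delta> by simp
    then have "1 < B" using B by linarith
    ultimately show False using theta_le no by blast
  qed
  also have "\<dots> \<le> real n * (3 * real n * p / real d) ^ d + real n ^ 2 * (real n * p\<^sup>2) ^ q"
    by (intro order.trans[OF bprob_disj[OF p]] add_mono bprob_large_degree bprob_large_codegree n d1 p)
  finally show ?thesis unfolding bprob_not[OF finite_all_edges] by simp
qed

end

section \<open>Choice of exponents and asymptotics\<close>

lemma eventually_le_powr:
  assumes "0 < a" shows "\<forall>\<^sub>F n in sequentially. K \<le> real n powr a"
proof -
  have "\<forall>\<^sub>F n in sequentially. max K 1 powr (1 / a) \<le> real n"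
    using filterlim_real_sequentially by (simp add: filterlim_at_top)
  then show ?thesis
  proof eventually_elim
    case (elim n)
    have "max K 1 = (max K 1 powr (1 / a)) powr a" using assms by (simp add: powr_powr)
    also have "\<dots> \<le> real n powr a" using elim assms by (intro powr_mono2) auto
    finally show ?case by simp
  qed
qed

text \<open>The density \<open>\<rho>\<close> must exceed the critical value
  \<open>(1 + x) / 2 = \<beta> / (2 * \<beta> - 1)\<close> for sets of size
  \<open>n powr (1 - \<beta>)\<close>. The strict gap leaves room to enlarge the sets by the factor
  \<open>n powr (7 * \<kappa>)\<close>.\<close>

lemma sparsity_parameters:
  fixes \<beta> :: real
  assumes "1 / 2 < \<beta>" "\<beta> < 1"
  obtains \<rho> \<kappa> :: real where "1 \<le> \<rho>" "0 < \<kappa>" "7 * \<kappa> \<le> \<beta>"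
    "0 < (2 * \<beta> - 1 - 7 * \<kappa>) - (\<beta> - 7 * \<kappa>) / \<rho>"
    "(\<exists>D::nat. \<rho> = (real D + 1) / 2 \<and> real D + 1 \<le> 2 / (2 * \<beta> - 1)) \<or> (0 \<le> \<rho> \<and> \<rho> < 3 / 2 \<and> 2 \<le> 2 / (2 * \<beta> - 1))"
proof -
  define x where "x = 1 / (2 * \<beta> - 1)"
  have b: "0 < 2 * \<beta> - 1" using assms by simp
  have x1: "1 < x" using assms by (simp add: x_def field_simps)
  have x2: "2 / (2 * \<beta> - 1) = 2 * x" by (simp add: x_def)
  have "\<exists>\<rho>. (1 + x) / 2 < \<rho> \<and> ((\<exists>D::nat. \<rho> = (real D + 1) / 2 \<and> real D + 1 \<le> 2 * x) \<or> (0 \<le> \<rho> \<and> \<rho> < 3 / 2 \<and> 2 \<le> 2 * x))"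
  proof (cases "x < 2")
    case True
    \<comment> \<open>The midpoint of \<open>(1 + x) / 2\<close> and \<open>3 / 2\<close>.\<close>
    then have "(1 + x) / 2 < (4 + x) / 4" "0 \<le> (4 + x) / 4" "(4 + x) / 4 < 3 / 2" "2 \<le> 2 * x"
      using x1 by auto
    then show ?thesis by blast
  next
    case False
    define D where "D = nat \<lfloor>1 + x\<rfloor>"
    have "real D \<le> 1 + x" "1 + x < real D + 1" using x1 unfolding D_def by linarith+
    \<comment> \<open>Here \<open>D + 1 \<le> 2 + x \<le> 2 * x\<close> because
      \<open>x \<ge> 2\<close>.\<close>
    then show ?thesis using False by (intro exI[of _ "(real D + 1) / 2"]) (auto intro!: exI[of _ D])
  qed
  then obtain \<rho> where \<rho>: "(1 + x) / 2 < \<rho>"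
    and cases: "(\<exists>D::nat. \<rho> = (real D + 1) / 2 \<and> real D + 1 \<le> 2 * x) \<or> (0 \<le> \<rho> \<and> \<rho> < 3 / 2 \<and> 2 \<le> 2 * x)"
    by blast
  have \<rho>1: "1 < \<rho>" using \<rho> x1 by simp
  define g where "g = (2 * \<beta> - 1) * \<rho> - \<beta>"
  have "(2 * \<beta> - 1) * ((1 + x) / 2) = \<beta>" using b by (simp add: x_def field_simps)
  then have g0: "0 < g" using mult_strict_left_mono[OF \<rho> b] by (simp add: g_def)
  \<comment> \<open>Spends half of the gap: \<open>7 * \<kappa> * \<rho> = g / 2\<close>.\<close>
  define \<kappa> where "\<kappa> = g / (14 * \<rho>)"
  have \<kappa>: "0 < \<kappa>" using g0 \<rho>1 by (simp add: \<kappa>_def)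
  have \<kappa>\<rho>: "7 * \<kappa> * \<rho> = g / 2" using \<rho>1 by (simp add: \<kappa>_def)
  have "7 * \<kappa> * \<rho> \<le> \<beta> * \<rho>"
  proof -
    have "g \<le> (2 * \<beta> - 1) * \<rho>" using assms by (simp add: g_def)
    also have "\<dots> \<le> (2 * \<beta>) * \<rho>" using \<rho>1 by (intro mult_right_mono) auto
    finally show ?thesis using \<kappa>\<rho> by simp
  qed
  then have "7 * \<kappa> \<le> \<beta>" using \<rho>1 by simp
  moreover have "0 < (2 * \<beta> - 1 - 7 * \<kappa>) - (\<beta> - 7 * \<kappa>) / \<rho>"
  proof -
    have "(2 * \<beta> - 1 - 7 * \<kappa>) - (\<beta> - 7 * \<kappa>) / \<rho> = (g - 7 * \<kappa> * \<rho> + 7 * \<kappa>) / \<rho>"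
      using \<rho>1 by (simp add: g_def field_simps)
    also have "\<dots> > 0" using g0 \<kappa> \<rho>1 unfolding \<kappa>\<rho> by simp
    finally show ?thesis .
  qed
  ultimately show ?thesis using that[of \<rho> \<kappa>] \<rho>1 \<kappa> cases x2 by auto
qed

context coloring_cone
begin

lemma bprob_not_extendable:
  fixes \<beta> \<kappa> \<rho> s :: real
  assumes n: "1 \<le> n" and p: "0 \<le> p" "p \<le> 1" "p \<le> real n powr (- \<beta>)"
    and \<rho>: "1 \<le> \<rho>" and \<kappa>: "0 < \<kappa>" "7 * \<kappa> \<le> \<beta>"
    and z: "z = 9 * real n powr (- ((2 * \<beta> - 1 - 7 * \<kappa>) - (\<beta> - 7 * \<kappa>) / \<rho>))" "z \<le> 1 / 2"
    and \<beta>: "\<beta> < 1"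
    and cases: "(\<exists>D::nat. \<rho> = (real D + 1) / 2 \<and> real D + 1 \<le> s) \<or> (0 \<le> \<rho> \<and> \<rho> < 3 / 2 \<and> 2 \<le> s)"
    and large: "\<rho> < 3 / 2 \<Longrightarrow> 10 / (3 - 2 * \<rho>) \<le> real n powr \<kappa>"
  shows "bprob (all_edges n) p (\<lambda>E. \<not> extendable n (real n powr (1 - \<beta> + 6 * \<kappa>)) s E) \<le> 2 * z"
proof -
  \<comment> \<open>The seventh \<open>\<kappa>\<close> is the ratio of \<open>?M\<close> to
    \<open>?m\<close>, which outgrows the constant \<open>10 / (3 - 2 * \<rho>)\<close> needed by
    the closure; since \<open>?m \<ge> 1\<close>, \<open>10 * ?m\<close> dominates
    \<open>3 * ?m + 6\<close>.\<close>
  let ?m = "real n powr (1 - \<beta> + 6 * \<kappa>)" and ?M = "real n powr (1 - \<beta> + 7 * \<kappa>)"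
  have N: "1 \<le> real n" using n by simp
  have M: "?M = real n powr \<kappa> * ?m" by (simp add: powr_add[symmetric] algebra_simps)
  have m1: "1 \<le> ?m" using N \<kappa> \<beta> by (intro ge_one_powr_ge_zero) auto
  have "bprob (all_edges n) p (\<lambda>E. \<not> extendable n ?m s E)
      \<le> bprob (all_edges n) p (\<lambda>E. \<exists>S\<subseteq>{1..n}. S \<noteq> {} \<and> real (card S) \<le> ?M \<and>
        \<rho> * real (card S) \<le> real (card (edges_in E S)))"
  proof (rule bprob_mono[OF p(1,2)], rule ccontr)
    fix E assume E: "E \<subseteq> all_edges n" and ne: "\<not> extendable n ?m s E"
      and no: "\<not> (\<exists>S\<subseteq>{1..n}. S \<noteq> {} \<and> real (card S) \<le> ?M \<and>
        \<rho> * real (card S) \<le> real (card (edges_in E S)))"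
    have "extendable n ?m s E"
    proof (rule extendable_if_sparse[OF E])
      show "?m \<le> ?M" using N \<kappa> by (intro powr_mono) auto
      show "real (card (edges_in E S)) < \<rho> * real (card S)"
        if "S \<subseteq> {1..n}" "S \<noteq> {}" "real (card S) \<le> ?M" for S
        using no that by (meson not_le)
      show "(\<exists>D::nat. \<rho> = (real D + 1) / 2 \<and> real D + 1 \<le> s) \<or>
        (0 \<le> \<rho> \<and> \<rho> < 3 / 2 \<and> 2 \<le> s \<and> 3 * ?m + 6 < (3 - 2 * \<rho>) * ?M)"
      proof (cases "\<rho> < 3 / 2")
        case True
        have "10 \<le> (3 - 2 * \<rho>) * real n powr \<kappa>" using large[OF True] True by (simp add: field_simps)
        then have "10 * ?m \<le> (3 - 2 * \<rho>) * ?M" unfolding M using m1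
          by (simp add: mult.assoc[symmetric] mult_right_mono)
        then show ?thesis using cases m1 by auto
      qed (use cases in auto)
    qed
    then show False using ne by simp
  qed
  also have "\<dots> \<le> 2 * z"
    by (rule bprob_dense_subset[OF n \<rho> _ p]) (use z \<kappa> in \<open>auto simp: algebra_simps\<close>)
  finally show ?thesis .
qed

text \<open>The degree bound \<open>\<Delta>\<close> exceeds \<open>n * p\<close> by a factor
  \<open>n powr \<kappa>\<close>, so a constant power \<open>J\<close> of the ratio already beats
  the union over vertices; likewise a constant \<open>q\<close> suffices for codegrees. Half a
  \<open>\<kappa>\<close> comes from \<open>sqrt \<Delta>\<close>, the other half absorbs the
  constant depending on \<open>q\<close>.\<close>

lemma bprob_theta_le_powr:
  fixes \<beta> \<kappa> :: real and J q :: nat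
  assumes n: "1 \<le> n" and p: "0 \<le> p" "p \<le> 1" "p \<le> real n powr (- \<beta>)"
    and \<beta>: "\<beta> < 1" and \<kappa>: "0 < \<kappa>" and J: "2 \<le> \<kappa> * real J" and q: "3 \<le> (2 * \<beta> - 1) * real q"
    and large: "1 + sqrt (1 + real q) \<le> real n powr (\<kappa> / 2)" "3 \<le> real n powr \<kappa>"
      "real J \<le> real n powr (1 - \<beta> + \<kappa>)"
  shows "1 - (3 ^ J + 1) / real n
    \<le> bprob (all_edges n) p (\<lambda>E. theta {1..n} E \<le> real n powr ((1 - \<beta>) / 2 + \<kappa>))"
proof -
  let ?N = "real n"
  have N: "1 \<le> ?N" using n by simp
  define \<Delta> where "\<Delta> = ?N powr (1 - \<beta> + \<kappa>)"
  define d where "d = nat \<lceil>\<Delta>\<rceil>"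
  have \<Delta>: "0 < \<Delta>" "\<Delta> \<le> real d" using N by (auto simp: \<Delta>_def d_def real_nat_ceiling_ge)
  have Jd: "J \<le> d" using large(3) \<Delta>(2) by (simp add: \<Delta>_def)
  have sq: "sqrt \<Delta> = ?N powr ((1 - \<beta> + \<kappa>) / 2)"
    using N by (simp add: \<Delta>_def powr_half_sqrt[symmetric] powr_powr)
  have "1 + sqrt (\<Delta> * (1 + real q)) \<le> sqrt \<Delta> * (1 + sqrt (1 + real q))"
  proof -
    have "1 \<le> sqrt \<Delta>" unfolding sq using N \<beta> \<kappa> by (intro ge_one_powr_ge_zero) auto
    then show ?thesis unfolding real_sqrt_mult by (simp only: distrib_left mult_1_right add_right_mono)
  qed
  also have "\<dots> \<le> sqrt \<Delta> * ?N powr (\<kappa> / 2)" using large(1) \<Delta>(1) by (intro mult_left_mono) auto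
  also have "\<dots> = ?N powr ((1 - \<beta>) / 2 + \<kappa>)"
    unfolding sq by (simp add: powr_add[symmetric] field_simps)
  finally have B: "1 + sqrt (\<Delta> * (1 + real q)) \<le> ?N powr ((1 - \<beta>) / 2 + \<kappa>)" .
  have deg: "?N * (3 * ?N * p / real d) ^ d \<le> 3 ^ J / ?N"
  proof -
    have "3 * ?N * p / real d \<le> 3 * ?N * ?N powr (- \<beta>) / \<Delta>"
      using p \<Delta> N by (intro frac_le mult_left_mono) auto
    also have "\<dots> = 3 * ?N powr (- \<kappa>)"
    proof -
      have "?N * ?N powr (- \<beta>) = ?N powr (1 - \<beta>)" using N by (simp add: powr_mult_base)
      moreover have "?N powr (1 - \<beta>) / \<Delta> = ?N powr (- \<kappa>)"
        unfolding \<Delta>_def by (simp add: powr_diff[symmetric])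
      ultimately show ?thesis by (metis mult.assoc times_divide_eq_right)
    qed
    finally have r: "3 * ?N * p / real d \<le> 3 * ?N powr (- \<kappa>)" .
    have r1: "3 * ?N powr (- \<kappa>) \<le> 1" using large(2) N by (simp add: powr_minus_divide divide_le_eq_1)
    have "(3 * ?N * p / real d) ^ d \<le> (3 * ?N powr (- \<kappa>)) ^ d"
      using r p N by (intro power_mono) auto
    also have "\<dots> \<le> (3 * ?N powr (- \<kappa>)) ^ J" using r1 Jd by (intro power_decreasing) auto
    also have "\<dots> = 3 ^ J * ?N powr (- (\<kappa> * real J))"
      using N by (simp add: power_mult_distrib powr_realpow[symmetric] powr_powr)
    also have "\<dots> \<le> 3 ^ J * ?N powr (- 2)" using N J by (intro mult_left_mono powr_mono) auto
    finally have "?N * (3 * ?N * p / real d) ^ d \<le> ?N * (3 ^ J * ?N powr (- 2))"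
      using N by (intro mult_left_mono) auto
    also have "\<dots> = 3 ^ J / ?N" using N by (simp add: powr_minus power2_eq_square field_simps)
    finally show ?thesis .
  qed
  have codeg: "?N ^ 2 * (?N * p\<^sup>2) ^ q \<le> 1 / ?N"
  proof -
    have "?N * p\<^sup>2 \<le> ?N * (?N powr (- \<beta>))\<^sup>2" using p N by (intro mult_left_mono power_mono) auto
    also have "\<dots> = ?N powr (- (2 * \<beta> - 1))"
    proof -
      have "(?N powr (- \<beta>))\<^sup>2 = ?N powr (- 2 * \<beta>)"
        using N by (simp add: power2_eq_square powr_add[symmetric])
      then show ?thesis using N by (simp add: powr_mult_base algebra_simps)
    qed
    finally have "(?N * p\<^sup>2) ^ q \<le> (?N powr (- (2 * \<beta> - 1))) ^ q" using N by (intro power_mono) auto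
    also have "\<dots> = ?N powr (- ((2 * \<beta> - 1) * real q))"
      using N by (simp add: powr_realpow[symmetric] powr_powr algebra_simps)
    also have "\<dots> \<le> ?N powr (- 3)" using N q by (intro powr_mono) auto
    finally have "?N ^ 2 * (?N * p\<^sup>2) ^ q \<le> ?N ^ 2 * ?N powr (- 3)" by (intro mult_left_mono) auto
    also have "\<dots> = 1 / ?N" using N by (simp add: powr_minus power2_eq_square power3_eq_cube field_simps)
    finally show ?thesis .
  qed
  have "1 - ?N * (3 * ?N * p / real d) ^ d - ?N ^ 2 * (?N * p\<^sup>2) ^ q
      \<le> bprob (all_edges n) p (\<lambda>E. theta {1..n} E \<le> ?N powr ((1 - \<beta>) / 2 + \<kappa>))"
    by (rule theta_upper_tail[OF p(1,2) n \<Delta>(1) B d_def])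
  moreover have "1 - (3 ^ J + 1) / ?N = 1 - 3 ^ J / ?N - 1 / ?N" by (simp add: add_divide_distrib)
  ultimately show ?thesis using deg codeg by linarith
qed

lemma theta_concentrated:
  fixes \<beta> \<kappa> \<rho> s :: real and p :: "nat \<Rightarrow> real"
  assumes \<beta>: "1 / 2 < \<beta>" "\<beta> < 1" and s: "0 \<le> s"
    and \<rho>: "1 \<le> \<rho>" and \<kappa>: "0 < \<kappa>" "7 * \<kappa> \<le> \<beta>"
    and \<gamma>: "0 < (2 * \<beta> - 1 - 7 * \<kappa>) - (\<beta> - 7 * \<kappa>) / \<rho>"
    and cases: "(\<exists>D::nat. \<rho> = (real D + 1) / 2 \<and> real D + 1 \<le> s) \<or> (0 \<le> \<rho> \<and> \<rho> < 3 / 2 \<and> 2 \<le> s)"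
    and p: "\<forall>\<^sub>F n in sequentially. 2 / real n \<le> p n \<and> p n \<le> real n powr (- \<beta>)"
  shows "\<exists>u. (\<lambda>n. bprob (all_edges n) (p n)
    (\<lambda>E. u n \<le> theta {1..n} E \<and> theta {1..n} E \<le> u n + (s + 2 * real n powr (- \<kappa>)))) \<longlonglongrightarrow> 1"
proof -
  define \<gamma>' where "\<gamma>' = (2 * \<beta> - 1 - 7 * \<kappa>) - (\<beta> - 7 * \<kappa>) / \<rho>"
  define z where "z n = 9 * real n powr (- \<gamma>')" for n
  define err where "err n = 2 * real n powr (- \<kappa>) + 2 * z n" for n
  let ?pr = "\<lambda>n u. bprob (all_edges n) (p n)
    (\<lambda>E. u \<le> theta {1..n} E \<and> theta {1..n} E \<le> u + (s + 2 * real n powr (- \<kappa>)))"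
  obtain J :: nat where "2 / \<kappa> \<le> real J" using real_arch_simple by blast
  then have J: "2 \<le> \<kappa> * real J" using \<kappa> by (simp add: field_simps)
  obtain q :: nat where "3 / (2 * \<beta> - 1) \<le> real q" using real_arch_simple by blast
  then have q: "3 \<le> (2 * \<beta> - 1) * real q" using \<beta> by (simp add: field_simps)
  have \<kappa>2: "0 < \<kappa> / 2" and \<beta>\<kappa>: "0 < 1 - \<beta> + \<kappa>" using \<kappa> \<beta> by auto
  have ev: "\<forall>\<^sub>F n in sequentially. \<exists>u. 1 - err n \<le> ?pr n u"
    using p eventually_ge_at_top[of 2]
      eventually_le_powr[OF \<gamma>, of 18] eventually_le_powr[OF \<kappa>(1), of "10 / (3 - 2 * \<rho>)"]
      eventually_le_powr[OF \<kappa>(1), of 36] eventually_le_powr[OF \<kappa>2, of "1 + sqrt (1 + real q)"]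
      eventually_le_powr[OF \<beta>\<kappa>, of "real J"] eventually_ge_at_top[of "nat \<lceil>3 * (3 ^ J + 1 :: real)\<rceil>"]
  proof eventually_elim
    case (elim n)
    let ?N = "real n"
    have N: "2 \<le> ?N" using elim(2) by simp
    have n1: "1 \<le> n" using elim(2) by simp
    have p0: "0 \<le> p n" "p n \<le> ?N powr (- \<beta>)" "2 / ?N \<le> p n"
    proof -
      show "2 / ?N \<le> p n" "p n \<le> ?N powr (- \<beta>)" using elim(1) by auto
      then show "0 \<le> p n" using N by (meson divide_nonneg_nonneg order.trans of_nat_0_le_iff zero_le_numeral)
    qed
    have "?N powr (- \<beta>) \<le> ?N powr 0" using N \<beta> by (intro powr_mono) auto
    then have p1: "p n \<le> 1" using p0(2) N by simp
    \<comment> \<open>One small quantity serves both as slack in the parameter and as the level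
      \<open>e\<close> of the quantile and of the tail.\<close>
    define c where "c = ?N powr (- \<kappa>)"
    define B where "B = ?N powr ((1 - \<beta>) / 2 + \<kappa>)"
    have K: "36 \<le> ?N powr \<kappa>" using elim by blast
    have c: "0 < c" "c \<le> 1 / 36" using K N by (auto simp: c_def powr_minus field_simps)
    have B1: "1 \<le> B" unfolding B_def using N \<beta> \<kappa> by (intro ge_one_powr_ge_zero) auto
    have z: "z n \<le> 1 / 2"
    proof -
      have "18 \<le> ?N powr \<gamma>'" using elim(3) by (simp only: \<gamma>'_def)
      then have "9 / ?N powr \<gamma>' \<le> 9 / 18" by (intro frac_le) auto
      then show ?thesis by (simp add: z_def powr_minus_divide)
    qed
    have upper: "c < bprob (all_edges n) (p n) (\<lambda>E. theta {1..n} E \<le> B)"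
    proof -
      have "1 - (3 ^ J + 1) / ?N \<le> bprob (all_edges n) (p n) (\<lambda>E. theta {1..n} E \<le> B)"
        unfolding B_def
        by (rule bprob_theta_le_powr[OF n1 p0(1) p1 p0(2) \<beta>(2) \<kappa>(1) J q]) (use elim K \<kappa> \<beta> in auto)
      moreover have "(3 ^ J + 1) / ?N \<le> 1 / 3"
      proof -
        have "3 * (3 ^ J + 1) \<le> ?N" using elim by linarith
        then show ?thesis using N by (simp add: field_simps)
      qed
      ultimately show ?thesis using c by linarith
    qed
    have noedge: "bprob (all_edges n) (p n) (\<lambda>E. E = {}) < c"
    proof -
      have "bprob (all_edges n) (p n) (\<lambda>E. E = {}) \<le> exp (1 - ?N)"
        by (rule bprob_no_edge[OF n1 p0(3) p1])
      also have "\<dots> = 1 / exp (?N - 1)" by (simp add: exp_diff)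
      also have "\<dots> < 1 / ?N"
      proof (rule divide_strict_left_mono)
        have "0 < (?N - 1)\<^sup>2" using N by simp
        moreover have "1 + (?N - 1) + (?N - 1)\<^sup>2 / 2 \<le> exp (?N - 1)"
          using N by (intro exp_lower_Taylor_quadratic) simp
        ultimately show "?N < exp (?N - 1)" by linarith
      qed (use N in auto)
      also have "\<dots> = ?N powr (- 1)" using N by (simp add: powr_minus_divide)
      also have "\<dots> \<le> c" unfolding c_def using N \<kappa> \<beta> by (intro powr_mono) auto
      finally show ?thesis .
    qed
    \<comment> \<open>\<open>B\<^sup>2\<close> contributes \<open>2 * \<kappa>\<close> to the
      exponent, the three factors \<open>c\<close> contribute \<open>3 * \<kappa>\<close>, and the
      constant 36 is absorbed by a sixth \<open>\<kappa>\<close>.\<close>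
    have m: "4 * (B + 2 * c)\<^sup>2 / (c * c\<^sup>2) \<le> ?N powr (1 - \<beta> + 6 * \<kappa>)"
    proof -
      have "(B + 2 * c)\<^sup>2 \<le> (3 * B)\<^sup>2" using B1 c by (intro power_mono) auto
      then have "4 * (B + 2 * c)\<^sup>2 / (c * c\<^sup>2) \<le> 36 * B\<^sup>2 / (c * c\<^sup>2)"
        using c by (intro divide_right_mono) auto
      also have "36 * B\<^sup>2 / (c * c\<^sup>2) = 36 * ?N powr (1 - \<beta> + 5 * \<kappa>)"
      proof -
        have "B\<^sup>2 = ?N powr (1 - \<beta> + 2 * \<kappa>)"
          unfolding B_def power2_eq_square powr_add[symmetric] by (rule arg_cong[of _ _ "(powr) ?N"]) (simp add: field_simps)
        moreover have "c * c\<^sup>2 = ?N powr (- 3 * \<kappa>)"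
          unfolding c_def power2_eq_square powr_add[symmetric] by (rule arg_cong[of _ _ "(powr) ?N"]) simp
        moreover have "?N powr (1 - \<beta> + 2 * \<kappa>) / ?N powr (- 3 * \<kappa>) = ?N powr (1 - \<beta> + 5 * \<kappa>)"
          unfolding powr_diff[symmetric] by (rule arg_cong[of _ _ "(powr) ?N"]) simp
        ultimately show ?thesis by (simp only: times_divide_eq_right[symmetric])
      qed
      also have "\<dots> \<le> ?N powr \<kappa> * ?N powr (1 - \<beta> + 5 * \<kappa>)" using K by (intro mult_right_mono) auto
      also have "\<dots> = ?N powr (1 - \<beta> + 6 * \<kappa>)" by (simp add: powr_add[symmetric] algebra_simps)
      finally show ?thesis .
    qed
    have ext: "bprob (all_edges n) (p n) (\<lambda>E. \<not> extendable n (?N powr (1 - \<beta> + 6 * \<kappa>)) s E) \<le> 2 * z n"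
      by (rule bprob_not_extendable[OF n1 p0(1) p1 p0(2) \<rho> \<kappa> _ z \<beta>(2) cases])
        (use elim in \<open>auto simp: z_def \<gamma>'_def\<close>)
    have "\<exists>u. 1 - (2 * c + 2 * z n) \<le> bprob (all_edges n) (p n)
      (\<lambda>E. u \<le> theta {1..n} E \<and> theta {1..n} E \<le> u + (s + 2 * c))"
      by (rule theta_interval[OF p0(1) p1 c(1) _ c(1) s upper noedge m ext]) (use c in auto)
    then show ?case by (simp add: err_def c_def)
  qed
  define u where "u n = (SOME u. 1 - err n \<le> ?pr n u)" for n
  have lower: "\<forall>\<^sub>F n in sequentially. 1 - err n \<le> ?pr n (u n)"
    using ev by eventually_elim (unfold u_def, rule someI_ex)
  have upper: "\<forall>\<^sub>F n in sequentially. ?pr n (u n) \<le> 1"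
    using p eventually_ge_at_top[of 1]
  proof eventually_elim
    case (elim n)
    have "real n powr (- \<beta>) \<le> real n powr 0" using elim(2) \<beta> by (intro powr_mono) auto
    then have "p n \<le> 1" using elim by simp
    moreover have "0 \<le> p n" using elim by (meson divide_nonneg_nonneg order.trans of_nat_0_le_iff zero_le_numeral)
    ultimately show ?case by (intro bprob_le_1 finite_all_edges)
  qed
  have "(\<lambda>n. real n powr (- \<kappa>)) \<longlonglongrightarrow> 0" "(\<lambda>n. real n powr (- \<gamma>')) \<longlonglongrightarrow> 0"
    using \<kappa>(1) \<gamma> by (auto intro!: tendsto_neg_powr filterlim_real_sequentially simp: \<gamma>'_def)
  then have "(\<lambda>n. 1 - err n) \<longlonglongrightarrow> 1 - (2 * 0 + 2 * (9 * 0))"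
    unfolding err_def z_def by (intro tendsto_intros)
  then have "(\<lambda>n. 1 - err n) \<longlonglongrightarrow> 1" by simp
  from tendsto_sandwich[OF lower upper this tendsto_const]
  show ?thesis by blast
qed

end

section \<open>Transfer to the random graph model and conclusion\<close>

lemma gnp_prob_eq_bprob: "gnp_prob n p P = bprob (all_edges n) p P"
  unfolding gnp_prob_def bprob_def bexp_def by (intro sum.cong) auto

theorem theorem2:
  shows "\<exists>C>0. \<forall>c0\<ge>C. \<forall>\<beta>::real. 1/2 < \<beta> \<and> \<beta> < 1 \<longrightarrow>
    (\<exists>s::nat \<Rightarrow> real. s \<longlonglongrightarrow> 2 / (2 * \<beta> - 1) \<and>
      (\<forall>p::nat \<Rightarrow> real.
         (\<forall>\<^sub>F n in sequentially. c0 / real n \<le> p n \<and> p n \<le> real n powr (- \<beta>)) \<longrightarrow>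
         (\<exists>u u' u'' :: nat \<Rightarrow> real.
            (\<lambda>n. gnp_prob n (p n) (\<lambda>E.
                u n \<le> vtheta_half n E \<and> vtheta_half n E \<le> u n + s n \<and>
                u' n \<le> vtheta n E \<and> vtheta n E \<le> u' n + s n \<and>
                u'' n \<le> vtheta2 n E \<and> vtheta2 n E \<le> u'' n + s n))
            \<longlonglongrightarrow> 1)))"
\<comment> \<open>The constant 2 is the one in \<open>bprob_no_edge\<close>.\<close>
proof (intro exI[of _ "2::real"] conjI allI impI)
  fix c0 \<beta> :: real
  assume c0: "2 \<le> c0" and \<beta>01: "1/2 < \<beta> \<and> \<beta> < 1"
  then have \<beta>: "1 / 2 < \<beta>" "\<beta> < 1" by auto
  obtain \<rho> \<kappa> :: real where par: "1 \<le> \<rho>" "0 < \<kappa>" "7 * \<kappa> \<le> \<beta>"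
    "0 < (2 * \<beta> - 1 - 7 * \<kappa>) - (\<beta> - 7 * \<kappa>) / \<rho>"
    "(\<exists>D::nat. \<rho> = (real D + 1) / 2 \<and> real D + 1 \<le> 2 / (2 * \<beta> - 1)) \<or> (0 \<le> \<rho> \<and> \<rho> < 3 / 2 \<and> 2 \<le> 2 / (2 * \<beta> - 1))"
    by (rule sparsity_parameters[OF \<beta>])
  \<comment> \<open>\<open>\<kappa>\<close> depends on \<open>\<beta>\<close> alone, so
    \<open>s\<close> is fixed before \<open>p\<close> and is shared by all three parameters.\<close>
  define s where "s n = 2 / (2 * \<beta> - 1) + 2 * real n powr (- \<kappa>)" for n
  have "(\<lambda>n. real n powr (- \<kappa>)) \<longlonglongrightarrow> 0"
    using par(2) by (intro tendsto_neg_powr filterlim_real_sequentially) auto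
  then have "s \<longlonglongrightarrow> 2 / (2 * \<beta> - 1) + 2 * 0" unfolding s_def by (intro tendsto_intros)
  then have lim: "s \<longlonglongrightarrow> 2 / (2 * \<beta> - 1)" by simp
  have s0: "0 \<le> 2 / (2 * \<beta> - 1)" using \<beta> by simp
  have "\<exists>u u' u'' :: nat \<Rightarrow> real. (\<lambda>n. gnp_prob n (p n) (\<lambda>E.
      u n \<le> vtheta_half n E \<and> vtheta_half n E \<le> u n + s n \<and>
      u' n \<le> vtheta n E \<and> vtheta n E \<le> u' n + s n \<and>
      u'' n \<le> vtheta2 n E \<and> vtheta2 n E \<le> u'' n + s n)) \<longlonglongrightarrow> 1"
    if p: "\<forall>\<^sub>F n in sequentially. c0 / real n \<le> p n \<and> p n \<le> real n powr (- \<beta>)" for p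
  proof -
    have p2: "\<forall>\<^sub>F n in sequentially. 2 / real n \<le> p n \<and> p n \<le> real n powr (- \<beta>)"
      using p
    proof eventually_elim
      case (elim n)
      have "2 / real n \<le> c0 / real n" using c0 by (intro divide_right_mono) auto
      then show ?case using elim by linarith
    qed
    have p01: "\<forall>\<^sub>F n in sequentially. 0 \<le> p n \<and> p n \<le> 1"
      using p2 eventually_ge_at_top[of 1]
    proof eventually_elim
      case (elim n)
      have "real n powr (- \<beta>) \<le> real n powr 0" using elim(2) \<beta> by (intro powr_mono) auto
      then show ?case using elim
        by (auto intro: order.trans[of 0 "2 / real n"] simp: order.trans[of "p n"])
    qed
    note conc = \<beta> s0 par p2
    obtain u where u: "(\<lambda>n. bprob (all_edges n) (p n)
        (\<lambda>E. u n \<le> half.theta {1..n} E \<and> half.theta {1..n} E \<le> u n + s n)) \<longlonglongrightarrow> 1"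
      using half.theta_concentrated[OF conc] unfolding s_def by blast
    obtain u' where u': "(\<lambda>n. bprob (all_edges n) (p n)
        (\<lambda>E. u' n \<le> strict.theta {1..n} E \<and> strict.theta {1..n} E \<le> u' n + s n)) \<longlonglongrightarrow> 1"
      using strict.theta_concentrated[OF conc] unfolding s_def by blast
    obtain u'' where u'': "(\<lambda>n. bprob (all_edges n) (p n)
        (\<lambda>E. u'' n \<le> rigid.theta {1..n} E \<and> rigid.theta {1..n} E \<le> u'' n + s n)) \<longlonglongrightarrow> 1"
      using rigid.theta_concentrated[OF conc] unfolding s_def by blast
    define P where "P n E \<longleftrightarrow> u n \<le> half.theta {1..n} E \<and> half.theta {1..n} E \<le> u n + s n" for n E
    define P' where "P' n E \<longleftrightarrow> u' n \<le> strict.theta {1..n} E \<and> strict.theta {1..n} E \<le> u' n + s n" for n E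
    define P'' where "P'' n E \<longleftrightarrow> u'' n \<le> rigid.theta {1..n} E \<and> rigid.theta {1..n} E \<le> u'' n + s n" for n E
    let ?b = "\<lambda>n. bprob (all_edges n) (p n)"
    have eq: "gnp_prob n (p n) (\<lambda>E.
      u n \<le> vtheta_half n E \<and> vtheta_half n E \<le> u n + s n \<and>
      u' n \<le> vtheta n E \<and> vtheta n E \<le> u' n + s n \<and>
      u'' n \<le> vtheta2 n E \<and> vtheta2 n E \<le> u'' n + s n) = ?b n (\<lambda>E. P n E \<and> (P' n E \<and> P'' n E))" for n
      unfolding gnp_prob_eq_bprob bprob_def
      by (intro bexp_cong refl) (simp add: vtheta_half_eq vtheta_eq vtheta2_eq P_def P'_def P''_def)
    have "(\<lambda>n. ?b n (P n) + (?b n (P' n) + ?b n (P'' n) - 1) - 1) \<longlonglongrightarrow> 1 + (1 + 1 - 1) - 1"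
      using u u' u'' unfolding P_def P'_def P''_def by (intro tendsto_intros)
    then have low: "(\<lambda>n. ?b n (P n) + (?b n (P' n) + ?b n (P'' n) - 1) - 1) \<longlonglongrightarrow> 1" by simp
    have "(\<lambda>n. ?b n (\<lambda>E. P n E \<and> (P' n E \<and> P'' n E))) \<longlonglongrightarrow> 1"
    proof (rule tendsto_sandwich[OF _ _ low tendsto_const])
      show "\<forall>\<^sub>F n in sequentially. ?b n (P n) + (?b n (P' n) + ?b n (P'' n) - 1) - 1
          \<le> ?b n (\<lambda>E. P n E \<and> (P' n E \<and> P'' n E))"
        using p01
      proof eventually_elim
        case (elim n)
        then show ?case
          using bprob_conj[OF finite_all_edges, of "p n" n "P n" "\<lambda>E. P' n E \<and> P'' n E"]
            bprob_conj[OF finite_all_edges, of "p n" n "P' n" "P'' n"] by simp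
      qed
      show "\<forall>\<^sub>F n in sequentially. ?b n (\<lambda>E. P n E \<and> (P' n E \<and> P'' n E)) \<le> 1"
        using p01 by eventually_elim (simp add: bprob_le_1 finite_all_edges)
    qed
    then have "(\<lambda>n. gnp_prob n (p n) (\<lambda>E.
      u n \<le> vtheta_half n E \<and> vtheta_half n E \<le> u n + s n \<and>
      u' n \<le> vtheta n E \<and> vtheta n E \<le> u' n + s n \<and>
      u'' n \<le> vtheta2 n E \<and> vtheta2 n E \<le> u'' n + s n)) \<longlonglongrightarrow> 1" by (simp only: eq)
    then show ?thesis by blast
  qed
  then show "\<exists>s::nat \<Rightarrow> real. s \<longlonglongrightarrow> 2 / (2 * \<beta> - 1) \<and>
      (\<forall>p::nat \<Rightarrow> real.
         (\<forall>\<^sub>F n in sequentially. c0 / real n \<le> p n \<and> p n \<le> real n powr (- \<beta>)) \<longrightarrow>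
         (\<exists>u u' u'' :: nat \<Rightarrow> real.
            (\<lambda>n. gnp_prob n (p n) (\<lambda>E.
                u n \<le> vtheta_half n E \<and> vtheta_half n E \<le> u n + s n \<and>
                u' n \<le> vtheta n E \<and> vtheta n E \<le> u' n + s n \<and>
                u'' n \<le> vtheta2 n E \<and> vtheta2 n E \<le> u'' n + s n))
            \<longlonglongrightarrow> 1))"
    using lim by (intro exI[of _ s]) blast
qed simp

end
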